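(* Let $V$ be a complex vector space with $\dim V = n+1$, $n\geq 2$, and let $f \in S^{d} V$. The following statements are equivalent: (i) $f$ is reducible; (ii) for a generic linear subspace $E \subseteq V^*$ with $\dim E = 3$, the restriction $f|_E \in S^{d} E^*$ is reducible; (iii) for every linear subspace $E \subseteq V^*$ with $\dim E = 3$, the restriction $f|_E \in S^{d} E^*$ is reducible. Moreover, if $d\ge 3$, there exist finitely many linear subspaces $E_1, \dots, E_N \subseteq V^*$ with $\dim E_j = 3$ for every $j=1,\dots,N$, such that the ideal \[ I = I_{d^2-1}\bigl(\rho_{f|_{E_1}}^{(d-2)}\bigr) + \cdots + I_{d^2-1}\bigl(\rho_{f|_{E_N}}^{(d-2)}\bigr) \] cuts out the variety of reducible forms $\mathcal{R}_{n,d}^\bullet \subseteq \mathbb{P} S^d V$ set-theoretically.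
   Context: All vector spaces are finite-dimensional over $\mathbb{C}$. $S^dV$ is the $d$-th symmetric power of $V$, identified with the space of homogeneous polynomials of degree $d$ on $V^*$; $\mathrm{Sym}\,V=\bigoplus_d S^dV$. For a linear subspace $E\subseteq V^*$, $f|_E\in S^dE^*$ is the restriction of the polynomial function $f$ to $E$. A form $f\in S^dV$ is called reducible if $f=gh$ for some $g\in S^kV$, $h\in S^{d-k}V$ with $1\le k\le d-1$ (for $d\ge 2$ the zero form is thus counted as reducible). $\mathcal{R}^\bullet_{n,d}\subseteq \mathbb{P}S^dV$ is the variety of classes $[f]$ of nonzero reducible forms. "Generic $E$" means: for all $E$ in some nonempty Zariski open subset of the Grassmannian $\mathrm{Gr}(3,V^* )$. For a vector space $U$ with basis $x_0,\dots,x_m$ and dual basis $\partial_0,\dots,\partial_m$ of $U^*$, acting on $\mathrm{Sym}\,U$ by $\partial_i\cdot g=\partial g/\partial x_i$, and for $e\ge 1$, put \[ \mathfrak{sl}^{(e-1)}(U)=\Bigl\{\textstyle\sum_{i}\partial_i\otimes g_i \;:\; \sum_i \partial_i g_i=0\Bigr\}\subseteq U^*\otimes S^eU . \] For $F\in S^dU$ and $e\ge1$ the $e$-th Ruppert map is the linear map \[ \rho_F^{(e)}:\mathfrak{sl}^{(e-1)}(U)\to S^{e+d-1}U,\qquad \sum_i g_i\otimes\partial_i\mapsto \sum_i g_i\,\partial_iF . \] In the statement this is applied with $U=E_j^*$ (of dimension $3$), $F=f|_{E_j}$ and $e=d-2$; in this case $\dim \mathfrak{sl}^{(d-3)}(U)=d^2-1$.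 $I_{d^2-1}(\rho_{f|_{E_j}}^{(d-2)})$ denotes the ideal in $\mathbb{C}[S^dV]$ (polynomials in the coefficients of $f$) generated by the minors of size $d^2-1$ of a matrix representing $\rho_{f|_{E_j}}^{(d-2)}$. An ideal cuts out a variety set-theoretically if its zero locus in $\mathbb{P}S^dV$ equals that variety. *)

theory Defs
  imports
    "HOL-Analysis.Analysis"
    "HOL-Library.Function_Algebras"
    "HOL-Algebra.Ideal"
    "Jordan_Normal_Form.Determinant"
    "Jordan_Normal_Form.DL_Submatrix"
begin

text \<open>
  A complex vector space is a subspace \<open>W\<close> of an ambient type carrying a scalar multiplication
  \<open>s\<close> with \<open>vector_space s\<close>.  The spaces derived from it (duals, symmetric and exterior powers,
  coordinate rings) consist of functions, with the pointwise operations.  A function that lives on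
  \<open>W\<close> is represented by its extension by \<open>0\<close> outside \<open>W\<close>, so that equality of functions on \<open>W\<close> is
  equality.
\<close>

definition pointwise :: "(complex \<Rightarrow> 'b \<Rightarrow> 'b) \<Rightarrow> complex \<Rightarrow> ('a \<Rightarrow> 'b) \<Rightarrow> 'a \<Rightarrow> 'b" where
  "pointwise s c f = (\<lambda>x. s c (f x))"

abbreviation fscale :: "complex \<Rightarrow> ('a \<Rightarrow> complex) \<Rightarrow> 'a \<Rightarrow> complex" where
  "fscale \<equiv> pointwise (*)"

lemma vector_space_pointwise:
  assumes "vector_space s"
  shows "vector_space (pointwise s)"
proof -
  interpret vector_space s by (fact assms)
  show ?thesis
    by unfold_locales
      (auto simp: pointwise_def plus_fun_def fun_eq_iff scale_right_distrib scale_left_distrib)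
qed

lemma vector_space_fscale: "vector_space fscale"
  by (intro vector_space_pointwise) (unfold_locales, auto simp: algebra_simps)

definition restr :: "'a set \<Rightarrow> ('a \<Rightarrow> complex) \<Rightarrow> 'a \<Rightarrow> complex" where
  "restr W f = (\<lambda>x. if x \<in> W then f x else 0)"

definition dual :: "(complex \<Rightarrow> 'a \<Rightarrow> 'a) \<Rightarrow> 'a::ab_group_add set \<Rightarrow> ('a \<Rightarrow> complex) set" where
  "dual s W = {\<phi>. (\<forall>x\<in>W. \<forall>y\<in>W. \<phi> (x + y) = \<phi> x + \<phi> y) \<and>
                  (\<forall>c. \<forall>x\<in>W. \<phi> (s c x) = c * \<phi> x) \<and> (\<forall>x. x \<notin> W \<longrightarrow> \<phi> x = 0)}"

definition ordered_basis ::
    "(complex \<Rightarrow> 'a \<Rightarrow> 'a) \<Rightarrow> 'a::ab_group_add set \<Rightarrow> 'a list \<Rightarrow> bool" where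
  "ordered_basis s W bs \<longleftrightarrow>
     distinct bs \<and> \<not> module.dependent s (set bs) \<and> module.span s (set bs) = W"

text \<open>
  \<open>forms s W d\<close> is \<open>S\<^sup>d(W\<^sup>*)\<close>, as the space of homogeneous polynomial functions of degree \<open>d\<close> on \<open>W\<close>:
  the span of the products of \<open>d\<close> linear functionals.  Since \<open>\<complex>\<close> is infinite, polynomials and
  polynomial functions on \<open>W\<close> are the same thing.  For \<open>d = 0\<close> these are the constants.
  In particular, for \<open>W = V\<^sup>*\<close> and \<open>V\<close> finite-dimensional, \<open>forms s W d\<close> is \<open>S\<^sup>dV\<close>.
  \<open>polys s W\<close> is \<open>Sym(W\<^sup>*)\<close>, the sum of all \<open>S\<^sup>d(W\<^sup>*)\<close>, and \<open>coord_ring s W\<close> is the ring \<open>\<complex>[W]\<close>.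
\<close>

definition forms ::
    "(complex \<Rightarrow> 'a \<Rightarrow> 'a) \<Rightarrow> 'a::ab_group_add set \<Rightarrow> nat \<Rightarrow> ('a \<Rightarrow> complex) set" where
  "forms s W d = module.span fscale
     {restr W (\<lambda>x. \<Prod>i<d. \<phi> i x) | \<phi> :: nat \<Rightarrow> 'a \<Rightarrow> complex. \<forall>i<d. \<phi> i \<in> dual s W}"

definition polys :: "(complex \<Rightarrow> 'a \<Rightarrow> 'a) \<Rightarrow> 'a::ab_group_add set \<Rightarrow> ('a \<Rightarrow> complex) set" where
  "polys s W = module.span fscale (\<Union>d. forms s W d)"

definition coord_ring ::
    "(complex \<Rightarrow> 'a \<Rightarrow> 'a) \<Rightarrow> 'a::ab_group_add set \<Rightarrow> ('a \<Rightarrow> complex) ring" where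
  "coord_ring s W =
     \<lparr>carrier = polys s W, mult = (*), one = restr W (\<lambda>_. 1), zero = 0, add = (+)\<rparr>"

definition reducible ::
    "(complex \<Rightarrow> 'a \<Rightarrow> 'a) \<Rightarrow> 'a::ab_group_add set \<Rightarrow> nat \<Rightarrow> ('a \<Rightarrow> complex) \<Rightarrow> bool" where
  "reducible s W d f \<longleftrightarrow>
     (\<exists>k g h. 1 \<le> k \<and> k \<le> d - 1 \<and> g \<in> forms s W k \<and> h \<in> forms s W (d - k) \<and> f = g * h)"

text \<open>Points of \<open>\<P>W\<close> are the lines in \<open>W\<close>.\<close>

definition proj :: "(complex \<Rightarrow> 'a \<Rightarrow> 'a) \<Rightarrow> 'a::ab_group_add set \<Rightarrow> 'a set set" where
  "proj s W = {module.span s {w} | w. w \<in> W \<and> w \<noteq> 0}"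

definition zero_locus ::
    "(complex \<Rightarrow> 'a \<Rightarrow> 'a) \<Rightarrow> 'a::ab_group_add set \<Rightarrow> ('a \<Rightarrow> complex) set \<Rightarrow> 'a set set" where
  "zero_locus s W P = {L \<in> proj s W. \<forall>p\<in>P. \<forall>w\<in>L - {0}. p w = 0}"

definition reducible_variety ::
    "(complex \<Rightarrow> 'a \<Rightarrow> 'a) \<Rightarrow> 'a::ab_group_add set \<Rightarrow> nat \<Rightarrow> ('a \<Rightarrow> complex) set set" where
  "reducible_variety s W d =
     {module.span fscale {f} | f. f \<in> forms s W d \<and> f \<noteq> 0 \<and> reducible s W d f}"

definition Gr ::
    "(complex \<Rightarrow> 'a \<Rightarrow> 'a) \<Rightarrow> nat \<Rightarrow> 'a::ab_group_add set \<Rightarrow> 'a set set" where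
  "Gr s k W = {E. module.subspace s E \<and> E \<subseteq> W \<and> vector_space.dim s E = k}"

text \<open>
  The Zariski topology on the Grassmannian of the dual space \<open>V\<^sup>*\<close> of \<open>V\<close> (here \<open>V\<close> is a whole
  type) is the one induced by the Pluecker embedding.  A decomposable element
  \<open>w\<^sub>1 \<and> \<dots> \<and> w\<^sub>k\<close> of the exterior power of \<open>V\<^sup>*\<close> is the alternating form
  \<open>(v\<^sub>1, \<dots>, v\<^sub>k) \<mapsto> det (w\<^sub>j(v\<^sub>i))\<close> on \<open>V\<close>; the arguments are passed as a list, and
  lists of the wrong length are sent to \<open>0\<close>.
\<close>

definition wedge :: "('v \<Rightarrow> complex) list \<Rightarrow> 'v list \<Rightarrow> complex" where
  "wedge ws = (\<lambda>vs. if length vs = length ws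
     then Determinant.det (mat (length ws) (length ws) (\<lambda>(i, j). (ws ! j) (vs ! i))) else 0)"

definition ext_power_dual ::
    "(complex \<Rightarrow> 'v \<Rightarrow> 'v) \<Rightarrow> nat \<Rightarrow> ('v::ab_group_add list \<Rightarrow> complex) set" where
  "ext_power_dual s k =
     module.span fscale {wedge ws | ws. length ws = k \<and> set ws \<subseteq> dual s UNIV}"

definition pluecker :: "('v \<Rightarrow> complex) set \<Rightarrow> ('v list \<Rightarrow> complex) set" where
  "pluecker E = module.span fscale {wedge ws | ws. ordered_basis fscale E ws}"

definition zariski_closed_Gr ::
    "(complex \<Rightarrow> 'v \<Rightarrow> 'v) \<Rightarrow> nat \<Rightarrow> ('v::ab_group_add \<Rightarrow> complex) set set \<Rightarrow> bool" where
  "zariski_closed_Gr s k Z \<longleftrightarrow>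
     (\<exists>P \<subseteq> (\<Union>m. forms fscale (ext_power_dual s k) m).
        Z = {E \<in> Gr fscale k (dual s UNIV).
               pluecker E \<in> zero_locus fscale (ext_power_dual s k) P})"

definition zariski_open_Gr ::
    "(complex \<Rightarrow> 'v \<Rightarrow> 'v) \<Rightarrow> nat \<Rightarrow> ('v::ab_group_add \<Rightarrow> complex) set set \<Rightarrow> bool" where
  "zariski_open_Gr s k A \<longleftrightarrow>
     A \<subseteq> Gr fscale k (dual s UNIV) \<and> zariski_closed_Gr s k (Gr fscale k (dual s UNIV) - A)"

definition generic_Gr ::
    "(complex \<Rightarrow> 'v \<Rightarrow> 'v) \<Rightarrow> nat \<Rightarrow> (('v::ab_group_add \<Rightarrow> complex) set \<Rightarrow> bool) \<Rightarrow> bool" where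
  "generic_Gr s k Q \<longleftrightarrow> (\<exists>A. zariski_open_Gr s k A \<and> A \<noteq> {} \<and> (\<forall>E\<in>A. Q E))"

text \<open>
  Ruppert maps for \<open>U = E\<^sup>*\<close>.  The list \<open>es\<close> is a basis of \<open>E = U\<^sup>*\<close>, i.e. \<open>es ! i\<close> is \<open>\<partial>\<^sub>i\<close>, which acts
  on polynomial functions on \<open>E\<close> as the derivative in the direction \<open>es ! i\<close>.  An element
  \<open>\<Sum>\<^sub>i \<partial>\<^sub>i \<otimes> g\<^sub>i\<close> of \<open>U\<^sup>* \<otimes> S\<^sup>eU\<close> is represented by the sequence of its coefficients \<open>g\<^sub>i\<close>, continued by
  \<open>0\<close>.
\<close>

definition partial ::
    "(complex \<Rightarrow> 'a \<Rightarrow> 'a) \<Rightarrow> 'a::ab_group_add \<Rightarrow> ('a \<Rightarrow> complex) \<Rightarrow> 'a \<Rightarrow> complex" where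
  "partial s v F = (\<lambda>x. deriv (\<lambda>t. F (x + s t v)) 0)"

text \<open>\<open>sl_space s E es e\<close> is \<open>\<ss>\<ll>\<^sup>(\<^sup>e\<^sup>-\<^sup>1\<^sup>)(U)\<close>, a subspace of \<open>U\<^sup>* \<otimes> S\<^sup>eU\<close>.\<close>

definition sl_space :: "(complex \<Rightarrow> 'a \<Rightarrow> 'a) \<Rightarrow> 'a::ab_group_add set \<Rightarrow> 'a list \<Rightarrow> nat \<Rightarrow>
    (nat \<Rightarrow> 'a \<Rightarrow> complex) set" where
  "sl_space s E es e = {g. (\<forall>i<length es. g i \<in> forms s E e) \<and> (\<forall>i\<ge>length es. g i = 0) \<and>
     (\<Sum>i<length es. partial s (es ! i) (g i)) = 0}"

definition ruppert_map :: "(complex \<Rightarrow> 'a \<Rightarrow> 'a) \<Rightarrow> 'a::ab_group_add list \<Rightarrow> ('a \<Rightarrow> complex) \<Rightarrow>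
    (nat \<Rightarrow> 'a \<Rightarrow> complex) \<Rightarrow> 'a \<Rightarrow> complex" where
  "ruppert_map s es F g = (\<Sum>i<length es. g i * partial s (es ! i) F)"

definition matrix_wrt :: "('b \<Rightarrow> 'a \<Rightarrow> complex) \<Rightarrow> 'b list \<Rightarrow> ('a \<Rightarrow> complex) list \<Rightarrow> complex mat" where
  "matrix_wrt T bs cs = mat (length cs) (length bs)
     (\<lambda>(i, j). module.representation fscale (set cs) (T (bs ! j)) (cs ! i))"

text \<open>
  The choice of bases needed to write the \<open>e\<close>-th Ruppert map of a form of degree \<open>d\<close> on \<open>E\<close> as a
  matrix: bases of \<open>E\<close>, of the source, and of the target.
\<close>

definition ruppert_bases :: "(complex \<Rightarrow> 'a \<Rightarrow> 'a) \<Rightarrow> 'a::ab_group_add set \<Rightarrow> nat \<Rightarrow> nat \<Rightarrow>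
    'a list \<Rightarrow> (nat \<Rightarrow> 'a \<Rightarrow> complex) list \<Rightarrow> ('a \<Rightarrow> complex) list \<Rightarrow> bool" where
  "ruppert_bases s E d e es bs cs \<longleftrightarrow>
     ordered_basis s E es \<and>
     ordered_basis (pointwise fscale) (sl_space s E es e) bs \<and>
     ordered_basis fscale (forms s E (e + d - 1)) cs"

text \<open>
  The ideal of \<open>\<complex>[S\<^sup>d(W\<^sup>*)]\<close> generated by the minors of size \<open>r\<close> of the matrix of the Ruppert map of the
  restriction \<open>f|\<^sub>E\<close>, where \<open>f\<close> is the variable form of degree \<open>d\<close> on \<open>W\<close>.
\<close>

definition ruppert_minor_ideal :: "(complex \<Rightarrow> 'a \<Rightarrow> 'a) \<Rightarrow> 'a::ab_group_add set \<Rightarrow> nat \<Rightarrow> nat \<Rightarrow>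
    'a set \<Rightarrow> 'a list \<Rightarrow> (nat \<Rightarrow> 'a \<Rightarrow> complex) list \<Rightarrow> ('a \<Rightarrow> complex) list \<Rightarrow>
    (('a \<Rightarrow> complex) \<Rightarrow> complex) set" where
  "ruppert_minor_ideal s W d r E es bs cs =
     Idl\<^bsub>coord_ring fscale (forms s W d)\<^esub>
       {restr (forms s W d)
          (\<lambda>f. Determinant.det (submatrix (matrix_wrt (ruppert_map s es (restr E f)) bs cs) I J)) | I J.
        I \<subseteq> {..<length cs} \<and> card I = r \<and> J \<subseteq> {..<length bs} \<and> card J = r}"

definition ideal_sum :: "'r ring \<Rightarrow> 'r set list \<Rightarrow> 'r set" where
  "ideal_sum R Is = foldr (\<lambda>I J. I <+>\<^bsub>R\<^esub> J) Is {\<zero>\<^bsub>R\<^esub>}"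

end

theory Submission
  imports Defs "HOL-Computational_Algebra.Computational_Algebra" "HOL-Computational_Algebra.Field_as_Ring"
begin

text \<open>
  \<^bold>\<open>Bertini.\<close>  A factorization of \<open>f\<close> restricts to every \<open>E\<close>, and what holds for every \<open>E\<close> holds for
  generic \<open>E\<close>; the content is that reducible generic sections force \<open>f\<close> to be reducible.  Choose
  \<open>p\<^sub>1\<close> with \<open>f p\<^sub>1 \<noteq> 0\<close>.  For a suitable \<open>p\<^sub>0\<close> the polynomial \<open>f (x p\<^sub>1 + p\<^sub>0)\<close> has \<open>d\<close> distinct roots,
  unless the radical of \<open>f (x p\<^sub>1 + p\<^sub>0 + t v)\<close> is a proper factor in every direction \<open>v\<close>
  (\<open>exists_separable_line\<close>).  By Hensel's lemma the roots \<open>x\<close> of \<open>f (x p\<^sub>1 + p\<^sub>0 + t v)\<close> are power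
  series in \<open>t\<close>, and the coefficient of \<open>t\<^sup>m\<close> is a form of degree \<open>m\<close> in \<open>v\<close> (\<open>graded_roots\<close>).  A
  factorization in the direction \<open>v\<close> selects a set \<open>N\<close> of roots whose product is a polynomial of
  degree at most \<open>|N|\<close> in \<open>t\<close>.  There are finitely many sets, and forms vanishing at generic \<open>v\<close> vanish
  everywhere, so one \<open>N\<close> serves all \<open>v\<close>; the coefficients of \<open>t\<^bsup>|N|\<^esup>\<close> and of \<open>t\<^bsup>d - |N|\<^esup>\<close> in the product of
  the chosen and of the remaining roots are forms in \<open>v\<close>, and up to a constant their product is \<open>f\<close>
  (\<open>reducible_if_generic_directions_split\<close>).  The same argument covers the case of the radical.

  \<^bold>\<open>Ruppert's criterion.\<close>  In three variables and for \<open>d \<ge> 3\<close>, the form \<open>f\<close> is reducible if and only if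
  some non-zero divergence-free field of degree \<open>d - 2\<close> is tangent to \<open>f = 0\<close> in the strong sense that
  it annihilates \<open>f\<close>.  If \<open>f = G H\<close>, such a field is \<open>\<nabla>G \<times> \<nabla>H\<close> (\<open>tangent_field_reducible\<close>).
  Conversely, on an affine chart with equation \<open>F\<close> such a field corresponds to a form \<open>\<eta>\<close> for which
  \<open>\<eta> / F\<close> is closed.  Its residue along a root \<open>x = \<alpha> t\<close> of \<open>F\<close> is a constant \<open>\<mu>\<close>, and \<open>\<eta> - \<mu> dF\<close> vanishes
  along this root; if \<open>F\<close> is irreducible, then \<open>\<eta> = \<mu> dF\<close>, which the degrees only allow for \<open>\<eta> = 0\<close>
  (\<open>tangent_field_zero\<close>).  The divergence-free fields form a space of dimension \<open>d\<^sup>2 - 1\<close>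
  (\<open>sl_basis_length\<close>), so that the minors in question are maximal and vanish together exactly when the
  Ruppert map has a kernel (\<open>ruppert_minors_zero_iff\<close>).

  \<^bold>\<open>Finiteness.\<close>  By these two parts, \<open>f\<close> is reducible if and only if the minors for all \<open>E\<close> vanish at \<open>f\<close>.
  They all are forms of degree \<open>d\<^sup>2 - 1\<close> in the coefficients of \<open>f\<close>, hence lie in a space of
  finite dimension, and the minors for finitely many \<open>E\<close> span the others (\<open>finitely_many_sections\<close>).
\<close>

hide_const (open) Module.smult Coset.order
no_notation vec_index (infixl "$" 100)
unbundle no vec_syntax
unbundle fps_syntax

section \<open>Bivariate polynomials\<close>

text \<open>
  Polynomials in \<open>x\<close> and \<open>t\<close> are of type \<open>complex poly poly\<close>: \<open>x\<close> is the outer variable and the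
  coefficients are polynomials in \<open>t\<close>.
\<close>

lemma bivariate_eqI:
  fixes P Q :: "complex poly poly"
  assumes "\<And>x t. poly (poly P [:x:]) t = poly (poly Q [:x:]) t"
  shows "P = Q"
proof (rule ccontr)
  assume "P \<noteq> Q"
  then have fin: "finite {y. poly (P - Q) y = 0}"
    by (intro poly_roots_finite) simp
  have "poly P [:x:] = poly Q [:x:]" for x
    using assms[of x] by (auto simp: poly_eq_poly_eq_iff[symmetric])
  then have "range (\<lambda>x::complex. [:x:]) \<subseteq> {y. poly (P - Q) y = 0}"
    by auto
  moreover have "infinite (range (\<lambda>x::complex. [:x:]))"
    using infinite_UNIV_char_0 by (subst finite_image_iff) (auto intro: injI)
  ultimately show False
    using fin finite_subset by blast
qed

definition total_degree_le :: "nat \<Rightarrow> 'a::zero poly poly \<Rightarrow> bool" where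
  "total_degree_le k Q \<longleftrightarrow> (\<forall>i j. coeff (coeff Q i) j \<noteq> 0 \<longrightarrow> i + j \<le> k)"

lemma total_degree_leD: "total_degree_le k Q \<Longrightarrow> k < i + j \<Longrightarrow> coeff (coeff Q i) j = 0"
  unfolding total_degree_le_def by (metis leD)

lemma total_degree_le_degree:
  assumes "total_degree_le k Q"
  shows "degree Q \<le> k"
proof (rule degree_le, intro allI impI)
  fix i assume "k < i"
  then show "coeff Q i = 0"
    using assms by (intro poly_eqI) (auto simp: total_degree_leD)
qed

lemma total_degree_le_coeff:
  assumes "total_degree_le k Q" and "coeff Q i \<noteq> 0"
  shows "i + degree (coeff Q i) \<le> k"
  using assms by (meson leading_coeff_0_iff total_degree_le_def)

text \<open>
  Among the terms of highest total degree, the one of highest \<open>x\<close>-degree is singled out, because the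
  product of two such terms cannot cancel in the product of two polynomials.  Hence the total degree
  is additive.
\<close>

lemma top_term:
  fixes G :: "'a::idom poly poly"
  assumes "G \<noteq> 0"
  shows "\<exists>i. coeff G i \<noteq> 0 \<and> (\<forall>j. coeff G j \<noteq> 0 \<longrightarrow> j + degree (coeff G j) \<le> i + degree (coeff G i)) \<and>
    (\<forall>j. coeff G j \<noteq> 0 \<longrightarrow> i < j \<longrightarrow> j + degree (coeff G j) < i + degree (coeff G i))"
proof -
  define S where "S = {i. coeff G i \<noteq> 0}"
  define w where "w i = i + degree (coeff G i)" for i
  have fin: "finite S"
    unfolding S_def by (rule finite_subset[of _ "{..degree G}"]) (auto simp: le_degree)
  have ne: "S \<noteq> {}"
    using assms by (auto simp: S_def poly_eq_iff)
  define \<tau> where "\<tau> = Max (w ` S)"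
  define T where "T = {i\<in>S. w i = \<tau>}"
  have le: "w j \<le> \<tau>" if "j \<in> S" for j
    using fin that by (auto simp: \<tau>_def)
  have "\<tau> \<in> w ` S"
    unfolding \<tau>_def using fin ne by (intro Max_in) auto
  then have "T \<noteq> {}" "finite T"
    using fin by (auto simp: T_def)
  then have M: "Max T \<in> T" "\<And>j. j \<in> T \<Longrightarrow> j \<le> Max T"
    by auto
  show ?thesis
  proof (intro exI[of _ "Max T"] conjI allI impI)
    show "coeff G (Max T) \<noteq> 0" using M(1) by (auto simp: T_def S_def)
    show "j + degree (coeff G j) \<le> Max T + degree (coeff G (Max T))" if "coeff G j \<noteq> 0" for j
      using le[of j] M(1) that by (auto simp: T_def S_def w_def)
    show "j + degree (coeff G j) < Max T + degree (coeff G (Max T))"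
      if "coeff G j \<noteq> 0" "Max T < j" for j
    proof -
      have "j \<notin> T" using M(2)[of j] that by auto
      then have "w j < \<tau>" using le[of j] that by (auto simp: T_def S_def)
      then show ?thesis using M(1) by (auto simp: T_def w_def)
    qed
  qed
qed

text \<open>
  When the \<open>x\<close>-degree of a product equals its total degree, no factor can have a total degree above
  its own \<open>x\<close>-degree, since both degrees add up.
\<close>

lemma total_degree_factor:
  fixes G H :: "'a::idom poly poly"
  assumes td: "total_degree_le d (G * H)" and deg: "degree (G * H) = d" and nz: "G * H \<noteq> 0"
  shows "total_degree_le (degree G) G"
proof -
  have G: "G \<noteq> 0" and H: "H \<noteq> 0" using nz by auto
  obtain a where a: "coeff G a \<noteq> 0" "\<And>j. coeff G j \<noteq> 0 \<Longrightarrow> j + degree (coeff G j) \<le> a + degree (coeff G a)"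
    "\<And>j. coeff G j \<noteq> 0 \<Longrightarrow> a < j \<Longrightarrow> j + degree (coeff G j) < a + degree (coeff G a)"
    using top_term[OF G] by blast
  obtain b where b: "coeff H b \<noteq> 0" "\<And>j. coeff H j \<noteq> 0 \<Longrightarrow> j + degree (coeff H j) \<le> b + degree (coeff H b)"
    "\<And>j. coeff H j \<noteq> 0 \<Longrightarrow> b < j \<Longrightarrow> j + degree (coeff H j) < b + degree (coeff H b)"
    using top_term[OF H] by blast
  define m where "m = degree (coeff G a) + degree (coeff H b)"
  have zero: "coeff (coeff G i * coeff H (a + b - i)) m = 0" if "i \<le> a + b" "i \<noteq> a" for i
  proof (cases "coeff G i = 0 \<or> coeff H (a + b - i) = 0")
    case False
    then have "degree (coeff G i * coeff H (a + b - i)) = degree (coeff G i) + degree (coeff H (a + b - i))"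
      by (simp add: degree_mult_eq)
    also have "\<dots> < m"
    proof -
      define k where "k = a + b - i"
      have k: "i + k = a + b" using that by (simp add: k_def)
      have nz: "coeff G i \<noteq> 0" "coeff H k \<noteq> 0" using False by (auto simp: k_def)
      have 1: "i + degree (coeff G i) \<le> a + degree (coeff G a)" using a(2) nz by blast
      have 2: "k + degree (coeff H k) \<le> b + degree (coeff H b)" using b(2) nz by blast
      have 3: "a < i \<Longrightarrow> i + degree (coeff G i) < a + degree (coeff G a)" using a(3) nz by blast
      have 4: "b < k \<Longrightarrow> k + degree (coeff H k) < b + degree (coeff H b)" using b(3) nz by blast
      have "a < i \<or> b < k" using k that(2) by linarith
      then show ?thesis
        unfolding m_def k_def[symmetric] using 1 2 3 4 k by linarith
    qed
    finally show ?thesis by (rule coeff_eq_0)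
  qed auto
  have "coeff (coeff (G * H) (a + b)) m = (\<Sum>i\<le>a + b. coeff (coeff G i * coeff H (a + b - i)) m)"
    by (simp add: coeff_mult coeff_sum)
  also have "\<dots> = (\<Sum>i\<in>{a}. coeff (coeff G i * coeff H (a + b - i)) m)"
    using zero by (intro sum.mono_neutral_right) auto
  also have "\<dots> = lead_coeff (coeff G a) * lead_coeff (coeff H b)"
    by (simp add: m_def coeff_mult_degree_sum)
  finally have "coeff (coeff (G * H) (a + b)) m \<noteq> 0"
    using a(1) b(1) by simp
  then have le: "(a + degree (coeff G a)) + (b + degree (coeff H b)) \<le> d"
    using td unfolding total_degree_le_def m_def by fastforce
  have "degree H \<le> b + degree (coeff H b)"
    using b(2)[of "degree H"] H by auto
  moreover have "degree G + degree H = d"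
    using deg G H by (simp add: degree_mult_eq)
  ultimately have top: "a + degree (coeff G a) \<le> degree G"
    using le by linarith
  show ?thesis
    unfolding total_degree_le_def
  proof (intro allI impI)
    fix i j assume ij: "coeff (coeff G i) j \<noteq> 0"
    then have "j \<le> degree (coeff G i)" "coeff G i \<noteq> 0"
      by (auto intro: le_degree)
    then show "i + j \<le> degree G"
      using a(2)[of i] top by linarith
  qed
qed

lemma smult_left_cancel:
  fixes p q :: "'a::idom poly"
  assumes "c \<noteq> 0" "smult c p = smult c q"
  shows "p = q"
proof -
  have "smult c (p - q) = 0" using assms(2) by (simp add: smult_diff_right)
  then show ?thesis using assms(1) by simp
qed

text \<open>
  A non-zero polynomial of least \<open>x\<close>-degree in the ideal \<open>(P, Q)\<close> divides both generators up to
  factors free of \<open>x\<close>; by Gauss's lemma its primitive part is a common divisor.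
\<close>

lemma coprime_bezout:
  fixes P Q :: "complex poly poly"
  assumes "P \<noteq> 0" and cop: "\<And>D. D dvd P \<Longrightarrow> D dvd Q \<Longrightarrow> degree D = 0"
  obtains U V \<rho> where "\<rho> \<noteq> 0" "U * P + V * Q = [:\<rho>:]"
proof -
  define J where "J = {U * P + V * Q | U V. True}"
  have "P = 1 * P + 0 * Q" by simp
  then have PJ: "P \<in> J" unfolding J_def by blast
  have "Q = 0 * P + 1 * Q" by simp
  then have QJ: "Q \<in> J" unfolding J_def by blast
  define nz where "nz D \<longleftrightarrow> D \<in> J \<and> D \<noteq> 0" for D
  have "nz P" using PJ assms(1) by (simp add: nz_def)
  then obtain D where nzD: "nz D" and least: "\<And>E. nz E \<Longrightarrow> degree D \<le> degree E"
    using ex_has_least_nat[of nz P degree] by blast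
  have D: "D \<in> J" "D \<noteq> 0" using nzD by (simp_all add: nz_def)
  define pp where "pp = primitive_part D"
  have cpp: "content pp = 1" using D(2) by (simp add: pp_def)
  have Dpp: "smult (content D) pp = D" unfolding pp_def by (rule content_times_primitive_part)
  have dvd: "pp dvd S" if S: "S \<in> J" for S
  proof -
    obtain q r where qr: "pseudo_divmod S D = (q, r)" by force
    define c where "c = coeff D (degree D) ^ (Suc (degree S) - degree D)"
    have eq: "smult c S = D * q + r" and rr: "r = 0 \<or> degree r < degree D"
      using pseudo_divmod[OF D(2) qr] by (auto simp: c_def)
    obtain U V where S': "S = U * P + V * Q" using S unfolding J_def by blast
    obtain U' V' where D': "D = U' * P + V' * Q" using D(1) unfolding J_def by blast
    have "r = smult c S - D * q" using eq by simp
    also have "\<dots> = (smult c U - U' * q) * P + (smult c V - V' * q) * Q"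
      unfolding S' D' by (simp add: algebra_simps smult_add_right)
    finally have "r \<in> J" unfolding J_def by blast
    then have "r = 0" using rr least[of r] by (metis nz_def leD)
    then have "smult c S = smult (content D) pp * q"
      unfolding Dpp using eq by simp
    then have e: "smult c S = pp * smult (content D) q"
      by simp
    have c0: "c \<noteq> 0" using D(2) by (simp add: c_def)
    have "[:c:] * S = pp * smult (content D) q"
      using e by simp
    then have "[:c:] dvd pp * smult (content D) q"
      by (metis dvd_triv_left)
    then have "c dvd content (pp * smult (content D) q)"
      using const_poly_dvd_iff_dvd_content by blast
    then have "c dvd content (smult (content D) q)"
      by (simp add: content_mult cpp)
    then have "[:c:] dvd smult (content D) q"
      using const_poly_dvd_iff_dvd_content by blast
    then obtain q' where q': "smult (content D) q = [:c:] * q'" by (elim dvdE)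
    have "smult c S = pp * ([:c:] * q')" unfolding e q' ..
    also have "\<dots> = smult c (pp * q')" by simp
    finally have "smult c S = smult c (pp * q')" .
    then have "S = pp * q'" by (rule smult_left_cancel[OF c0])
    then show ?thesis by (rule dvdI)
  qed
  have "degree pp = 0"
    using cop[OF dvd[OF PJ] dvd[OF QJ]] .
  then have "degree D = 0" by (simp add: pp_def)
  then obtain \<rho> where \<rho>: "D = [:\<rho>:]" by (rule degree_eq_zeroE)
  obtain U V where UV: "D = U * P + V * Q" using D(1) unfolding J_def by blast
  show thesis
  proof (rule that)
    show "\<rho> \<noteq> 0" using D(2) \<rho> by simp
    show "U * P + V * Q = [:\<rho>:]" using UV \<rho> by (rule subst)
  qed
qed

section \<open>Products of linear factors\<close>

text \<open>
  A root of \<open>G H\<close> is a root of \<open>G\<close> or of \<open>H\<close>, so the linear factors can be cancelled one by one;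
  this replaces unique factorization over the ring of power series.
\<close>

lemma factor_of_linear_product:
  fixes \<alpha> :: "'i \<Rightarrow> 'a::idom"
  assumes "G * H = smult c (\<Prod>i\<in>#M. [:- \<alpha> i, 1:])" and "c \<noteq> 0"
  shows "\<exists>N u w. N \<subseteq># M \<and> G = smult u (\<Prod>i\<in>#N. [:- \<alpha> i, 1:]) \<and>
           H = smult w (\<Prod>i\<in>#M - N. [:- \<alpha> i, 1:])"
  using assms
proof (induction M arbitrary: G H)
  case empty
  then have "G \<noteq> 0" "H \<noteq> 0" by auto
  then have "degree G = 0" "degree H = 0"
    using arg_cong[OF empty(1), of degree] by (auto simp: degree_mult_eq)
  then obtain u w where "G = [:u:]" "H = [:w:]" by (metis degree_0_id)
  then show ?case by auto
next
  case (add i M)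
  let ?l = "[:- \<alpha> i, 1:]"
  have "poly (G * H) (\<alpha> i) = 0" unfolding add.prems by simp
  then consider "poly G (\<alpha> i) = 0" | "poly H (\<alpha> i) = 0" by auto
  then show ?case
  proof cases
    case 1
    then obtain G' where G': "G = ?l * G'" by (metis dvdE poly_eq_0_iff_dvd)
    have "?l * (G' * H) = ?l * smult c (\<Prod>i\<in>#M. [:- \<alpha> i, 1:])"
      using add.prems(1) by (simp add: G' mult.assoc del: mult_pCons_left)
    then have "G' * H = smult c (\<Prod>i\<in>#M. [:- \<alpha> i, 1:])"
      by (metis mult_left_cancel one_neq_zero pCons_eq_0_iff)
    from add.IH[OF this add.prems(2)] obtain N u w where
      "N \<subseteq># M" "G' = smult u (\<Prod>i\<in>#N. [:- \<alpha> i, 1:])" "H = smult w (\<Prod>i\<in>#M - N. [:- \<alpha> i, 1:])"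
      by blast
    then show ?thesis
      by (intro exI[of _ "add_mset i N"] exI[of _ u] exI[of _ w]) (simp add: G' del: mult_pCons_left)
  next
    case 2
    then obtain H' where H': "H = ?l * H'" by (metis dvdE poly_eq_0_iff_dvd)
    have "?l * (G * H') = ?l * smult c (\<Prod>i\<in>#M. [:- \<alpha> i, 1:])"
      using add.prems(1) by (simp add: H' mult.left_commute del: mult_pCons_left)
    then have "G * H' = smult c (\<Prod>i\<in>#M. [:- \<alpha> i, 1:])"
      by (metis mult_left_cancel one_neq_zero pCons_eq_0_iff)
    from add.IH[OF this add.prems(2)] obtain N u w where N:
      "N \<subseteq># M" "G = smult u (\<Prod>i\<in>#N. [:- \<alpha> i, 1:])" "H' = smult w (\<Prod>i\<in>#M - N. [:- \<alpha> i, 1:])"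
      by blast
    obtain K where "M = N + K" using N(1) by (metis subset_mset.le_iff_add)
    then have "add_mset i M - N = add_mset i (M - N)" by simp
    moreover have "N \<subseteq># add_mset i M"
      using N(1) by (metis add_mset_add_single mset_subset_eq_add_left subset_mset.order_trans)
    ultimately show ?thesis using N
      by (intro exI[of _ N] exI[of _ u] exI[of _ w]) (simp add: H' del: mult_pCons_left)
  qed
qed

lemma prod_linear_monic:
  fixes \<alpha> :: "'i \<Rightarrow> 'a::idom"
  shows "coeff (\<Prod>i\<in>#M. [:- \<alpha> i, 1:]) (size M) = 1" (is "?c M")
    and "degree (\<Prod>i\<in>#M. [:- \<alpha> i, 1:]) = size M" (is "?d M")
proof -
  have "?c M \<and> ?d M"
  proof (induction M)
    case (add i M)
    let ?P = "\<Prod>i\<in>#M. [:- \<alpha> i, 1:]"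
    have eq: "(\<Prod>i\<in>#add_mset i M. [:- \<alpha> i, 1:]) = pCons 0 ?P - smult (\<alpha> i) ?P"
      by (simp add: minus_poly_def)
    have P: "coeff ?P (size M) = 1" "degree ?P = size M" using add by blast+
    have top: "coeff (pCons 0 ?P - smult (\<alpha> i) ?P) (Suc (size M)) = 1"
      using P by (simp add: coeff_eq_0)
    have "coeff (pCons 0 ?P - smult (\<alpha> i) ?P) k = 0" if "Suc (size M) < k" for k
      using P that by (cases k) (simp_all add: coeff_eq_0)
    then have "degree (pCons 0 ?P - smult (\<alpha> i) ?P) \<le> Suc (size M)"
      by (intro degree_le) blast
    moreover have "Suc (size M) \<le> degree (pCons 0 ?P - smult (\<alpha> i) ?P)"
      using top by (intro le_degree) simp
    ultimately show ?case unfolding eq using top by simp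
  qed simp
  then show "?c M" "?d M" by blast+
qed

section \<open>Hensel's lemma for power series\<close>

lemma poly_taylor2:
  fixes P :: "'a::idom poly"
  shows "\<exists>R. poly P (B + h) = poly P B + h * poly (pderiv P) B + h\<^sup>2 * R"
proof (induction P)
  case (pCons a P)
  then obtain R where R: "poly P (B + h) = poly P B + h * poly (pderiv P) B + h\<^sup>2 * R" by blast
  show ?case
    by (rule exI[of _ "poly (pderiv P) B + (B + h) * R"])
      (simp add: R pderiv_pCons algebra_simps power2_eq_square)
qed auto

text \<open>
  The coefficient of \<open>t\<^sup>m\<close> in \<open>P(A)\<close> depends on that of \<open>A\<close> in an affine way, with slope \<open>P'(A)\<close> at
  \<open>t = 0\<close>.  Newton's iteration solves this equation for each \<open>m\<close> in turn.
\<close>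

lemma poly_fps_nth_truncated:
  fixes P :: "complex fps poly"
  assumes "\<And>j. j < m \<Longrightarrow> A $ j = B $ j" "0 < m"
  shows "poly P A $ m = poly P B $ m + (A $ m - B $ m) * poly (pderiv P) B $ 0"
    and "\<And>j. j < m \<Longrightarrow> poly P A $ j = poly P B $ j"
proof -
  define D where "D = fps_shift m (A - B)"
  have h: "A - B = fps_X ^ m * D"
    unfolding D_def
    by (rule fps_ext) (auto simp: fps_X_power_mult_nth assms)
  have A: "A = B + fps_X ^ m * D" using h by (simp add: algebra_simps)
  obtain R where "poly P A = poly P B + fps_X ^ m * D * poly (pderiv P) B + (fps_X ^ m * D)\<^sup>2 * R"
    unfolding A using poly_taylor2 by blast
  then have eq: "poly P A = poly P B + fps_X ^ m * (D * poly (pderiv P) B) + fps_X ^ (2 * m) * (D\<^sup>2 * R)"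
    by (simp only: power_mult_distrib power_mult[symmetric] mult.commute[of m 2] mult.assoc)
  show "poly P A $ m = poly P B $ m + (A $ m - B $ m) * poly (pderiv P) B $ 0"
    using \<open>0 < m\<close> by (simp add: eq fps_X_power_mult_nth D_def)
  show "poly P A $ j = poly P B $ j" if "j < m" for j
    using that by (simp add: eq fps_X_power_mult_nth)
qed

lemma poly_fps_nth_0: "poly P A $ 0 = poly P (fps_const (A $ 0)) $ 0"
  for P :: "complex fps poly"
  by (induction P) auto

lemma hensel:
  fixes P :: "complex fps poly"
  assumes "poly P (fps_const a) $ 0 = 0" "poly (pderiv P) (fps_const a) $ 0 \<noteq> 0"
  shows "\<exists>\<alpha>. \<alpha> $ 0 = a \<and> poly P \<alpha> = 0"
proof -
  define c where "c = poly (pderiv P) (fps_const a) $ 0"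
  define A where "A = rec_nat (fps_const a)
    (\<lambda>m B. B - fps_const (poly P B $ Suc m / c) * fps_X ^ Suc m)"
  \<comment> \<open>\<open>A m\<close> is a root modulo \<open>t\<close> to the power \<open>m + 1\<close>.\<close>
  have A0: "A 0 = fps_const a" and
    AS: "A (Suc m) = A m - fps_const (poly P (A m) $ Suc m / c) * fps_X ^ Suc m" for m
    by (simp_all add: A_def)
  have step: "A (Suc m) $ j = A m $ j" if "j \<le> m" for m j
    using that by (simp add: AS fps_X_power_nth del: power_Suc)
  have stab: "A n $ j = A j $ j" if "j \<le> n" for n j
    using that by (induction n rule: dec_induct) (auto simp: step)
  have A_0: "A n $ 0 = a" for n using stab[of 0 n] by (simp add: A0)
  have zero: "poly P (A m) $ j = 0" if "j \<le> m" for m j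
    using that
  proof (induction m arbitrary: j)
    case 0
    then show ?case using assms by (simp add: A0)
  next
    case (Suc m)
    have eq: "A (Suc m) $ i = A m $ i" if "i < Suc m" for i using step that by simp
    show ?case
    proof (cases "j = Suc m")
      case True
      have "poly (pderiv P) (A m) $ 0 = c"
        using poly_fps_nth_0[of "pderiv P" "A m"] by (simp add: A_0 c_def)
      moreover have "A (Suc m) $ Suc m - A m $ Suc m = - (poly P (A m) $ Suc m / c)"
        by (simp add: AS del: power_Suc)
      ultimately show ?thesis
        using poly_fps_nth_truncated(1)[of "Suc m" "A (Suc m)" "A m" P, OF eq] assms True
        by (simp add: c_def)
    next
      case False
      then show ?thesis
        using poly_fps_nth_truncated(2)[of "Suc m" "A (Suc m)" "A m" j P, OF eq] Suc by simp
    qed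
  qed
  define \<alpha> where "\<alpha> = Abs_fps (\<lambda>m. A m $ m)"
  have "poly P \<alpha> $ j = 0" for j
  proof -
    have "\<alpha> $ i = A (Suc j) $ i" if "i < Suc j" for i
      using stab[of i "Suc j"] that by (simp add: \<alpha>_def)
    then have "poly P \<alpha> $ j = poly P (A (Suc j)) $ j"
      using poly_fps_nth_truncated(2)[of "Suc j" \<alpha> "A (Suc j)" j P] by blast
    then show ?thesis using zero[of j "Suc j"] by simp
  qed
  then have "poly P \<alpha> = 0" by (intro fps_ext) simp
  then show ?thesis by (intro exI[of _ \<alpha>]) (simp add: \<alpha>_def A0)
qed

section \<open>Maximal minors\<close>

text \<open>Padded with zero rows, the matrix becomes a square one with determinant \<open>0\<close>.\<close>

lemma wide_kernel:
  fixes M :: "nat \<Rightarrow> nat \<Rightarrow> complex"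
  assumes "m < p"
  shows "\<exists>c. (\<exists>j<p. c j \<noteq> 0) \<and> (\<forall>i<m. (\<Sum>j<p. M i j * c j) = 0)"
proof -
  define N where "N = mat p p (\<lambda>(i, j). if i < m then M i j else 0)"
  have N: "N \<in> carrier_mat p p" by (simp add: N_def)
  have "N = mat\<^sub>r p p (\<lambda>i. if i = m then 0\<^sub>v p else row N i)"
    by (rule eq_matI) (auto simp: N_def)
  also have "Determinant.det \<dots> = 0"
    using assms N by (intro det_row_0) auto
  finally have "Determinant.det N = 0" .
  then obtain v where v: "v \<in> carrier_vec p" "v \<noteq> 0\<^sub>v p" "N *\<^sub>v v = 0\<^sub>v p"
    using det_0_iff_vec_prod_zero_field[OF N] by blast
  have "\<exists>j<p. vec_index v j \<noteq> 0"
  proof (rule ccontr)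
    assume "\<not> (\<exists>j<p. vec_index v j \<noteq> 0)"
    then have "v = 0\<^sub>v p" using v(1) by (intro eq_vecI) auto
    then show False using v(2) by contradiction
  qed
  moreover have "(\<Sum>j<p. M i j * vec_index v j) = 0" if "i < m" for i
  proof -
    have "vec_index (N *\<^sub>v v) i = 0" using v assms that by simp
    then show ?thesis
      using v assms that by (simp add: N_def scalar_prod_def atLeast0LessThan)
  qed
  ultimately show ?thesis by blast
qed

text \<open>
  A smallest set of rows whose joint kernel is still trivial has exactly \<open>m\<close> elements: with fewer
  rows there would be a kernel, and for each row there is a vector killed by all other rows only, so
  more than \<open>m\<close> rows would give too many independent vectors.
\<close>

lemma exists_maximal_minor:
  fixes A :: "nat \<Rightarrow> nat \<Rightarrow> complex"
  assumes inj: "\<And>x. (\<forall>i<n. (\<Sum>j<m. A i j * x j) = 0) \<Longrightarrow> (\<forall>j<m. x j = 0)"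
  shows "\<exists>I \<subseteq> {..<n}. card I = m \<and> Determinant.det (mat m m (\<lambda>(i, j). A (pick I i) j)) \<noteq> 0"
proof -
  define good where "good I \<longleftrightarrow> I \<subseteq> {..<n} \<and>
    (\<forall>x. (\<forall>i\<in>I. (\<Sum>j<m. A i j * x j) = 0) \<longrightarrow> (\<forall>j<m. x j = 0))" for I
  have "good {..<n}" using inj by (auto simp: good_def)
  then obtain I where I: "good I" "\<And>J. good J \<Longrightarrow> card I \<le> card J"
    using ex_has_least_nat[of good "{..<n}" card] by auto
  have fin: "finite I" using I(1) finite_subset by (auto simp: good_def)
  have "pick I k \<in> I" if "k < card I" for k
    using pick_in_set_le[OF that] .
  have surj: "\<exists>k<card I. pick I k = i" if "i \<in> I" for i
  proof (intro exI[of _ "card {a\<in>I. a < i}"] conjI)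
    show "card {a \<in> I. a < i} < card I"
      using fin that by (intro psubset_card_mono) auto
    show "pick I (card {a \<in> I. a < i}) = i" using pick_card_in_set[OF that] .
  qed
  have ker: "\<forall>j<m. x j = 0" if "\<And>k. k < card I \<Longrightarrow> (\<Sum>j<m. A (pick I k) j * x j) = 0" for x
    using I(1) surj that unfolding good_def by blast
  have ge: "m \<le> card I"
  proof (rule ccontr)
    assume "\<not> m \<le> card I"
    then obtain c where "\<exists>j<m. c j \<noteq> 0" "\<forall>i<card I. (\<Sum>j<m. A (pick I i) j * c j) = 0"
      using wide_kernel[of "card I" m "\<lambda>k. A (pick I k)"] by auto
    then show False using ker[of c] by blast
  qed
  have le: "card I \<le> m"
  proof (rule ccontr)
    assume less: "\<not> card I \<le> m"
    have "\<exists>x. (\<forall>j\<in>I - {i}. (\<Sum>l<m. A j l * x l) = 0) \<and> (\<Sum>l<m. A i l * x l) \<noteq> 0" if "i \<in> I" for i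
    proof -
      have "card (I - {i}) < card I" using fin that by (intro psubset_card_mono) auto
      then have "\<not> good (I - {i})" using I(2)[of "I - {i}"] by auto
      then obtain x where x: "\<forall>j\<in>I - {i}. (\<Sum>l<m. A j l * x l) = 0" "\<not> (\<forall>j<m. x j = 0)"
        using I(1) by (auto simp: good_def)
      then have "(\<Sum>l<m. A i l * x l) \<noteq> 0"
        using I(1) unfolding good_def by (metis Diff_iff singletonD)
      with x show ?thesis by blast
    qed
    then obtain X where X: "\<And>i j. i \<in> I \<Longrightarrow> j \<in> I - {i} \<Longrightarrow> (\<Sum>l<m. A j l * X i l) = 0"
      "\<And>i. i \<in> I \<Longrightarrow> (\<Sum>l<m. A i l * X i l) \<noteq> 0" by metis
    obtain c where c: "\<exists>k<card I. c k \<noteq> 0" "\<forall>l<m. (\<Sum>k<card I. X (pick I k) l * c k) = 0"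
      using wide_kernel[of m "card I" "\<lambda>l k. X (pick I k) l"] less by auto
    then obtain k0 where k0: "k0 < card I" "c k0 \<noteq> 0" by blast
    let ?i = "pick I k0"
    have pI: "pick I k \<in> I" if "k < card I" for k using pick_in_set_le[OF that] .
    have inj: "pick I k \<noteq> pick I k'" if "k < card I" "k' < card I" "k \<noteq> k'" for k k'
      using pick_mono_le[of k' I k] pick_mono_le[of k I k'] that by (cases "k < k'") auto
    have "0 = (\<Sum>l<m. A ?i l * (\<Sum>k<card I. X (pick I k) l * c k))" using c(2) by simp
    also have "\<dots> = (\<Sum>l<m. \<Sum>k<card I. A ?i l * X (pick I k) l * c k)"
      by (simp add: sum_distrib_left mult.assoc)
    also have "\<dots> = (\<Sum>k<card I. (\<Sum>l<m. A ?i l * X (pick I k) l) * c k)"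
      by (subst sum.swap) (simp add: sum_distrib_right)
    also have "\<dots> = (\<Sum>k\<in>{k0}. (\<Sum>l<m. A ?i l * X (pick I k) l) * c k)"
      using k0 X(1) pI inj by (intro sum.mono_neutral_right) auto
    finally show False using X(2)[OF pI[OF k0(1)]] k0 by simp
  qed
  have card: "card I = m" using ge le by simp
  define N where "N = mat m m (\<lambda>(i, j). A (pick I i) j)"
  have N: "N \<in> carrier_mat m m" by (simp add: N_def)
  have "Determinant.det N \<noteq> 0"
  proof
    assume "Determinant.det N = 0"
    then obtain v where v: "v \<in> carrier_vec m" "v \<noteq> 0\<^sub>v m" "N *\<^sub>v v = 0\<^sub>v m"
      using det_0_iff_vec_prod_zero_field[OF N] by blast
    have "(\<Sum>j<m. A (pick I k) j * vec_index v j) = 0" if "k < card I" for k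
    proof -
      have "vec_index (N *\<^sub>v v) k = 0" using v card that by simp
      then show ?thesis
        using v card that by (simp add: N_def scalar_prod_def atLeast0LessThan)
    qed
    then have "\<forall>j<m. vec_index v j = 0" by (rule ker)
    then have "v = 0\<^sub>v m" using v(1) by (intro eq_vecI) auto
    then show False using v(2) by contradiction
  qed
  moreover have "I \<subseteq> {..<n}" using I(1) unfolding good_def by blast
  ultimately show ?thesis using card unfolding N_def by blast
qed

section \<open>Forms on a complex vector space\<close>

global_interpretation FS: vector_space "fscale :: complex \<Rightarrow> ('a \<Rightarrow> complex) \<Rightarrow> 'a \<Rightarrow> complex"
  by (rule vector_space_fscale)

text \<open>
  The pointwise operations on functions are unfolded only on demand: the spaces of forms are treated
  as abstract subspaces of a ring of functions.
\<close>

lemma fscale_apply: "fscale c f x = c * f x"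
  by (simp add: pointwise_def)

lemma restr_apply: "restr W f x = (if x \<in> W then f x else 0)"
  by (simp add: restr_def)

lemmas fun_simps = restr_apply fscale_apply plus_fun_apply zero_fun_apply times_fun_apply minus_apply

declare plus_fun_apply [simp del] zero_fun_apply [simp del] times_fun_apply [simp del]
  minus_apply [simp del]

text \<open>A subspace \<open>W\<close> of an ambient vector space; functions on \<open>W\<close> are \<open>0\<close> outside of it.\<close>

locale cspace =
  fixes s :: "complex \<Rightarrow> 'a::ab_group_add \<Rightarrow> 'a" and W :: "'a set"
  assumes vs: "vector_space s" and sub: "module.subspace s W"
begin

sublocale S: vector_space s by (rule vs)

lemma mem_add: "x \<in> W \<Longrightarrow> y \<in> W \<Longrightarrow> x + y \<in> W"
  using sub by (rule S.subspace_add)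

lemma mem_scale: "x \<in> W \<Longrightarrow> s c x \<in> W"
  using sub by (rule S.subspace_scale)

lemma mem_0: "0 \<in> W"
  using sub by (rule S.subspace_0)

lemma mem_diff: "x \<in> W \<Longrightarrow> y \<in> W \<Longrightarrow> x - y \<in> W"
  using sub by (rule S.subspace_diff)

lemma mem_sum: "(\<And>i. i \<in> I \<Longrightarrow> x i \<in> W) \<Longrightarrow> (\<Sum>i\<in>I. x i) \<in> W"
  using sub by (rule S.subspace_sum)

lemma mem_add_iff: "v \<in> W \<Longrightarrow> x + v \<in> W \<longleftrightarrow> x \<in> W"
  using mem_add mem_diff by fastforce

lemma dual_add: "\<phi> \<in> dual s W \<Longrightarrow> x \<in> W \<Longrightarrow> y \<in> W \<Longrightarrow> \<phi> (x + y) = \<phi> x + \<phi> y"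
  by (auto simp: dual_def)

lemma dual_scale: "\<phi> \<in> dual s W \<Longrightarrow> x \<in> W \<Longrightarrow> \<phi> (s c x) = c * \<phi> x"
  by (auto simp: dual_def)

lemma dual_outside: "\<phi> \<in> dual s W \<Longrightarrow> x \<notin> W \<Longrightarrow> \<phi> x = 0"
  by (auto simp: dual_def)

lemma dual_0: "\<phi> \<in> dual s W \<Longrightarrow> \<phi> 0 = 0"
  using dual_scale[of \<phi> 0 0] mem_0 by simp

lemma dual_sum:
  assumes "\<phi> \<in> dual s W" "finite I" "\<And>i. i \<in> I \<Longrightarrow> x i \<in> W"
  shows "\<phi> (\<Sum>i\<in>I. x i) = (\<Sum>i\<in>I. \<phi> (x i))"
  using assms(2,3)
proof (induction I rule: finite_induct)
  case empty
  then show ?case using dual_0[OF assms(1)] by simp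
next
  case (insert i I)
  then show ?case using dual_add[OF assms(1)] by (simp add: mem_sum)
qed

lemma subspace_dual: "FS.subspace (dual s W)"
  by (rule FS.subspaceI) (auto simp: fun_simps dual_def algebra_simps)

lemma subspace_forms: "FS.subspace (forms s W k)"
  unfolding forms_def by (rule FS.subspace_span)

lemmas forms_zero = FS.subspace_0[OF subspace_forms]
lemmas forms_add = FS.subspace_add[OF subspace_forms]
lemmas forms_diff = FS.subspace_diff[OF subspace_forms]
lemmas forms_scale = FS.subspace_scale[OF subspace_forms]
lemmas forms_sum = FS.subspace_sum[OF subspace_forms]

lemma forms_gen: "(\<And>i. i < k \<Longrightarrow> \<phi> i \<in> dual s W) \<Longrightarrow> restr W (\<lambda>x. \<Prod>i<k. \<phi> i x) \<in> forms s W k"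
  unfolding forms_def by (rule FS.span_base) blast

lemma forms_one: "restr W (\<lambda>_. 1) \<in> forms s W 0"
  using forms_gen[of 0] by simp

lemma forms_const: "restr W (\<lambda>_. c) \<in> forms s W 0"
proof -
  have "restr W (\<lambda>_. c) = fscale c (restr W (\<lambda>_. 1))"
    by (rule ext) (simp add: fun_simps)
  then show ?thesis using forms_scale[OF forms_one] by simp
qed

lemma restr_prod_Suc:
  assumes "\<phi> k \<in> dual s W"
  shows "restr W (\<lambda>x. \<Prod>i<Suc k. \<phi> i x) = \<phi> k * restr W (\<lambda>x. \<Prod>i<k. \<phi> i x)"
  by (rule ext) (simp add: fun_simps mult.commute)

lemma forms_mult_dual:
  assumes \<phi>: "\<phi> \<in> dual s W" and g: "g \<in> forms s W k"
  shows "\<phi> * g \<in> forms s W (Suc k)"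
  using g[unfolded forms_def]
proof (induction rule: FS.span_induct)
  case (step g)
  then obtain \<psi> where \<psi>: "g = restr W (\<lambda>x. \<Prod>i<k. \<psi> i x)" "\<forall>i<k. \<psi> i \<in> dual s W" by blast
  define \<psi>' where "\<psi>' = \<psi>(k := \<phi>)"
  have "restr W (\<lambda>x. \<Prod>i<Suc k. \<psi>' i x) \<in> forms s W (Suc k)"
    using \<phi> \<psi>(2) by (intro forms_gen) (auto simp: \<psi>'_def less_Suc_eq)
  also have "restr W (\<lambda>x. \<Prod>i<Suc k. \<psi>' i x) = \<psi>' k * restr W (\<lambda>x. \<Prod>i<k. \<psi>' i x)"
    using \<phi> by (intro restr_prod_Suc) (simp add: \<psi>'_def)
  also have "\<dots> = \<phi> * g"
    by (simp add: \<psi>'_def \<psi>(1) restr_def)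
  finally show ?case .
next
  case base
  show ?case
  proof (rule FS.subspaceI)
    show "0 \<in> {g. \<phi> * g \<in> forms s W (Suc k)}" using forms_zero by simp
  next
    fix x y assume "x \<in> {g. \<phi> * g \<in> forms s W (Suc k)}" "y \<in> {g. \<phi> * g \<in> forms s W (Suc k)}"
    then show "x + y \<in> {g. \<phi> * g \<in> forms s W (Suc k)}"
      using forms_add by (simp add: distrib_left)
  next
    fix c x assume "x \<in> {g. \<phi> * g \<in> forms s W (Suc k)}"
    moreover have "\<phi> * fscale c x = fscale c (\<phi> * x)" by (rule ext) (simp add: fun_simps)
    ultimately show "fscale c x \<in> {g. \<phi> * g \<in> forms s W (Suc k)}"
      using forms_scale by simp
  qed
qed

text \<open>
  A property of all forms only has to be checked on constants, on multiples by a linear form and on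
  linear combinations.
\<close>

lemma forms_induct [consumes 1, case_names zero add scale one mult]:
  assumes "g \<in> forms s W k"
    and zero: "\<And>k. P k 0"
    and add: "\<And>k g h. g \<in> forms s W k \<Longrightarrow> h \<in> forms s W k \<Longrightarrow> P k g \<Longrightarrow> P k h \<Longrightarrow> P k (g + h)"
    and scale: "\<And>k c g. g \<in> forms s W k \<Longrightarrow> P k g \<Longrightarrow> P k (fscale c g)"
    and one: "P 0 (restr W (\<lambda>_. 1))"
    and mult: "\<And>k \<phi> g. \<phi> \<in> dual s W \<Longrightarrow> g \<in> forms s W k \<Longrightarrow> P k g \<Longrightarrow> P (Suc k) (\<phi> * g)"
  shows "P k g"
proof -
  have gen: "P k (restr W (\<lambda>x. \<Prod>i<k. \<phi> i x))" if "\<forall>i<k. \<phi> i \<in> dual s W" for k and \<phi> :: "nat \<Rightarrow> 'a \<Rightarrow> complex"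
    using that
  proof (induction k)
    case 0
    then show ?case using one by simp
  next
    case (Suc k)
    have "P (Suc k) (\<phi> k * restr W (\<lambda>x. \<Prod>i<k. \<phi> i x))"
      by (intro mult forms_gen Suc.IH) (use Suc.prems in auto)
    moreover have "restr W (\<lambda>x. \<Prod>i<Suc k. \<phi> i x) = \<phi> k * restr W (\<lambda>x. \<Prod>i<k. \<phi> i x)"
      using Suc.prems by (intro restr_prod_Suc) simp
    ultimately show ?case by (simp only:)
  qed
  have "g \<in> forms s W k \<and> P k g"
    using assms(1)[unfolded forms_def]
  proof (induction rule: FS.span_induct)
    case (step g)
    then obtain \<phi> where "g = restr W (\<lambda>x. \<Prod>i<k. \<phi> i x)" "\<forall>i<k. \<phi> i \<in> dual s W" by blast
    then show ?case using gen[of k \<phi>] forms_gen[of k \<phi>] by blast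
  next
    case base
    show ?case
      by (rule FS.subspaceI) (auto intro: zero add scale forms_zero forms_add forms_scale)
  qed
  then show ?thesis ..
qed

lemma forms_outside: "g \<in> forms s W k \<Longrightarrow> x \<notin> W \<Longrightarrow> g x = 0"
  by (induction rule: forms_induct) (auto simp: fun_simps)

lemma forms_homogeneous: "g \<in> forms s W k \<Longrightarrow> x \<in> W \<Longrightarrow> g (s c x) = c ^ k * g x"
  by (induction rule: forms_induct) (auto simp: fun_simps dual_scale mem_scale algebra_simps)

lemma forms_one_mult: "g \<in> forms s W k \<Longrightarrow> restr W (\<lambda>_. 1) * g = g"
  by (rule ext) (auto simp: fun_simps forms_outside)

lemma forms_mult: "g \<in> forms s W k \<Longrightarrow> h \<in> forms s W l \<Longrightarrow> g * h \<in> forms s W (k + l)"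
proof (induction rule: forms_induct)
  case (zero k)
  then show ?case by (simp add: forms_zero)
next
  case (add k g g')
  then show ?case by (simp add: distrib_right forms_add)
next
  case (scale k c g)
  have "fscale c g * h = fscale c (g * h)" by (rule ext) (simp add: fun_simps)
  then show ?case using scale by (simp add: forms_scale)
next
  case one
  then show ?case by (simp add: forms_one_mult)
next
  case (mult k \<phi> g)
  then show ?case using forms_mult_dual by (simp add: mult.assoc)
qed

lemma dual_forms: "\<phi> \<in> dual s W \<Longrightarrow> \<phi> \<in> forms s W 1"
proof -
  assume \<phi>: "\<phi> \<in> dual s W"
  have "\<phi> * restr W (\<lambda>_. 1) = \<phi>"
    by (rule ext) (simp add: fun_simps dual_outside[OF \<phi>])
  then show ?thesis using forms_mult_dual[OF \<phi> forms_one] by simp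
qed

lemma forms_power: "g \<in> forms s W k \<Longrightarrow> restr W (\<lambda>x. g x ^ m) \<in> forms s W (m * k)"
proof (induction m)
  case 0
  then show ?case by (simp add: forms_one)
next
  case (Suc m)
  have "restr W (\<lambda>x. g x ^ Suc m) = g * restr W (\<lambda>x. g x ^ m)"
    by (rule ext) (simp add: fun_simps)
  then show ?case using forms_mult[OF Suc.prems Suc.IH[OF Suc.prems]] by (simp add: add.commute)
qed

lemma dual_restrict:
  assumes "S.subspace E" "E \<subseteq> W" "\<phi> \<in> dual s W"
  shows "restr E \<phi> \<in> dual s E"
  using assms S.subspace_add[OF assms(1)] S.subspace_scale[OF assms(1)] by (auto simp: dual_def restr_def subset_iff)

lemma forms_restrict:
  assumes E: "S.subspace E" "E \<subseteq> W" and f: "f \<in> forms s W k"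
  shows "restr E f \<in> forms s E k"
proof -
  interpret E: cspace s E by unfold_locales (use vs E in auto)
  show ?thesis
    using f
  proof (induction rule: forms_induct)
    case (zero k)
    have "restr E 0 = 0" by (rule ext) (simp add: fun_simps)
    then show ?case using E.forms_zero by simp
  next
    case (add k g h)
    have "restr E (g + h) = restr E g + restr E h" by (rule ext) (simp add: fun_simps)
    then show ?case using E.forms_add add by simp
  next
    case (scale k c g)
    have "restr E (fscale c g) = fscale c (restr E g)" by (rule ext) (simp add: fun_simps)
    then show ?case using E.forms_scale scale by simp
  next
    case one
    have "restr E (restr W (\<lambda>_. 1)) = restr E (\<lambda>_. 1)"
      using E by (intro ext) (auto simp: restr_def)
    then show ?case using E.forms_one by simp
  next
    case (mult k \<phi> g)
    have "restr E (\<phi> * g) = restr E \<phi> * restr E g" by (rule ext) (simp add: fun_simps)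
    then show ?case using E.forms_mult_dual mult dual_restrict E by simp
  qed
qed

section \<open>Restriction of a form to a plane\<close>

text \<open>
  \<open>bip p\<^sub>1 p\<^sub>0 v g\<close> is the polynomial \<open>g (x p\<^sub>1 + p\<^sub>0 + t v)\<close>, that is, \<open>g\<close> on an affine chart of the
  span of \<open>p\<^sub>1\<close>, \<open>p\<^sub>0\<close>, \<open>v\<close>.  The vectors \<open>p\<^sub>1\<close> and \<open>p\<^sub>0\<close> stay fixed, and the coefficient of \<open>x\<^sup>i t\<^sup>j\<close> is
  then a form of degree \<open>j\<close> in \<open>v\<close>; to make this literally true it is \<open>0\<close> for \<open>v\<close> outside of \<open>W\<close>.
  \<open>lin_bip\<close> is the case of a linear form.
\<close>

definition lin_bip :: "'a \<Rightarrow> 'a \<Rightarrow> 'a \<Rightarrow> ('a \<Rightarrow> complex) \<Rightarrow> complex poly poly" where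
  "lin_bip p1 p0 v \<phi> = [:[:\<phi> p0, \<phi> v:], [:\<phi> p1:]:]"

definition bip :: "'a \<Rightarrow> 'a \<Rightarrow> 'a \<Rightarrow> ('a \<Rightarrow> complex) \<Rightarrow> complex poly poly" where
  "bip p1 p0 v g = (if v \<in> W
     then THE Q. \<forall>x t. poly (poly Q [:x:]) t = g (s x p1 + p0 + s t v) else 0)"

lemma bip_eqI:
  assumes "v \<in> W" "\<And>x t. poly (poly Q [:x:]) t = g (s x p1 + p0 + s t v)"
  shows "bip p1 p0 v g = Q"
proof -
  have "(THE Q. \<forall>x t. poly (poly Q [:x:]) t = g (s x p1 + p0 + s t v)) = Q"
    by (rule the_equality) (use assms(2) in \<open>auto intro: bivariate_eqI\<close>)
  then show ?thesis using assms(1) by (simp add: bip_def)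
qed

lemma bip_outside: "v \<notin> W \<Longrightarrow> bip p1 p0 v g = 0"
  by (simp add: bip_def)

context
  fixes p1 p0 assumes p: "p1 \<in> W" "p0 \<in> W"
begin

lemma mem_plane: "v \<in> W \<Longrightarrow> s x p1 + p0 + s t v \<in> W"
  using p by (simp add: mem_add mem_scale)

lemma poly_lin_bip:
  assumes "\<phi> \<in> dual s W" "v \<in> W"
  shows "poly (poly (lin_bip p1 p0 v \<phi>) [:x:]) t = \<phi> (s x p1 + p0 + s t v)"
  using assms p by (simp add: lin_bip_def dual_add dual_scale mem_add mem_scale algebra_simps)

lemma bip_exists:
  assumes "g \<in> forms s W k" "v \<in> W"
  shows "\<exists>Q. \<forall>x t. poly (poly Q [:x:]) t = g (s x p1 + p0 + s t v)"
  using assms(1)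
proof (induction rule: forms_induct)
  case (zero k)
  show ?case by (intro exI[of _ 0]) (simp add: fun_simps)
next
  case (add k g h)
  then obtain Q R where "\<forall>x t. poly (poly Q [:x:]) t = g (s x p1 + p0 + s t v)"
    "\<forall>x t. poly (poly R [:x:]) t = h (s x p1 + p0 + s t v)" by blast
  then show ?case by (intro exI[of _ "Q + R"]) (simp add: fun_simps)
next
  case (scale k c g)
  then obtain Q where "\<forall>x t. poly (poly Q [:x:]) t = g (s x p1 + p0 + s t v)" by blast
  then show ?case by (intro exI[of _ "smult [:c:] Q"]) (simp add: fun_simps)
next
  case one
  then show ?case using mem_plane[OF assms(2)] by (intro exI[of _ 1]) (simp add: restr_def)
next
  case (mult k \<phi> g)
  then obtain Q where "\<forall>x t. poly (poly Q [:x:]) t = g (s x p1 + p0 + s t v)" by blast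
  then show ?case
    using poly_lin_bip[OF mult(1) assms(2)]
    by (intro exI[of _ "lin_bip p1 p0 v \<phi> * Q"]) (simp add: fun_simps)
qed

lemma poly_bip:
  assumes "g \<in> forms s W k" "v \<in> W"
  shows "poly (poly (bip p1 p0 v g) [:x:]) t = g (s x p1 + p0 + s t v)"
proof -
  obtain Q where Q: "\<forall>x t. poly (poly Q [:x:]) t = g (s x p1 + p0 + s t v)"
    using bip_exists[OF assms] by blast
  then have "bip p1 p0 v g = Q" by (intro bip_eqI assms(2)) auto
  then show ?thesis using Q by simp
qed

lemma bip_add:
  assumes "g \<in> forms s W k" "h \<in> forms s W l"
  shows "bip p1 p0 v (g + h) = bip p1 p0 v g + bip p1 p0 v h"
proof (cases "v \<in> W")
  case True
  then show ?thesis by (intro bip_eqI) (use assms in \<open>simp_all add: fun_simps poly_bip\<close>)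
qed (simp add: bip_outside)

lemma bip_scale:
  assumes "g \<in> forms s W k"
  shows "bip p1 p0 v (fscale c g) = smult [:c:] (bip p1 p0 v g)"
proof (cases "v \<in> W")
  case True
  then show ?thesis by (intro bip_eqI) (use assms in \<open>simp_all add: fun_simps poly_bip\<close>)
qed (simp add: bip_outside)

lemma bip_0: "bip p1 p0 v 0 = 0"
proof (cases "v \<in> W")
  case True
  then show ?thesis by (intro bip_eqI) (simp_all add: fun_simps)
qed (simp add: bip_outside)

lemma bip_one: "v \<in> W \<Longrightarrow> bip p1 p0 v (restr W (\<lambda>_. 1)) = 1"
  by (intro bip_eqI) (simp_all add: restr_def mem_plane)

lemma bip_mult:
  assumes "g \<in> forms s W k" "h \<in> forms s W l"
  shows "bip p1 p0 v (g * h) = bip p1 p0 v g * bip p1 p0 v h"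
proof (cases "v \<in> W")
  case True
  then show ?thesis by (intro bip_eqI) (use assms in \<open>simp_all add: fun_simps poly_bip\<close>)
qed (simp add: bip_outside)

lemma bip_dual:
  assumes "\<phi> \<in> dual s W" "v \<in> W"
  shows "bip p1 p0 v \<phi> = lin_bip p1 p0 v \<phi>"
  by (intro bip_eqI assms poly_lin_bip)

lemma bip_mult_dual:
  assumes "\<phi> \<in> dual s W" "g \<in> forms s W k"
  shows "bip p1 p0 v (\<phi> * g) = lin_bip p1 p0 v \<phi> * bip p1 p0 v g"
proof (cases "v \<in> W")
  case True
  then show ?thesis by (intro bip_eqI) (use assms in \<open>simp_all add: fun_simps poly_bip poly_lin_bip\<close>)
qed (simp add: bip_outside)

lemma coeff_lin_bip_mult:
  "coeff (lin_bip p1 p0 v \<phi> * Q) i = [:\<phi> p0, \<phi> v:] * coeff Q i + (if i = 0 then 0 else smult (\<phi> p1) (coeff Q (i - 1)))"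
  unfolding lin_bip_def by (cases i) simp_all

lemma coeff_coeff_lin_bip_mult:
  "coeff (coeff (lin_bip p1 p0 v \<phi> * Q) i) j = \<phi> p0 * coeff (coeff Q i) j
     + (if j = 0 then 0 else \<phi> v * coeff (coeff Q i) (j - 1))
     + (if i = 0 then 0 else \<phi> p1 * coeff (coeff Q (i - 1)) j)"
  unfolding coeff_lin_bip_mult by (cases j) simp_all

lemma total_degree_bip:
  assumes "g \<in> forms s W k"
  shows "total_degree_le k (bip p1 p0 v g)"
  using assms
proof (induction rule: forms_induct)
  case (zero k)
  show ?case by (simp add: bip_0 total_degree_le_def)
next
  case (add k g h)
  have "bip p1 p0 v (g + h) = bip p1 p0 v g + bip p1 p0 v h"
    using add(1,2) by (rule bip_add)
  then show ?case using add(3,4) unfolding total_degree_le_def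
    by (metis add.right_neutral coeff_add)
next
  case (scale k c g)
  then show ?case by (simp add: bip_scale total_degree_le_def)
next
  case one
  show ?case
    by (cases "v \<in> W") (auto simp: bip_one bip_outside total_degree_le_def coeff_1 split: if_splits)
next
  case (mult k \<phi> g)
  show ?case
    unfolding total_degree_le_def
  proof (intro allI impI)
    fix i j assume nz: "coeff (coeff (bip p1 p0 v (\<phi> * g)) i) j \<noteq> 0"
    show "i + j \<le> Suc k"
    proof (rule ccontr)
      assume "\<not> i + j \<le> Suc k"
      then have "coeff (coeff (bip p1 p0 v g) i) j = 0"
        "(if j = 0 then 0 else \<phi> v * coeff (coeff (bip p1 p0 v g) i) (j - 1)) = 0"
        "(if i = 0 then 0 else \<phi> p1 * coeff (coeff (bip p1 p0 v g) (i - 1)) j) = 0"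
        using total_degree_leD[OF mult(3)] by auto
      then have "coeff (coeff (bip p1 p0 v (\<phi> * g)) i) j = 0"
        unfolding bip_mult_dual[OF mult(1,2)] coeff_coeff_lin_bip_mult by (simp only: mult_zero_right add_0)
      then show False using nz by contradiction
    qed
  qed
qed

lemma coeff_bip_top:
  assumes "g \<in> forms s W k" "v \<in> W"
  shows "coeff (bip p1 p0 v g) k = [:g p1:]"
  using assms(1)
proof (induction rule: forms_induct)
  case (mult k \<phi> g)
  have "coeff (bip p1 p0 v g) (Suc k) = 0"
    using total_degree_le_degree[OF total_degree_bip[OF mult(2)]] by (intro coeff_eq_0) (simp add: le_imp_less_Suc)
  then show ?case
    unfolding bip_mult_dual[OF mult(1,2)] coeff_lin_bip_mult using mult(3) by (simp add: fun_simps)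
qed (simp_all add: bip_0 bip_add bip_scale bip_one[OF assms(2)], simp_all add: fun_simps p assms(2))

text \<open>The value \<open>g v\<close> is recovered as the coefficient of \<open>t\<^sup>k\<close> in \<open>g (p\<^sub>0 + t v)\<close>.\<close>

lemma coeff_coeff_bip_top:
  assumes "g \<in> forms s W k" "v \<in> W"
  shows "coeff (coeff (bip p1 p0 v g) 0) k = g v"
  using assms(1)
proof (induction rule: forms_induct)
  case (mult k \<phi> g)
  have "coeff (coeff (bip p1 p0 v g) 0) (Suc k) = 0"
    using total_degree_bip[OF mult(2)] by (rule total_degree_leD) simp
  then show ?case
    unfolding bip_mult_dual[OF mult(1,2)] coeff_coeff_lin_bip_mult using mult(3) by (simp add: fun_simps)
qed (simp_all add: bip_0 bip_add bip_scale bip_one[OF assms(2)], simp_all add: fun_simps p assms(2))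

lemma coeff_bip_forms:
  assumes "g \<in> forms s W k"
  shows "(\<lambda>v. coeff (coeff (bip p1 p0 v g) i) j) \<in> forms s W j"
  using assms
proof (induction arbitrary: i j rule: forms_induct)
  case (zero k)
  have "(\<lambda>v. coeff (coeff (bip p1 p0 v 0) i) j) = 0" by (rule ext) (simp add: fun_simps bip_0)
  then show ?case using forms_zero by simp
next
  case (add k g h)
  have "(\<lambda>v. coeff (coeff (bip p1 p0 v (g + h)) i) j)
      = (\<lambda>v. coeff (coeff (bip p1 p0 v g) i) j) + (\<lambda>v. coeff (coeff (bip p1 p0 v h) i) j)"
    using bip_add[OF add(1,2)] by (intro ext) (simp add: fun_simps)
  then show ?case using add(3,4) forms_add by simp
next
  case (scale k c g)
  have "(\<lambda>v. coeff (coeff (bip p1 p0 v (fscale c g)) i) j)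
      = fscale c (\<lambda>v. coeff (coeff (bip p1 p0 v g) i) j)"
    using bip_scale[OF scale(1)] by (intro ext) (simp add: fun_simps)
  then show ?case using scale(2) forms_scale by simp
next
  case one
  have "(\<lambda>v. coeff (coeff (bip p1 p0 v (restr W (\<lambda>_. 1))) i) j)
      = (if i = 0 \<and> j = 0 then restr W (\<lambda>_. 1) else 0)"
  proof (rule ext)
    fix v show "coeff (coeff (bip p1 p0 v (restr W (\<lambda>_. 1))) i) j
      = (if i = 0 \<and> j = 0 then restr W (\<lambda>_. 1) else 0) v"
      by (cases "v \<in> W") (auto simp: fun_simps bip_one bip_outside coeff_1)
  qed
  then show ?case using forms_one forms_zero by auto
next
  case (mult k \<phi> g)
  let ?c = "\<lambda>i j v. coeff (coeff (bip p1 p0 v g) i) j"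
  have "(\<lambda>v. coeff (coeff (bip p1 p0 v (\<phi> * g)) i) j)
     = fscale (\<phi> p0) (?c i j) + (if j = 0 then 0 else \<phi> * ?c i (j - 1))
       + (if i = 0 then 0 else fscale (\<phi> p1) (?c (i - 1) j))"
    unfolding bip_mult_dual[OF mult(1,2)] coeff_coeff_lin_bip_mult by (rule ext) (simp add: fun_simps)
  moreover have "(if j = 0 then 0 else \<phi> * ?c i (j - 1)) \<in> forms s W j"
    using forms_mult_dual[OF mult(1) mult(3)[of i "j - 1"]] forms_zero by (cases j) auto
  moreover have "(if i = 0 then 0 else fscale (\<phi> p1) (?c (i - 1) j)) \<in> forms s W j"
    using forms_scale mult(3) forms_zero by auto
  ultimately show ?case
    using forms_add forms_scale mult(3) by auto
qed

end

section \<open>Functions that are polynomial along lines\<close>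

text \<open>
  Products of non-zero functions of this kind are non-zero, which is all that is needed of the
  Zariski topology: a non-zero polynomial and finitely many others have a common point where none of
  them vanishes.
\<close>

definition line_poly :: "('a \<Rightarrow> complex) \<Rightarrow> bool" where
  "line_poly \<Psi> \<longleftrightarrow> (\<forall>x\<in>W. \<forall>y\<in>W. \<exists>q. \<forall>t. \<Psi> (x + s t y) = poly q t)"

lemma forms_line_poly:
  assumes "g \<in> forms s W k"
  shows "line_poly g"
  unfolding line_poly_def
proof (intro ballI)
  fix x y assume xy: "x \<in> W" "y \<in> W"
  show "\<exists>q. \<forall>t. g (x + s t y) = poly q t"
    using poly_bip[OF xy(1,1) assms xy(2), of 0]
    by (intro exI[of _ "poly (bip x x y g) [:0:]"]) simp
qed

lemma line_poly_const: "line_poly (\<lambda>_. c)"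
  unfolding line_poly_def by (intro ballI exI[of _ "[:c:]"]) simp

lemma line_poly_mult:
  assumes "line_poly \<Phi>" "line_poly \<Psi>"
  shows "line_poly (\<lambda>x. \<Phi> x * \<Psi> x)"
  unfolding line_poly_def
proof (intro ballI)
  fix x y assume "x \<in> W" "y \<in> W"
  then obtain q r where "\<forall>t. \<Phi> (x + s t y) = poly q t" "\<forall>t. \<Psi> (x + s t y) = poly r t"
    using assms unfolding line_poly_def by meson
  then show "\<exists>q. \<forall>t. \<Phi> (x + s t y) * \<Psi> (x + s t y) = poly q t"
    by (intro exI[of _ "q * r"]) simp
qed

text \<open>On the line through \<open>x\<close> and \<open>y\<close> both functions are non-zero polynomials in one variable.\<close>

lemma line_poly_common_nonzero:
  assumes "line_poly \<Phi>" "line_poly \<Psi>" "x \<in> W" "\<Phi> x \<noteq> 0" "y \<in> W" "\<Psi> y \<noteq> 0"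
  shows "\<exists>z\<in>W. \<Phi> z \<noteq> 0 \<and> \<Psi> z \<noteq> 0"
proof -
  have yx: "y - x \<in> W" using assms mem_diff by blast
  obtain q r where q: "\<forall>t. \<Phi> (x + s t (y - x)) = poly q t" and r: "\<forall>t. \<Psi> (x + s t (y - x)) = poly r t"
    using assms yx unfolding line_poly_def by meson
  have "poly q 0 \<noteq> 0" using q[rule_format, of 0] assms by simp
  moreover have "poly r 1 \<noteq> 0" using r[rule_format, of 1] assms by simp
  ultimately have "q * r \<noteq> 0" by auto
  then obtain t where "poly (q * r) t \<noteq> 0" using poly_all_0_iff_0 by blast
  then have "\<Phi> (x + s t (y - x)) \<noteq> 0 \<and> \<Psi> (x + s t (y - x)) \<noteq> 0" using q r by simp
  moreover have "x + s t (y - x) \<in> W" using assms(3) yx by (simp add: mem_add mem_scale)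
  ultimately show ?thesis by blast
qed

lemma line_poly_family_nonzero:
  assumes "finite A" "\<And>\<Phi>. \<Phi> \<in> A \<Longrightarrow> line_poly \<Phi> \<and> (\<exists>x\<in>W. \<Phi> x \<noteq> 0)"
  shows "\<exists>z\<in>W. \<forall>\<Phi>\<in>A. \<Phi> z \<noteq> 0"
proof -
  have "\<exists>\<Psi>. line_poly \<Psi> \<and> (\<exists>x\<in>W. \<Psi> x \<noteq> 0) \<and> (\<forall>x. \<Psi> x \<noteq> 0 \<longrightarrow> (\<forall>\<Phi>\<in>A. \<Phi> x \<noteq> 0))"
    using assms
  proof (induction A rule: finite_induct)
    case empty
    then show ?case using line_poly_const[of 1] mem_0 by (intro exI[of _ "\<lambda>_. 1"]) auto
  next
    case (insert \<Phi> A)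
    then obtain \<Psi> where \<Psi>: "line_poly \<Psi>" "\<exists>x\<in>W. \<Psi> x \<noteq> 0" "\<forall>x. \<Psi> x \<noteq> 0 \<longrightarrow> (\<forall>\<Phi>\<in>A. \<Phi> x \<noteq> 0)"
      by auto
    have \<Phi>: "line_poly \<Phi>" "\<exists>x\<in>W. \<Phi> x \<noteq> 0" using insert.prems by auto
    then obtain z where "z \<in> W" "\<Phi> z \<noteq> 0 \<and> \<Psi> z \<noteq> 0"
      using line_poly_common_nonzero[OF \<Phi>(1) \<Psi>(1)] \<Psi>(2) by blast
    then show ?case
      using \<Psi> \<Phi> line_poly_mult[OF \<Phi>(1) \<Psi>(1)] by (intro exI[of _ "\<lambda>x. \<Phi> x * \<Psi> x"]) auto
  qed
  then show ?thesis by blast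
qed

end

section \<open>Power series roots\<close>

text \<open>\<open>ps Q\<close> is \<open>Q\<close> as a polynomial in \<open>x\<close> over the power series in \<open>t\<close>, and \<open>ev t Q\<close> specializes \<open>t\<close>.\<close>

abbreviation ps :: "complex poly poly \<Rightarrow> complex fps poly" where
  "ps \<equiv> map_poly fps_of_poly"

interpretation fps_of_poly: comm_ring_hom "fps_of_poly :: complex poly \<Rightarrow> complex fps"
  by unfold_locales (simp_all add: fps_of_poly_add fps_of_poly_mult)

lemma coeff_ps: "coeff (ps Q) i = fps_of_poly (coeff Q i)"
  by (simp add: coeff_map_poly)

lemma ps_mult: "ps (P * Q) = ps P * ps Q"
  by (rule poly_eqI) (simp only: coeff_ps coeff_mult fps_of_poly_sum fps_of_poly_mult)

lemma ps_power: "ps (P ^ k) = ps P ^ k"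
proof (induction k)
  case 0
  show ?case by (rule poly_eqI) (simp add: coeff_ps coeff_1)
next
  case (Suc k)
  then show ?case by (simp only: power_Suc ps_mult)
qed

lemma fps_of_poly_nth: "fps_of_poly p $ n = coeff p n"
  by (simp add: fps_of_poly_def)

lemma coeff_ps_nth: "coeff (ps Q) i $ n = coeff (coeff Q i) n"
  by (simp add: coeff_ps fps_of_poly_nth)

lemma fps_of_poly_0_iff: "fps_of_poly p = 0 \<longleftrightarrow> p = (0 :: complex poly)"
  by (metis fps_of_poly_nth fps_zero_nth poly_eqI coeff_0 fps_of_poly_0)

lemma degree_ps: "degree (ps Q) = degree Q"
  by (rule degree_map_poly) (simp add: fps_of_poly_0_iff)

lemma ps_eq_0_iff: "ps Q = 0 \<longleftrightarrow> Q = 0"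
  by (metis coeff_0 coeff_ps fps_of_poly_0_iff poly_eq_iff map_poly_0)

definition ev :: "complex \<Rightarrow> complex poly poly \<Rightarrow> complex poly" where
  "ev t Q = map_poly (\<lambda>c. poly c t) Q"

lemma coeff_ev: "coeff (ev t Q) i = poly (coeff Q i) t"
  by (simp add: ev_def coeff_map_poly)

lemma poly_ev: "poly (ev t Q) x = poly (poly Q [:x:]) t"
proof (induction Q)
  case (pCons c Q)
  have "ev t (pCons c Q) = pCons (poly c t) (ev t Q)"
    by (rule poly_eqI) (simp add: coeff_ev coeff_pCons split: nat.splits)
  then show ?case using pCons by (simp add: mult.commute)
qed (simp add: ev_def)

lemma ev_mult: "ev t (P * Q) = ev t P * ev t Q"
  by (subst poly_eq_poly_eq_iff[symmetric]) (simp add: fun_eq_iff poly_ev)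

lemma ev_pderiv: "ev t (pderiv Q) = pderiv (ev t Q)"
  by (rule poly_eqI) (simp add: coeff_ev coeff_pderiv)

lemma poly_ps_nth_0: "poly (ps Q) A $ 0 = poly (ev 0 Q) (A $ 0)"
proof (induction Q)
  case (pCons c Q)
  have "ev 0 (pCons c Q) = pCons (poly c 0) (ev 0 Q)"
    by (rule poly_eqI) (simp add: coeff_ev coeff_pCons split: nat.splits)
  moreover have "ps (pCons c Q) = pCons (fps_of_poly c) (ps Q)"
    by (rule poly_eqI) (simp add: coeff_ps coeff_pCons split: nat.splits)
  ultimately show ?case using pCons by (simp add: fps_of_poly_nth poly_0_coeff_0)
qed (simp add: ev_def)

lemma ps_pderiv: "ps (pderiv Q) = pderiv (ps Q)"
proof (rule poly_eqI)
  fix n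
  have "fps_of_poly (of_nat (Suc n) * coeff Q (Suc n)) = of_nat (Suc n) * fps_of_poly (coeff Q (Suc n))"
    by (metis fps_of_poly.hom_mult fps_of_poly.hom_of_nat)
  then show "coeff (ps (pderiv Q)) n = coeff (pderiv (ps Q)) n"
    by (simp only: coeff_ps coeff_pderiv)
qed

lemma distinct_roots_product:
  fixes \<alpha> :: "'i \<Rightarrow> 'b::idom"
  assumes "finite S" "inj_on \<alpha> S" "\<And>i. i \<in> S \<Longrightarrow> poly P (\<alpha> i) = 0" "card S = degree P"
  shows "P = smult (lead_coeff P) (\<Prod>i\<in>#mset_set S. [:- \<alpha> i, 1:])"
proof (rule ccontr)
  let ?Q = "smult (lead_coeff P) (\<Prod>i\<in>#mset_set S. [:- \<alpha> i, 1:])"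
  assume ne: "P \<noteq> ?Q"
  define D where "D = P - ?Q"
  have D: "D \<noteq> 0" using ne by (simp add: D_def)
  have deg: "degree (\<Prod>i\<in>#mset_set S. [:- \<alpha> i, 1:]) = degree P"
    using prod_linear_monic(2)[of \<alpha> "mset_set S"] assms(4) by simp
  have top: "coeff (\<Prod>i\<in>#mset_set S. [:- \<alpha> i, 1:]) (degree P) = 1"
    using prod_linear_monic(1)[of \<alpha> "mset_set S"] assms(4) by simp
  have "coeff D n = 0" if "degree P \<le> n" for n
  proof (cases "n = degree P")
    case True
    then show ?thesis using top by (simp add: D_def)
  next
    case False
    then have "degree P < n" using that by simp
    then show ?thesis using deg by (simp add: D_def coeff_eq_0)
  qed
  then have less: "degree D < degree P \<or> degree P = 0"
    by (metis D leading_coeff_0_iff not_le)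
  have root: "poly D (\<alpha> i) = 0" if "i \<in> S" for i
  proof -
    have "i \<in># mset_set S" using assms(1) that by simp
    then have "poly (\<Prod>j\<in>#mset_set S. [:- \<alpha> j, 1:]) (\<alpha> i) = 0"
      by (auto simp: poly_prod_mset)
    then show ?thesis using assms(3)[OF that] by (simp add: D_def)
  qed
  have "\<alpha> ` S \<subseteq> {x. poly D x = 0}" using root by auto
  then have "card (\<alpha> ` S) \<le> card {x. poly D x = 0}"
    using D by (intro card_mono poly_roots_finite)
  also have "\<dots> \<le> degree D" using D by (rule card_poly_roots_bound)
  finally have "degree P \<le> degree D" using assms(2,4) by (simp add: card_image)
  then have "degree P = 0" using less by simp
  then have "coeff D (degree D) = 0"
    using \<open>\<And>n. degree P \<le> n \<Longrightarrow> coeff D n = 0\<close> by simp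
  then show False using D by simp
qed

lemma distinct_roots_simple:
  fixes U :: "complex poly"
  assumes "U \<noteq> 0" "card {x. poly U x = 0} = degree U" "poly U a = 0"
  shows "poly (pderiv U) a \<noteq> 0"
proof -
  let ?S = "{x. poly U x = 0}"
  have fin: "finite ?S" by (rule poly_roots_finite[OF assms(1)])
  define l where "l = lead_coeff U"
  have "l \<noteq> 0" using assms(1) by (simp add: l_def)
  define Q where "Q = smult l (\<Prod>b\<in>#mset_set (?S - {a}). [:- b, 1:])"
  have "U = smult l (\<Prod>b\<in>#mset_set ?S. [:- b, 1:])"
    unfolding l_def by (rule distinct_roots_product[of _ "\<lambda>a. a"]) (use fin assms in simp_all)
  moreover have "mset_set ?S = add_mset a (mset_set (?S - {a}))"
    using fin assms(3) by (intro mset_set.remove) auto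
  ultimately have "U = [:- a, 1:] * Q"
    unfolding Q_def by (simp only: image_mset_add_mset prod_mset.add_mset mult_smult_right)
  then have "poly (pderiv U) a = poly (pderiv ([:- a, 1:] * Q)) a" by simp
  also have "\<dots> = poly Q a" by (simp only: pderiv_mult poly_add poly_mult) (simp add: pderiv_pCons)
  finally have "poly (pderiv U) a = poly Q a" .
  moreover have "poly Q a \<noteq> 0"
    using \<open>l \<noteq> 0\<close> fin by (auto simp: Q_def poly_prod_mset)
  ultimately show ?thesis by simp
qed

lemma pderiv_funpow_linear_power:
  fixes a :: "'b::idom"
  shows "poly ((pderiv ^^ m) ([:- a, 1:] ^ m * Q)) a = of_nat (fact m) * poly Q a"
proof (induction m arbitrary: Q)
  case (Suc m)
  have "pderiv ([:- a, 1:] ^ Suc m * Q) = [:- a, 1:] ^ m * (of_nat (Suc m) * Q + [:- a, 1:] * pderiv Q)"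
  proof -
    have "pderiv ([:- a, 1:] ^ Suc m) = smult (of_nat (Suc m)) ([:- a, 1:] ^ m)"
      by (subst pderiv_power_Suc) (simp add: pderiv_pCons)
    then show ?thesis
      by (simp only: pderiv_mult of_nat_poly) (simp add: algebra_simps)
  qed
  then have "poly ((pderiv ^^ Suc m) ([:- a, 1:] ^ Suc m * Q)) a
      = of_nat (fact m) * poly (of_nat (Suc m) * Q + [:- a, 1:] * pderiv Q) a"
    by (simp only: funpow_Suc_right o_apply Suc.IH)
  also have "\<dots> = of_nat (fact m) * (of_nat (Suc m) * poly Q a)" by (simp add: of_nat_poly)
  finally show ?case by (simp only: fact_Suc of_nat_mult mult_ac of_nat_id)
qed simp

lemma card_roots_separable:
  fixes p :: "complex poly"
  assumes "p \<noteq> 0" "\<And>x. poly p x = 0 \<Longrightarrow> poly (pderiv p) x \<noteq> 0"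
  shows "card {x. poly p x = 0} = degree p"
proof -
  have "rsquarefree p" using assms(2) by (auto simp: rsquarefree_roots)
  then have o: "order x p = 0 \<or> order x p = 1" for x by (auto simp: rsquarefree_def)
  have "proots p = mset_set {x. poly p x = 0}"
  proof (rule multiset_eqI)
    fix x
    show "count (proots p) x = count (mset_set {x. poly p x = 0}) x"
      using o[of x] assms(1) order_root[of p x] poly_roots_finite[OF assms(1)] by auto
  qed
  then show ?thesis using size_proots_complex[of p] by simp
qed

lemma degree_0_if_primes_degree_0:
  fixes D :: "complex poly poly"
  assumes "D \<noteq> 0" "\<And>P. prime P \<Longrightarrow> P dvd D \<Longrightarrow> degree P = 0"
  shows "degree D = 0"
  using assms
proof (induction D rule: prime_divisors_induct)
  case (unit x)
  then show ?case by (auto simp: is_unit_poly_iff)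
next
  case (factor p x)
  then have "x \<noteq> 0" "p \<noteq> 0" by auto
  moreover have "degree p = 0" using factor by auto
  moreover have "degree x = 0" using factor \<open>x \<noteq> 0\<close> by (metis dvd_mult)
  ultimately show ?case by (simp add: degree_mult_eq)
qed auto

text \<open>
  \<open>R\<close> is the product of the distinct primes dividing \<open>F\<close>.  A prime \<open>P\<close> dividing \<open>R\<close> and its derivative
  would divide its own derivative, which has smaller degree and is not \<open>0\<close> in characteristic \<open>0\<close>.
\<close>

lemma squarefree_radical:
  fixes F :: "complex poly poly"
  assumes "F \<noteq> 0"
  obtains R K where "R dvd F" "F dvd R ^ K" "\<And>D. D dvd R \<Longrightarrow> D dvd pderiv R \<Longrightarrow> degree D = 0"
proof -
  define A where "A = prime_factors F"
  have fin: "finite A" by (simp add: A_def)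
  have prime: "prime P" if "P \<in> A" for P using that by (auto simp: A_def)
  have inA: "P \<in> A" if "prime P" "P dvd F" for P
    using that assms by (simp add: A_def prime_factors_dvd)
  define R where "R = \<Prod>A"
  have "prod_mset (mset_set A) dvd prod_mset (prime_factorization F)"
    unfolding A_def by (intro prod_mset_subset_imp_dvd mset_set_set_mset_msubset)
  then have "R dvd F"
    using associatedD1[OF prod_mset_prime_factorization_weak[OF assms]] dvd_trans
    unfolding R_def prod_unfold_prod_mset by (metis image_mset.identity id_apply image_mset_cong)
  moreover have "\<exists>K. F dvd R ^ K"
  proof -
    have "G \<noteq> 0 \<longrightarrow> (\<forall>P. prime P \<longrightarrow> P dvd G \<longrightarrow> P dvd R) \<longrightarrow> (\<exists>K. G dvd R ^ K)" for G
    proof (induction G rule: prime_divisors_induct)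
      case (unit x)
      then show ?case by (metis power_0)
    next
      case (factor p x)
      show ?case
      proof (intro impI)
        assume nz: "p * x \<noteq> 0" and d: "\<forall>P. prime P \<longrightarrow> P dvd p * x \<longrightarrow> P dvd R"
        have "x \<noteq> 0" using nz by auto
        moreover have "\<forall>P. prime P \<longrightarrow> P dvd x \<longrightarrow> P dvd R" using d dvd_mult by blast
        ultimately obtain K where "x dvd R ^ K" using factor.IH by blast
        moreover have "p dvd R" using d factor.hyps by simp
        ultimately have "p * x dvd R ^ Suc K" by (simp add: mult_dvd_mono)
        then show "\<exists>K. p * x dvd R ^ K" by blast
      qed
    qed simp
    moreover have "P dvd R" if "prime P" "P dvd F" for P
      unfolding R_def using fin inA[OF that] by (rule dvd_prodI)
    ultimately show ?thesis using assms by blast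
  qed
  moreover have "degree D = 0" if D: "D dvd R" "D dvd pderiv R" for D
  proof (rule degree_0_if_primes_degree_0)
    have R0: "R \<noteq> 0" using prime[of 0] fin by (auto simp: R_def)
    then show "D \<noteq> 0" using D by auto
    fix P :: "complex poly poly" assume P: "prime P" "P dvd D"
    show "degree P = 0"
    proof (rule ccontr)
      assume deg: "degree P \<noteq> 0"
      have "P dvd R" using P D dvd_trans by blast
      then have PA: "P \<in> A" using \<open>R dvd F\<close> inA[OF P(1)] dvd_trans by blast
      define R' where "R' = \<Prod>(A - {P})"
      have R: "R = P * R'" unfolding R_def R'_def using fin PA by (rule prod.remove)
      have "P dvd P * pderiv R' + R' * pderiv P"
        using P D dvd_trans by (metis R pderiv_mult)
      then have "P dvd R' * pderiv P"
        by (metis dvd_add_right_iff dvd_triv_left)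
      then consider "P dvd R'" | "P dvd pderiv P"
        using P(1) prime_dvd_mult_iff by blast
      then show False
      proof cases
        case 1
        then obtain Q where "Q \<in> A - {P}" "P dvd Q"
          unfolding R'_def using P(1) fin by (auto simp: prime_dvd_prod_iff)
        then show False using prime P(1) primes_dvd_imp_eq by blast
      next
        case 2
        have "pderiv P \<noteq> 0" using deg by (simp add: pderiv_eq_0_iff)
        then have "degree P \<le> degree (pderiv P)" using 2 by (intro dvd_imp_degree_le)
        then show False using deg by (simp add: degree_pderiv)
      qed
    qed
  qed
  ultimately show thesis using that by blast
qed

lemma finite_submultisets: "finite {N. N \<subseteq># M}"
proof (induction M)
  case (add x M)
  have "{N. N \<subseteq># add_mset x M} \<subseteq> {N. N \<subseteq># M} \<union> add_mset x ` {N. N \<subseteq># M}"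
  proof
    fix N assume "N \<in> {N. N \<subseteq># add_mset x M}"
    then have N: "N \<subseteq># add_mset x M" by simp
    show "N \<in> {N. N \<subseteq># M} \<union> add_mset x ` {N. N \<subseteq># M}"
    proof (cases "x \<in># N")
      case True
      then obtain N' where "N = add_mset x N'" by (metis multi_member_split)
      then show ?thesis using N by auto
    next
      case False
      then have "N \<subseteq># M" using N by (metis diff_single_trivial subset_eq_diff_conv add_mset_add_single)
      then show ?thesis by simp
    qed
  qed
  then show ?case using add finite_subset by blast
qed auto

lemma fun_sum_apply: "(\<Sum>i\<in>I. f i) x = (\<Sum>i\<in>I. (f i x :: complex))"
  by (induction I rule: infinite_finite_induct) (simp_all add: fun_simps)

text \<open>Up to sign and a constant, \<open>\<Prod>\<alpha>\<^sub>i\<close> is the value of \<open>G\<close> at \<open>x = 0\<close>, a polynomial in \<open>t\<close> of bounded degree.\<close>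

lemma linear_factor_constant_term:
  fixes \<alpha> :: "'i \<Rightarrow> complex fps"
  assumes G: "ps G = smult u (\<Prod>i\<in>#N. [:- \<alpha> i, 1:])" and nz: "G \<noteq> 0" and td: "total_degree_le (degree G) G"
  shows "size N = degree G" "\<And>m. size N < m \<Longrightarrow> (\<Prod>i\<in>#N. \<alpha> i) $ m = 0"
proof -
  have u0: "u \<noteq> 0"
  proof
    assume "u = 0"
    then have "ps G = 0" unfolding G by simp
    then show False using nz ps_eq_0_iff by blast
  qed
  then have "degree (ps G) = size N"
    unfolding G by (simp add: prod_linear_monic(2))
  then show s: "size N = degree G" by (simp add: degree_ps)
  have "degree G + degree (lead_coeff G) \<le> degree G"
    using td nz by (intro total_degree_le_coeff) auto
  then obtain g where g: "lead_coeff G = [:g:]" by (metis add_le_same_cancel1 degree_eq_zeroE le_zero_eq)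
  have "coeff (ps G) (size N) = u" unfolding G by (simp add: prod_linear_monic(1))
  then have u: "u = fps_const g" using s g by (simp add: coeff_ps fps_of_poly_const)
  fix m assume m: "size N < m"
  have "poly (ps G) 0 = u * (\<Prod>i\<in>#N. - \<alpha> i)" unfolding G by (simp add: poly_prod_mset)
  also have "(\<Prod>i\<in>#N. - \<alpha> i) = (- 1) ^ size N * (\<Prod>i\<in>#N. \<alpha> i)"
    by (induction N) auto
  finally have eq: "fps_of_poly (coeff G 0) = u * ((- 1) ^ size N * (\<Prod>i\<in>#N. \<alpha> i))"
    by (simp add: poly_0_coeff_0 coeff_ps)
  have sgn: "(- 1 :: complex fps) ^ k = fps_const ((- 1) ^ k)" for k
    by (metis fps_const_1_eq_1 fps_const_neg fps_const_power)
  have "0 = fps_of_poly (coeff G 0) $ m"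
    using td m s by (simp add: fps_of_poly_nth total_degree_leD)
  also have "\<dots> = g * ((- 1) ^ size N * (\<Prod>i\<in>#N. \<alpha> i) $ m)"
    by (simp add: eq u sgn)
  finally show "(\<Prod>i\<in>#N. \<alpha> i) $ m = 0" using u u0 by simp
qed

context cspace
begin

text \<open>
  Families of power series in \<open>t\<close>, depending on \<open>v\<close>, which become homogeneous when \<open>t\<close> is given
  degree \<open>- 1\<close>.
\<close>

definition graded :: "('a \<Rightarrow> complex fps) \<Rightarrow> bool" where
  "graded A \<longleftrightarrow> (\<forall>m. (\<lambda>v. A v $ m) \<in> forms s W m)"

lemma gradedD: "graded A \<Longrightarrow> (\<lambda>v. A v $ m) \<in> forms s W m"
  by (simp add: graded_def)

lemma graded_outside: "graded A \<Longrightarrow> v \<notin> W \<Longrightarrow> A v = 0"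
  using forms_outside[OF gradedD] by (intro fps_ext) simp

lemma graded_0: "graded (\<lambda>_. 0)"
  using forms_zero by (simp add: graded_def zero_fun_def)

lemma graded_add: "graded A \<Longrightarrow> graded B \<Longrightarrow> graded (\<lambda>v. A v + B v)"
  unfolding graded_def
proof
  fix m assume "\<forall>m. (\<lambda>v. A v $ m) \<in> forms s W m" "\<forall>m. (\<lambda>v. B v $ m) \<in> forms s W m"
  then have "(\<lambda>v. A v $ m) + (\<lambda>v. B v $ m) \<in> forms s W m" by (intro forms_add) auto
  then show "(\<lambda>v. (A v + B v) $ m) \<in> forms s W m" by (simp add: plus_fun_def)
qed

lemma graded_mult: "graded A \<Longrightarrow> graded B \<Longrightarrow> graded (\<lambda>v. A v * B v)"
  unfolding graded_def
proof
  fix m assume A: "\<forall>m. (\<lambda>v. A v $ m) \<in> forms s W m" and B: "\<forall>m. (\<lambda>v. B v $ m) \<in> forms s W m"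
  have "(\<lambda>v. A v $ i) * (\<lambda>v. B v $ (m - i)) \<in> forms s W m" if "i \<in> {0..m}" for i
    using forms_mult[OF A[rule_format, of i] B[rule_format, of "m - i"]] that by simp
  then have "(\<Sum>i=0..m. (\<lambda>v. A v $ i) * (\<lambda>v. B v $ (m - i))) \<in> forms s W m"
    by (rule forms_sum)
  moreover have "(\<lambda>v. (A v * B v) $ m) = (\<Sum>i=0..m. (\<lambda>v. A v $ i) * (\<lambda>v. B v $ (m - i)))"
    by (rule ext) (simp add: fun_sum_apply fun_simps fps_mult_nth)
  ultimately show "(\<lambda>v. (A v * B v) $ m) \<in> forms s W m" by simp
qed

lemma graded_of_nat: "graded A \<Longrightarrow> graded (\<lambda>v. of_nat k * A v)"
proof (induction k)
  case 0
  then show ?case by (simp add: graded_0)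
next
  case (Suc k)
  then show ?case using graded_add[of A "\<lambda>v. of_nat k * A v"] by (simp add: distrib_right)
qed

lemma graded_mult_power: "graded B \<Longrightarrow> graded A \<Longrightarrow> graded (\<lambda>v. B v * A v ^ j)"
proof (induction j)
  case (Suc j)
  then show ?case using graded_mult[of "\<lambda>v. B v * A v ^ j" A] by (simp add: mult_ac)
qed simp

lemma graded_sum: "finite I \<Longrightarrow> (\<And>i. i \<in> I \<Longrightarrow> graded (A i)) \<Longrightarrow> graded (\<lambda>v. \<Sum>i\<in>I. A i v)"
  by (induction I rule: finite_induct) (simp_all add: graded_0 graded_add)

lemma graded_poly:
  assumes "\<And>j. graded (\<lambda>v. coeff (P v) j)" "\<And>v. degree (P v) \<le> N" "graded A"
  shows "graded (\<lambda>v. poly (P v) (A v))"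
proof -
  have "poly (P v) (A v) = (\<Sum>j\<le>N. coeff (P v) j * A v ^ j)" for v
    unfolding poly_altdef using assms(2)[of v]
    by (intro sum.mono_neutral_left) (auto simp: coeff_eq_0)
  then show ?thesis
    using graded_sum[of "{..N}" "\<lambda>j v. coeff (P v) j * A v ^ j"] graded_mult_power[OF assms(1) assms(3)]
    by simp
qed

text \<open>The product of the \<open>\<alpha>\<^sub>i v\<close>, made \<open>0\<close> outside of \<open>W\<close> so that its coefficients can be forms.\<close>

definition beta :: "('i \<Rightarrow> 'a \<Rightarrow> complex fps) \<Rightarrow> 'i multiset \<Rightarrow> 'a \<Rightarrow> complex fps" where
  "beta \<alpha> N v = (if v \<in> W then \<Prod>i\<in>#N. \<alpha> i v else 0)"

lemma graded_beta:
  assumes "\<And>i. i \<in># N \<Longrightarrow> graded (\<alpha> i)"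
  shows "graded (beta \<alpha> N)"
  using assms
proof (induction N)
  case empty
  have "(\<lambda>v. beta \<alpha> {#} v $ m) = (if m = 0 then restr W (\<lambda>_. 1) else 0)" for m
    by (rule ext) (simp add: beta_def fun_simps)
  then show ?case using forms_one forms_zero by (simp add: graded_def)
next
  case (add i N)
  have "beta \<alpha> (add_mset i N) = (\<lambda>v. \<alpha> i v * beta \<alpha> N v)"
    by (rule ext) (simp add: beta_def)
  then show ?case using graded_mult[of "\<alpha> i" "beta \<alpha> N"] add by simp
qed

text \<open>
  Newton's recursion: \<open>\<alpha>\<^sub>m\<close> is determined linearly by the coefficients of \<open>P\<close> and of \<open>\<alpha>\<close> below \<open>m\<close>,
  with a constant denominator, so it is again a form.
\<close>

lemma graded_root:
  assumes P: "\<And>j. graded (\<lambda>v. coeff (P v) j)" "\<And>v. degree (P v) \<le> N"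
    and root: "\<And>v. v \<in> W \<Longrightarrow> \<alpha> v $ 0 = a" "\<And>v. v \<in> W \<Longrightarrow> poly (P v) (\<alpha> v) = 0"
      "\<And>v. v \<in> W \<Longrightarrow> poly (pderiv (P v)) (\<alpha> v) $ 0 = c"
    and c: "c \<noteq> 0" and out: "\<And>v. v \<notin> W \<Longrightarrow> \<alpha> v = 0"
  shows "graded \<alpha>"
  unfolding graded_def
proof
  fix m
  show "(\<lambda>v. \<alpha> v $ m) \<in> forms s W m"
  proof (induction m rule: less_induct)
    case (less m)
    show ?case
    proof (cases "m = 0")
      case True
      have "(\<lambda>v. \<alpha> v $ 0) = restr W (\<lambda>_. a)"
        by (rule ext) (simp add: fun_simps root(1) out)
      then show ?thesis using True forms_const by simp
    next
      case False
      define A where "A v = Abs_fps (\<lambda>n. if n < m then \<alpha> v $ n else 0)" for v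
      have "graded A"
        unfolding graded_def
      proof
        fix n
        show "(\<lambda>v. A v $ n) \<in> forms s W n"
          using less.IH[of n] forms_zero[of n] by (cases "n < m") (simp_all add: A_def zero_fun_def)
      qed
      then have g: "graded (\<lambda>v. poly (P v) (A v))" by (rule graded_poly[OF P])
      have "\<alpha> v $ m = (- 1 / c) * (poly (P v) (A v) $ m)" for v
      proof (cases "v \<in> W")
        case True
        have eq: "A v $ j = \<alpha> v $ j" if "j < m" for j using that by (simp add: A_def)
        have "poly (P v) (A v) $ m = poly (P v) (\<alpha> v) $ m + (A v $ m - \<alpha> v $ m) * poly (pderiv (P v)) (\<alpha> v) $ 0"
          using False by (intro poly_fps_nth_truncated(1) eq) simp_all
        then show ?thesis using c True by (simp add: root A_def)
      next
        case False
        then show ?thesis using graded_outside[OF g] out by simp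
      qed
      then have "(\<lambda>v. \<alpha> v $ m) = fscale (- 1 / c) (\<lambda>v. poly (P v) (A v) $ m)"
        by (intro ext) (simp only: fscale_apply)
      then show ?thesis using forms_scale[OF gradedD[OF g]] by (simp only:)
    qed
  qed
qed

lemma poly_ev_bip:
  assumes "p1 \<in> W" "p0 \<in> W" "f \<in> forms s W d" "v \<in> W"
  shows "poly (ev t (bip p1 p0 v f)) x = f (s x p1 + p0 + s t v)"
  using poly_bip[OF assms] by (simp add: poly_ev)

lemma degree_bip:
  assumes "p1 \<in> W" "p0 \<in> W" "f \<in> forms s W d" "v \<in> W" "f p1 \<noteq> 0"
  shows "degree (bip p1 p0 v f) = d"
proof (rule antisym)
  show "degree (bip p1 p0 v f) \<le> d"
    using total_degree_le_degree[OF total_degree_bip] assms by blast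
  show "d \<le> degree (bip p1 p0 v f)"
    using coeff_bip_top assms by (intro le_degree) simp
qed

lemma graded_coeff_ps_bip:
  assumes "p1 \<in> W" "p0 \<in> W" "f \<in> forms s W d"
  shows "graded (\<lambda>v. coeff (ps (bip p1 p0 v f)) j)"
  using coeff_bip_forms[OF assms] by (simp add: graded_def coeff_ps_nth)

lemma graded_coeff_pderiv:
  assumes "\<And>j. graded (\<lambda>v. coeff (P v) j)"
  shows "graded (\<lambda>v. coeff ((pderiv ^^ n) (P v)) j)"
proof (induction n arbitrary: j)
  case (Suc n)
  then show ?case using graded_of_nat[OF Suc[of "Suc j"], of "Suc j"] by (simp add: coeff_pderiv)
qed (simp add: assms)

lemma degree_funpow_pderiv: "degree ((pderiv ^^ n) P) \<le> degree P"
  for P :: "complex fps poly"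
proof (induction n)
  case (Suc n)
  have "degree ((pderiv ^^ Suc n) P) \<le> degree ((pderiv ^^ n) P)" by (simp add: degree_pderiv)
  then show ?case using Suc by linarith
qed simp

section \<open>Families of power series roots\<close>

text \<open>
  If in every direction \<open>v\<close> some factor \<open>R\<close> of \<open>f (x p\<^sub>1 + p\<^sub>0 + t v)\<close> with the same prime divisors
  has distinct roots at \<open>t = 0\<close>, then the roots do not branch at \<open>t = 0\<close>: they are power series in \<open>t\<close> whose
  coefficients are forms in \<open>v\<close>.
\<close>

lemma graded_roots:
  assumes f: "f \<in> forms s W d" and p: "p1 \<in> W" "p0 \<in> W" and fp1: "f p1 \<noteq> 0"
    and Z: "Z = {x. f (s x p1 + p0) = 0}"
    and R: "\<And>v. v \<in> W \<Longrightarrow> \<exists>R K. R dvd bip p1 p0 v f \<and> bip p1 p0 v f dvd R ^ K \<and> degree R = card Z"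
  obtains \<alpha> M where "\<And>a. a \<in># M \<Longrightarrow> graded (\<alpha> a)" "set_mset M \<subseteq> Z"
    "\<And>v. v \<in> W \<Longrightarrow> ps (bip p1 p0 v f) = smult (fps_const (f p1)) (\<Prod>a\<in>#M. [:- \<alpha> a v, 1:])"
proof -
  let ?F = "\<lambda>v. bip p1 p0 v f"
  \<comment> \<open>At \<open>t = 0\<close> the direction \<open>v\<close> drops out, so \<open>U\<close> and the multiset \<open>M\<close> of its roots do not depend on \<open>v\<close>.\<close>
  define U where "U = ev 0 (?F 0)"
  have U: "ev 0 (?F v) = U" if "v \<in> W" for v
    unfolding U_def by (subst poly_eq_poly_eq_iff[symmetric])
      (use that mem_0 in \<open>simp add: fun_eq_iff poly_ev_bip[OF p f]\<close>)
  have UZ: "{x. poly U x = 0} = Z"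
    using poly_ev_bip[OF p f mem_0] by (simp add: U_def Z)
  have F0: "?F v \<noteq> 0" if "v \<in> W" for v
    using coeff_bip_top[OF p f that] fp1 by auto
  have "coeff U d = f p1" using coeff_bip_top[OF p f mem_0] by (simp add: U_def coeff_ev)
  then have U0: "U \<noteq> 0" using fp1 by auto
  have finZ: "finite Z" using poly_roots_finite[OF U0] UZ by simp
  define M where "M = proots U"
  have setM: "set_mset M = Z" using U0 UZ by (simp add: M_def)
  have "\<exists>\<alpha>. (\<forall>a\<in>Z. \<alpha> a $ 0 = a) \<and> ps (?F v) = smult (fps_const (f p1)) (\<Prod>a\<in>#M. [:- \<alpha> a, 1:])"
    if v: "v \<in> W" for v
  proof -
    obtain R K where R: "R dvd ?F v" "?F v dvd R ^ K" "degree R = card Z" using R[OF v] by blast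
    obtain H where H: "?F v = R * H" using R(1) by (elim dvdE)
    obtain H' where H': "R ^ K = ?F v * H'" using R(2) by (elim dvdE)
    have R0: "R \<noteq> 0" "H \<noteq> 0" using F0[OF v] H by auto
    have td: "total_degree_le (degree R) R"
      using total_degree_factor[of d R H] total_degree_bip[OF p f] degree_bip[OF p f v fp1] F0[OF v] H by metis
    then have "degree R + degree (lead_coeff R) \<le> degree R"
      using R0 by (intro total_degree_le_coeff) auto
    then obtain l where l: "lead_coeff R = [:l:]" by (metis add_le_same_cancel1 degree_eq_zeroE le_zero_eq)
    have l0: "l \<noteq> 0" using l R0 by auto
    have evF: "U = ev 0 R * ev 0 H" using U[OF v] by (simp add: H ev_mult)
    have evR0: "ev 0 R \<noteq> 0" using evF U0 by auto
    have "coeff (ev 0 R) (degree R) = l" using l by (simp add: coeff_ev)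
    then have dR: "degree (ev 0 R) = degree R"
      using l0 by (intro antisym le_degree degree_le) (auto simp: coeff_ev coeff_eq_0)
    have evpow: "ev 0 (R ^ k) = ev 0 R ^ k" for k
      by (subst poly_eq_poly_eq_iff[symmetric]) (simp add: fun_eq_iff poly_ev)
    have rootR: "poly (ev 0 R) a = 0" if "a \<in> Z" for a
    proof -
      have "ev 0 R ^ K = U * ev 0 H'" using evpow[of K] H' U[OF v] by (simp add: ev_mult)
      then have "poly (ev 0 R) a ^ K = 0"
        using that UZ by (metis (mono_tags) mem_Collect_eq mult_zero_left poly_mult poly_power)
      then show ?thesis by simp
    qed
    have "{x. poly (ev 0 R) x = 0} = Z"
    proof
      show "Z \<subseteq> {x. poly (ev 0 R) x = 0}" using rootR by blast
      show "{x. poly (ev 0 R) x = 0} \<subseteq> Z" unfolding UZ[symmetric] evF by auto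
    qed
    then have simple: "poly (pderiv (ev 0 R)) a \<noteq> 0" if "a \<in> Z" for a
      using R(3) dR rootR[OF that] by (intro distinct_roots_simple[OF evR0]) simp_all
    have "\<exists>\<alpha>. \<alpha> $ 0 = a \<and> poly (ps R) \<alpha> = 0" if "a \<in> Z" for a
    proof (rule hensel)
      show "poly (ps R) (fps_const a) $ 0 = 0" using rootR[OF that] by (simp add: poly_ps_nth_0)
      show "poly (pderiv (ps R)) (fps_const a) $ 0 \<noteq> 0"
        using simple[OF that] by (simp add: ps_pderiv[symmetric] poly_ps_nth_0 ev_pderiv)
    qed
    then obtain \<alpha> where \<alpha>: "\<And>a. a \<in> Z \<Longrightarrow> \<alpha> a $ 0 = a" "\<And>a. a \<in> Z \<Longrightarrow> poly (ps R) (\<alpha> a) = 0" by metis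
    have "inj_on \<alpha> Z" using \<alpha>(1) by (metis inj_onI)
    then have psR: "ps R = smult (lead_coeff (ps R)) (\<Prod>a\<in>#mset_set Z. [:- \<alpha> a, 1:])"
      using distinct_roots_product[of Z \<alpha> "ps R"] finZ \<alpha>(2) R(3) by (simp add: degree_ps)
    have pw: "(\<Prod>a\<in>#repeat_mset k N. q a) = (\<Prod>a\<in>#N. q a) ^ k" for k and N :: "complex multiset" and q :: "complex \<Rightarrow> complex fps poly"
      by (induction k) simp_all
    have "ps (?F v) * ps H' = ps R ^ K" by (metis H' ps_mult ps_power)
    also have "\<dots> = smult (lead_coeff (ps R) ^ K) (\<Prod>a\<in>#repeat_mset K (mset_set Z). [:- \<alpha> a, 1:])"
      unfolding pw by (subst psR) (rule smult_power)
    finally obtain N u w where N: "N \<subseteq># repeat_mset K (mset_set Z)" "ps (?F v) = smult u (\<Prod>a\<in>#N. [:- \<alpha> a, 1:])"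
      using factor_of_linear_product[of "ps (?F v)" "ps H'" "lead_coeff (ps R) ^ K" \<alpha>] R0
      by (metis leading_coeff_0_iff power_not_zero ps_eq_0_iff)
    have NZ: "set_mset N \<subseteq> Z"
    proof -
      have "set_mset (repeat_mset k X) \<subseteq> set_mset X" for k and X :: "complex multiset"
        by (induction k) auto
      then show ?thesis using set_mset_mono[OF N(1)] finZ by (metis finite_set_mset_mset_set subset_trans)
    qed
    have u0: "u \<noteq> 0"
    proof
      assume "u = 0"
      then have "ps (?F v) = 0" unfolding N(2) by simp
      then show False using F0[OF v] ps_eq_0_iff by blast
    qed
    have "size N = degree (ps (?F v))" unfolding N(2) using u0 by (simp add: prod_linear_monic(2))
    then have sN: "size N = d" using degree_bip[OF p f v fp1] by (simp add: degree_ps)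
    have "u = coeff (ps (?F v)) d" unfolding N(2) using prod_linear_monic(1)[of \<alpha> N] sN by simp
    then have u: "u = fps_const (f p1)"
      using coeff_bip_top[OF p f v] by (simp add: coeff_ps fps_of_poly_const)
    have "U = smult (f p1) (\<Prod>a\<in>#N. [:- a, 1:])"
    proof (subst poly_eq_poly_eq_iff[symmetric], rule ext)
      fix x
      have "poly U x = poly (ps (?F v)) (fps_const x) $ 0" using U[OF v] by (simp add: poly_ps_nth_0)
      also have "\<dots> = f p1 * (\<Prod>a\<in>#N. fps_const x - \<alpha> a) $ 0"
        unfolding N(2) u by (simp add: poly_prod_mset)
      also have "(\<Prod>a\<in>#N. fps_const x - \<alpha> a) $ 0 = (\<Prod>a\<in>#N. x - a)"
        using NZ by (induction N) (auto simp: \<alpha>(1))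
      finally show "poly U x = poly (smult (f p1) (\<Prod>a\<in>#N. [:- a, 1:])) x"
        by (simp add: poly_prod_mset)
    qed
    moreover have "proots (\<Prod>a\<in>#N. [:- a, 1:]) = N"
    proof (induction N)
      case (add a N)
      have "(\<Prod>a\<in>#N. [:- a, 1:]) \<noteq> 0"
        using prod_linear_monic(1)[of "\<lambda>a. a" N] by auto
      then have "proots ([:- a, 1:] * (\<Prod>a\<in>#N. [:- a, 1:])) = {#a#} + N"
        using add by (subst proots_mult) auto
      then show ?case by (simp del: mult_pCons_left)
    qed simp
    ultimately have "N = M" using fp1 by (simp add: M_def)
    then show ?thesis using \<alpha>(1) N(2) u by blast
  qed
  then obtain \<alpha>0 where \<alpha>0: "\<And>v a. v \<in> W \<Longrightarrow> a \<in> Z \<Longrightarrow> \<alpha>0 v a $ 0 = a"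
    "\<And>v. v \<in> W \<Longrightarrow> ps (?F v) = smult (fps_const (f p1)) (\<Prod>a\<in>#M. [:- \<alpha>0 v a, 1:])" by metis
  define \<alpha> where "\<alpha> a v = (if v \<in> W then \<alpha>0 v a else 0)" for a v
  have graded: "graded (\<alpha> a)" if a: "a \<in># M" for a
  proof -
    have aZ: "a \<in> Z" using a setM by auto
    obtain m where m: "count M a = Suc m" using a by (metis count_greater_zero_iff gr0_implies_Suc)
    define N where "N = filter_mset (\<lambda>b. b \<noteq> a) M"
    have MN: "M = replicate_mset (Suc m) a + N"
      by (rule multiset_eqI) (auto simp: N_def m)
    define k :: nat where "k = fact (Suc m)"
    have k0: "k \<noteq> 0" unfolding k_def by (rule fact_nonzero)
    define c where "c = of_nat k * (f p1 * (\<Prod>b\<in>#N. a - b))"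
    have NZ: "set_mset N \<subseteq> Z" using setM by (auto simp: N_def)
    have dec: "ps (?F v) = [:- \<alpha>0 v a, 1:] ^ Suc m * smult (fps_const (f p1)) (\<Prod>b\<in>#N. [:- \<alpha>0 v b, 1:])"
      if "v \<in> W" for v
    proof -
      have "ps (?F v) = smult (fps_const (f p1)) (\<Prod>b\<in>#replicate_mset (Suc m) a + N. [:- \<alpha>0 v b, 1:])"
        using \<alpha>0(2)[OF that] MN by metis
      then show ?thesis
        by (simp only: image_mset_union prod_mset.union image_replicate_mset prod_mset_replicate_mset mult_smult_right)
    qed
    \<comment> \<open>A root of multiplicity \<open>m + 1\<close> is a simple root of the \<open>m\<close>-th derivative.\<close>
    show ?thesis
    proof (rule graded_root[of "\<lambda>v. (pderiv ^^ m) (ps (?F v))" d])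
      show "graded (\<lambda>v. coeff ((pderiv ^^ m) (ps (?F v))) j)" for j
        by (intro graded_coeff_pderiv graded_coeff_ps_bip[OF p f])
      show "degree ((pderiv ^^ m) (ps (?F v))) \<le> d" for v
        using degree_funpow_pderiv[of m "ps (?F v)"] total_degree_le_degree[OF total_degree_bip[OF p f, of v]]
        by (simp add: degree_ps)
      show "\<alpha> a v $ 0 = a" if "v \<in> W" for v using \<alpha>0(1)[OF that aZ] that by (simp add: \<alpha>_def)
      show "\<alpha> a v = 0" if "v \<notin> W" for v using that by (simp add: \<alpha>_def)
      show "poly ((pderiv ^^ m) (ps (?F v))) (\<alpha> a v) = 0" if "v \<in> W" for v
      proof -
        have "ps (?F v) = [:- \<alpha>0 v a, 1:] ^ m * ([:- \<alpha>0 v a, 1:] * smult (fps_const (f p1)) (\<Prod>b\<in>#N. [:- \<alpha>0 v b, 1:]))"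
          unfolding dec[OF that] by (simp only: power_Suc2 mult.assoc)
        then have "poly ((pderiv ^^ m) (ps (?F v))) (\<alpha>0 v a) = of_nat (fact m) * poly ([:- \<alpha>0 v a, 1:] * smult (fps_const (f p1)) (\<Prod>b\<in>#N. [:- \<alpha>0 v b, 1:])) (\<alpha>0 v a)"
          by (simp only: pderiv_funpow_linear_power)
        then show ?thesis using that by (simp add: \<alpha>_def)
      qed
      show "poly (pderiv ((pderiv ^^ m) (ps (?F v)))) (\<alpha> a v) $ 0 = c" if v: "v \<in> W" for v
      proof -
        have "poly ((pderiv ^^ Suc m) (ps (?F v))) (\<alpha>0 v a) = of_nat k * (fps_const (f p1) * (\<Prod>b\<in>#N. \<alpha>0 v a - \<alpha>0 v b))"
          unfolding dec[OF that] pderiv_funpow_linear_power k_def[symmetric] by (simp add: poly_prod_mset)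
        moreover have "(\<Prod>b\<in>#N. \<alpha>0 v a - \<alpha>0 v b) $ 0 = (\<Prod>b\<in>#N. a - b)"
          using NZ \<alpha>0(1)[OF v] aZ by (induction N) auto
        moreover have "(of_nat k * X) $ 0 = of_nat k * X $ 0" for k and X :: "complex fps"
          by (induction k) (simp_all add: distrib_right)
        ultimately show ?thesis using v by (simp add: \<alpha>_def c_def)
      qed
      show "c \<noteq> 0" using fp1 k0 by (auto simp: c_def N_def)
    qed
  qed
  show thesis
  proof (rule that[of M \<alpha>])
    show "ps (?F v) = smult (fps_const (f p1)) (\<Prod>a\<in>#M. [:- \<alpha> a v, 1:])" if "v \<in> W" for v
      using \<alpha>0(2)[OF that] that by (simp add: \<alpha>_def)
  qed (use graded setM in auto)
qed

section \<open>A factorization along generic directions extends\<close>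

text \<open>
  A factorization of \<open>f (x p\<^sub>1 + p\<^sub>0 + t v)\<close> picks a subset of the roots \<open>\<alpha>\<^sub>i\<close> such that the product of the
  chosen \<open>\<alpha>\<^sub>i\<close>, a power series in \<open>t\<close> with coefficients that are forms in \<open>v\<close>, stops at the expected
  degree, and so does the complementary product.  There are finitely many subsets, and the vanishing
  of the superfluous coefficients for generic \<open>v\<close> is their vanishing for all \<open>v\<close>.  As \<open>f v\<close> is the
  coefficient of \<open>t\<^sup>d\<close> in \<open>f (p\<^sub>0 + t v)\<close>, it is then, up to a constant, the product of the top
  coefficients of the two products.
\<close>

lemma reducible_if_generic_directions_split:
  fixes \<alpha> :: "'i \<Rightarrow> 'a \<Rightarrow> complex fps"
  assumes f: "f \<in> forms s W d" and p: "p1 \<in> W" "p0 \<in> W" and fp1: "f p1 \<noteq> 0"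
    and \<alpha>: "\<And>i. i \<in># M \<Longrightarrow> graded (\<alpha> i)"
    and prod: "\<And>v. v \<in> W \<Longrightarrow> ps (bip p1 p0 v f) = smult (fps_const (f p1)) (\<Prod>i\<in>#M. [:- \<alpha> i v, 1:])"
    and \<Psi>: "line_poly \<Psi>" "x0 \<in> W" "\<Psi> x0 \<noteq> 0"
    and split: "\<And>v. v \<in> W \<Longrightarrow> \<Psi> v \<noteq> 0 \<Longrightarrow>
      \<exists>G H. bip p1 p0 v f = G * H \<and> 0 < degree G \<and> degree G < d"
  shows "reducible s W d f"
proof -
  let ?F = "\<lambda>v. bip p1 p0 v f"
  define S where "S = {N. N \<subseteq># M \<and> 0 < size N \<and> size N < d}"
  have fin: "finite S" unfolding S_def by (rule finite_subset[OF _ finite_submultisets[of M]]) auto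
  have gr: "graded (beta \<alpha> N)" if "N \<subseteq># M" for N
    using that by (intro graded_beta \<alpha>) (rule mset_subset_eqD)
  have sizeM: "size M = d"
  proof -
    have "degree (ps (?F p0)) = size M"
      unfolding prod[OF p(2)] using fp1 by (simp add: prod_linear_monic(2))
    then show ?thesis using degree_bip[OF p f p(2) fp1] by (simp add: degree_ps)
  qed
  define good where "good N v \<longleftrightarrow> (\<forall>m>size N. beta \<alpha> N v $ m = 0) \<and> (\<forall>m>size (M - N). beta \<alpha> (M - N) v $ m = 0)" for N v
  have 1: "\<exists>N\<in>S. good N v" if v: "v \<in> W" "\<Psi> v \<noteq> 0" for v
  proof -
    obtain G H where GH: "?F v = G * H" "0 < degree G" "degree G < d" using split[OF v] by blast
    have F0: "?F v \<noteq> 0" using coeff_bip_top[OF p f v(1)] fp1 by auto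
    then have nz: "G \<noteq> 0" "H \<noteq> 0" using GH by auto
    have dF: "degree (G * H) = d" using degree_bip[OF p f v(1) fp1] GH by simp
    have td: "total_degree_le d (G * H)" using total_degree_bip[OF p f, of v] GH by simp
    have tdG: "total_degree_le (degree G) G" using total_degree_factor[OF td dF] F0 GH by simp
    have tdH: "total_degree_le (degree H) H"
      using total_degree_factor[of d H G] td dF F0 GH by (simp add: mult.commute)
    have "ps G * ps H = smult (fps_const (f p1)) (\<Prod>i\<in>#M. [:- \<alpha> i v, 1:])"
      using prod[OF v(1)] GH(1) by (simp only: ps_mult)
    then obtain N u w where N: "N \<subseteq># M" "ps G = smult u (\<Prod>i\<in>#N. [:- \<alpha> i v, 1:])"
      "ps H = smult w (\<Prod>i\<in>#M - N. [:- \<alpha> i v, 1:])"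
      using factor_of_linear_product[of "ps G" "ps H" "fps_const (f p1)" "\<lambda>i. \<alpha> i v" M] fp1 by auto
    have "size N = degree G" by (rule linear_factor_constant_term(1)[OF N(2) nz(1) tdG])
    then have "N \<in> S" using N(1) GH by (simp add: S_def)
    moreover have "good N v"
      using linear_factor_constant_term(2)[OF N(2) nz(1) tdG] linear_factor_constant_term(2)[OF N(3) nz(2) tdH] v
      by (simp add: good_def beta_def)
    ultimately show ?thesis by blast
  qed
  have "\<exists>N\<in>S. \<forall>v\<in>W. good N v"
  proof (rule ccontr)
    assume none: "\<not> (\<exists>N\<in>S. \<forall>v\<in>W. good N v)"
    have "\<exists>c. line_poly c \<and> (\<exists>v\<in>W. c v \<noteq> 0) \<and> (\<forall>v. good N v \<longrightarrow> c v = 0)" if "N \<in> S" for N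
    proof -
      have "\<not> (\<forall>v\<in>W. good N v)" using bspec[of S "\<lambda>N. \<not> (\<forall>v\<in>W. good N v)" N] none that by meson
      then obtain v where v: "v \<in> W" "\<not> good N v" by meson
      have sub: "N \<subseteq># M" "M - N \<subseteq># M" using that by (simp_all add: S_def)
      have lp: "line_poly (\<lambda>v. beta \<alpha> N' v $ m)" if "N' \<subseteq># M" for N' m
        using gradedD[OF gr[OF that]] by (rule forms_line_poly)
      from v(2) consider m where "size N < m" "beta \<alpha> N v $ m \<noteq> 0"
        | m where "size (M - N) < m" "beta \<alpha> (M - N) v $ m \<noteq> 0" unfolding good_def by blast
      then show ?thesis
      proof cases
        case 1
        then show ?thesis
          using lp[OF sub(1)] v(1) by (intro exI[of _ "\<lambda>v. beta \<alpha> N v $ m"]) (auto simp: good_def)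
      next
        case 2
        then show ?thesis
          using lp[OF sub(2)] v(1) by (intro exI[of _ "\<lambda>v. beta \<alpha> (M - N) v $ m"]) (auto simp: good_def)
      qed
    qed
    then obtain c where c: "\<And>N. N \<in> S \<Longrightarrow> line_poly (c N)" "\<And>N. N \<in> S \<Longrightarrow> \<exists>v\<in>W. c N v \<noteq> 0"
      "\<And>N v. N \<in> S \<Longrightarrow> good N v \<Longrightarrow> c N v = 0" by metis
    have "\<exists>z\<in>W. \<forall>\<Phi>\<in>insert \<Psi> (c ` S). \<Phi> z \<noteq> 0"
      using fin \<Psi> c(1,2) by (intro line_poly_family_nonzero) auto
    then obtain z where "z \<in> W" "\<Psi> z \<noteq> 0" "\<And>N. N \<in> S \<Longrightarrow> c N z \<noteq> 0" by auto
    then show False using 1 c(3) by blast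
  qed
  then obtain N where N: "N \<in> S" "\<And>v. v \<in> W \<Longrightarrow> good N v" by blast
  then have sub: "N \<subseteq># M" "M - N \<subseteq># M" and k: "0 < size N" "size N < d" by (simp_all add: S_def)
  define e where "e = f p1 * (- 1) ^ d"
  define g where "g = fscale e (\<lambda>v. beta \<alpha> N v $ size N)"
  define h where "h = (\<lambda>v. beta \<alpha> (M - N) v $ (d - size N))"
  have sMN: "size (M - N) = d - size N" using sub(1) sizeM by (simp add: size_Diff_submset)
  have "g \<in> forms s W (size N)" unfolding g_def by (intro forms_scale gradedD gr sub)
  moreover have "h \<in> forms s W (d - size N)" unfolding h_def by (intro gradedD gr sub)
  moreover have "f = g * h"
  proof (rule ext)
    fix v
    show "f v = (g * h) v"
    proof (cases "v \<in> W")
      case True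
      have "f v = fps_of_poly (coeff (?F v) 0) $ d"
        using coeff_coeff_bip_top[OF p f True] by (simp add: fps_of_poly_nth)
      also have "fps_of_poly (coeff (?F v) 0) = poly (ps (?F v)) 0" by (simp add: poly_0_coeff_0 coeff_ps)
      also have "\<dots> = fps_const (f p1) * (\<Prod>i\<in>#M. - \<alpha> i v)"
        unfolding prod[OF True] by (simp add: poly_prod_mset)
      also have "(\<Prod>i\<in>#M. - \<alpha> i v) = (- 1) ^ size M * (\<Prod>i\<in>#M. \<alpha> i v)"
        by (induction M) auto
      also have "(- 1 :: complex fps) ^ size M = fps_const ((- 1) ^ d)"
        unfolding sizeM by (metis fps_const_1_eq_1 fps_const_neg fps_const_power)
      also have "(\<Prod>i\<in>#M. \<alpha> i v) = beta \<alpha> N v * beta \<alpha> (M - N) v"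
        using True sub(1) by (simp add: beta_def flip: prod_mset.union image_mset_union)
      finally have "f v = e * (beta \<alpha> N v * beta \<alpha> (M - N) v) $ d"
        by (simp add: e_def mult.assoc)
      also have "(beta \<alpha> N v * beta \<alpha> (M - N) v) $ d = (\<Sum>i=0..d. beta \<alpha> N v $ i * beta \<alpha> (M - N) v $ (d - i))"
        by (rule fps_mult_nth)
      also have "\<dots> = (\<Sum>i\<in>{size N}. beta \<alpha> N v $ i * beta \<alpha> (M - N) v $ (d - i))"
      proof (rule sum.mono_neutral_right)
        show "\<forall>i\<in>{0..d} - {size N}. beta \<alpha> N v $ i * beta \<alpha> (M - N) v $ (d - i) = 0"
        proof
          fix i assume i: "i \<in> {0..d} - {size N}"
          show "beta \<alpha> N v $ i * beta \<alpha> (M - N) v $ (d - i) = 0"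
          proof (cases "size N < i")
            case True
            then show ?thesis using N(2)[OF \<open>v \<in> W\<close>] by (simp add: good_def)
          next
            case False
            then have "size (M - N) < d - i" using i k sMN by auto
            then show ?thesis using N(2)[OF \<open>v \<in> W\<close>] by (simp add: good_def)
          qed
        qed
      qed (use k in auto)
      finally show ?thesis by (simp add: g_def h_def fun_simps)
    next
      case False
      then show ?thesis using forms_outside[OF f] by (simp add: fun_simps h_def beta_def)
    qed
  qed
  ultimately show ?thesis
    unfolding reducible_def using k by (intro exI[of _ "size N"]) auto
qed

section \<open>Bertini's theorem\<close>

lemma exists_t_nonzero:
  assumes "line_poly \<Psi>" "x \<in> W" "v \<in> W" "\<Psi> x \<noteq> 0" "\<rho> \<noteq> (0 :: complex poly)"
  shows "\<exists>t. \<Psi> (x + s t v) \<noteq> 0 \<and> poly \<rho> t \<noteq> 0"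
proof -
  obtain q where q: "\<forall>t. \<Psi> (x + s t v) = poly q t" using assms unfolding line_poly_def by meson
  have "poly q 0 \<noteq> 0" using q[rule_format, of 0] assms by simp
  then have "q * \<rho> \<noteq> 0" using assms(5) by auto
  then obtain t where "poly (q * \<rho>) t \<noteq> 0" using poly_all_0_iff_0 by blast
  then show ?thesis using q by (intro exI[of _ t]) auto
qed

text \<open>
  Choose \<open>p\<^sub>0\<close> with the largest possible number \<open>r\<close> of roots of \<open>f (x p\<^sub>1 + p\<^sub>0)\<close>.  The radical of
  \<open>f (x p\<^sub>1 + p\<^sub>0 + t v)\<close> then has \<open>x\<close>-degree exactly \<open>r\<close>, since its roots are distinct for almost all
  \<open>t\<close>.  If \<open>r < d\<close>, it is a proper factor in every direction \<open>v\<close>,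
  so that \<open>f\<close> is reducible.
\<close>

lemma exists_separable_line:
  assumes f: "f \<in> forms s W d" and d: "1 \<le> d" and p1: "p1 \<in> W" and fp1: "f p1 \<noteq> 0"
    and \<Psi>: "line_poly \<Psi>" "y0 \<in> W" "\<Psi> y0 \<noteq> 0" and irred: "\<not> reducible s W d f"
  shows "\<exists>p0\<in>W. \<Psi> p0 \<noteq> 0 \<and> card {x. f (s x p1 + p0) = 0} = d"
proof -
  define Z where "Z y = {x. f (s x p1 + y) = 0}" for y
  let ?U = "\<lambda>y. ev 0 (bip p1 y 0 f)"
  have U: "{x. poly (?U y) x = 0} = Z y" if "y \<in> W" for y
    using poly_ev_bip[OF p1 that f mem_0] by (simp add: Z_def)
  have degU: "degree (?U y) = d" "?U y \<noteq> 0" if "y \<in> W" for y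
  proof -
    have "coeff (?U y) d = f p1" using coeff_bip_top[OF p1 that f mem_0] by (simp add: coeff_ev)
    moreover have "degree (?U y) \<le> d"
      using degree_bip[OF p1 that f mem_0 fp1] by (intro degree_le) (simp add: coeff_ev coeff_eq_0)
    ultimately show "degree (?U y) = d" "?U y \<noteq> 0" using fp1 by (auto intro!: antisym le_degree)
  qed
  have finZ: "finite (Z y)" if "y \<in> W" for y using poly_roots_finite[OF degU(2)] U that by metis
  have leZ: "card (Z y) \<le> d" if "y \<in> W" for y
    using card_poly_roots_bound[OF degU(2)[OF that]] U[OF that] degU(1)[OF that] by simp
  define P where "P k \<longleftrightarrow> (\<exists>y\<in>W. \<Psi> y \<noteq> 0 \<and> card (Z y) = k)" for k
  have "P (card (Z y0))" using \<Psi> by (auto simp: P_def)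
  moreover have "\<forall>k. P k \<longrightarrow> k \<le> d" using leZ by (auto simp: P_def)
  ultimately obtain r where r: "P r" "\<And>k. P k \<Longrightarrow> k \<le> r"
    using Nat.ex_has_greatest_nat[of P "card (Z y0)" d] by meson
  obtain p0 where p0: "p0 \<in> W" "\<Psi> p0 \<noteq> 0" "card (Z p0) = r" using r(1) by (auto simp: P_def)
  note p = p1 p0(1)
  let ?F = "\<lambda>v. bip p1 p0 v f"
  show ?thesis
  proof (cases "r = d")
    case True
    then show ?thesis using p0 by (auto simp: Z_def)
  next
    case False
    then have rd: "r < d" using p0(3) leZ[OF p0(1)] by linarith
    have "Z p0 \<noteq> {}"
    proof -
      have "\<not> constant (poly (?U p0))" using degU[OF p0(1)] d by (simp add: constant_degree)
      then obtain x where "poly (?U p0) x = 0" using fundamental_theorem_of_algebra by blast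
      then show ?thesis using U[OF p0(1)] by auto
    qed
    then have r0: "0 < r" using finZ[OF p0(1)] p0(3) by (metis card_gt_0_iff)
    have radical: "\<exists>R K. R dvd ?F v \<and> ?F v dvd R ^ K \<and> degree R = r" if v: "v \<in> W" for v
    proof -
      have F0: "?F v \<noteq> 0" using coeff_bip_top[OF p f v] fp1 by auto
      obtain R K where R: "R dvd ?F v" "?F v dvd R ^ K" "\<And>D. D dvd R \<Longrightarrow> D dvd pderiv R \<Longrightarrow> degree D = 0"
        using squarefree_radical[OF F0] by blast
      obtain H where H: "?F v = R * H" using R(1) by (elim dvdE)
      obtain H' where H': "R ^ K = ?F v * H'" using R(2) by (elim dvdE)
      have R0: "R \<noteq> 0" using F0 H by auto
      have td: "total_degree_le (degree R) R"
        using total_degree_factor[of d R H] total_degree_bip[OF p f] degree_bip[OF p f v fp1] F0 H by metis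
      then have "degree R + degree (lead_coeff R) \<le> degree R"
        using R0 by (intro total_degree_le_coeff) auto
      then obtain l where l: "lead_coeff R = [:l:]" by (metis add_le_same_cancel1 degree_eq_zeroE le_zero_eq)
      have l0: "l \<noteq> 0" using l R0 by auto
      have dR: "degree (ev t R) = degree R" for t
      proof -
        have "coeff (ev t R) (degree R) = l" using l by (simp add: coeff_ev)
        then show ?thesis using l0 by (intro antisym le_degree degree_le) (auto simp: coeff_ev coeff_eq_0)
      qed
      have nzR: "ev t R \<noteq> 0" for t
      proof -
        have "coeff (ev t R) (degree R) = l" using l by (simp add: coeff_ev)
        then show ?thesis using l0 by auto
      qed
      have pv: "p0 + s t v \<in> W" for t using p0(1) v by (simp add: mem_add mem_scale)
      have evZ: "poly (ev t (?F v)) x = 0 \<longleftrightarrow> x \<in> Z (p0 + s t v)" for t x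
        unfolding Z_def mem_Collect_eq poly_ev_bip[OF p f v] add.assoc by (rule refl)
      have RZ: "{x. poly (ev t R) x = 0} \<subseteq> Z (p0 + s t v)" for t
      proof
        fix x assume "x \<in> {x. poly (ev t R) x = 0}"
        then have "poly (ev t (?F v)) x = 0" by (simp add: H ev_mult)
        then show "x \<in> Z (p0 + s t v)" using evZ by blast
      qed
      obtain A B \<rho> where \<rho>: "\<rho> \<noteq> 0" "A * R + B * pderiv R = [:\<rho>:]"
        by (rule coprime_bezout[OF R0 R(3)])
      obtain t where t: "\<Psi> (p0 + s t v) \<noteq> 0" "poly \<rho> t \<noteq> 0"
        using exists_t_nonzero[OF \<Psi>(1) p0(1) v p0(2) \<rho>(1)] by blast
      \<comment> \<open>For this \<open>t\<close> the roots of \<open>R\<close> are distinct, whereas at \<open>t = 0\<close> all roots of \<open>f\<close> are roots of \<open>R\<close>.\<close>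
      have "card {x. poly (ev t R) x = 0} = degree (ev t R)"
      proof (rule card_roots_separable[OF nzR])
        fix x assume x: "poly (ev t R) x = 0"
        have "poly \<rho> t = poly (poly (A * R + B * pderiv R) [:x:]) t" unfolding \<rho>(2) by simp
        also have "\<dots> = poly (ev t A) x * poly (ev t R) x + poly (ev t B) x * poly (pderiv (ev t R)) x"
          by (simp add: poly_ev flip: ev_pderiv)
        finally show "poly (pderiv (ev t R)) x \<noteq> 0" using x t(2) by auto
      qed
      then have "degree R \<le> card (Z (p0 + s t v))"
        using card_mono[OF finZ[OF pv] RZ] dR by metis
      then have le: "degree R \<le> r" using r(2)[of "card (Z (p0 + s t v))"] t(1) pv by (force simp: P_def)
      have "Z p0 \<subseteq> {x. poly (ev 0 R) x = 0}"
      proof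
        fix x assume "x \<in> Z p0"
        then have "poly (ev 0 (?F v)) x = 0" using evZ[of 0 x] by simp
        then have "poly (poly (R ^ K) [:x:]) 0 = 0" unfolding H' by (simp add: poly_ev)
        then show "x \<in> {x. poly (ev 0 R) x = 0}" by (simp add: poly_ev)
      qed
      then have "r \<le> card {x. poly (ev 0 R) x = 0}"
        using p0(3) card_mono[OF poly_roots_finite[OF nzR]] by blast
      also have "\<dots> \<le> degree R" using card_poly_roots_bound[OF nzR] dR by metis
      finally show ?thesis using le R by (metis antisym)
    qed
    obtain \<alpha> M where \<alpha>: "\<And>a. a \<in># M \<Longrightarrow> graded (\<alpha> a)" "set_mset M \<subseteq> Z p0"
      "\<And>v. v \<in> W \<Longrightarrow> ps (?F v) = smult (fps_const (f p1)) (\<Prod>a\<in>#M. [:- \<alpha> a v, 1:])"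
      using graded_roots[OF f p fp1 Z_def[of p0]] radical p0(3) by metis
    have "reducible s W d f"
    proof (rule reducible_if_generic_directions_split[OF f p fp1 \<alpha>(1) \<alpha>(3) line_poly_const[of 1] mem_0])
      fix v assume v: "v \<in> W"
      obtain R where "R dvd ?F v" "degree R = r" using radical[OF v] by blast
      then show "\<exists>G H. ?F v = G * H \<and> 0 < degree G \<and> degree G < d"
        using r0 rd by (metis dvdE)
    qed auto
    then show ?thesis using irred by blast
  qed
qed

lemma bip_restrict:
  assumes E: "S.subspace E" "E \<subseteq> W" and v: "p1 \<in> E" "p0 \<in> E" "v \<in> E" and f: "f \<in> forms s W d"
  shows "cspace.bip s E p1 p0 v (restr E f) = bip p1 p0 v f"
proof -
  interpret E: cspace s E by unfold_locales (use vs E in auto)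
  have vW: "p1 \<in> W" "p0 \<in> W" "v \<in> W" using E v by auto
  show ?thesis
  proof (rule E.bip_eqI[OF v(3)])
    show "poly (poly (bip p1 p0 v f) [:x:]) t = restr E f (s x p1 + p0 + s t v)" for x t
      using poly_bip[OF vW(1,2) f vW(3)] E.mem_plane[OF v] by (simp add: fun_simps)
  qed
qed

lemma reducible_splits_bip:
  assumes red: "reducible s W d f" and p: "p1 \<in> W" "p0 \<in> W" "v \<in> W" and fp1: "f p1 \<noteq> 0"
  shows "\<exists>G H. bip p1 p0 v f = G * H \<and> 0 < degree G \<and> degree G < d"
proof -
  obtain k g h where k: "1 \<le> k" "k \<le> d - 1" "g \<in> forms s W k" "h \<in> forms s W (d - k)" "f = g * h"
    using red unfolding reducible_def by blast
  have "g p1 \<noteq> 0" using fp1 k(5) by (auto simp: fun_simps)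
  then have "degree (bip p1 p0 v g) = k" using degree_bip[OF p(1,2) k(3) p(3)] by blast
  moreover have "bip p1 p0 v f = bip p1 p0 v g * bip p1 p0 v h"
    unfolding k(5) by (rule bip_mult[OF p(1,2) k(3,4)])
  ultimately show ?thesis using k by (intro exI[of _ "bip p1 p0 v g"] exI[of _ "bip p1 p0 v h"]) auto
qed

text \<open>
  On the line through \<open>p\<^sub>1\<close> and \<open>p\<^sub>0\<close> the form \<open>f\<close> has distinct roots, so these extend to power series
  in every direction, and reducible sections in generic directions would make \<open>f\<close> reducible.
\<close>

lemma bertini:
  assumes f: "f \<in> forms s W d" and p: "p1 \<in> W" "p0 \<in> W" and fp1: "f p1 \<noteq> 0"
    and sep: "card {x. f (s x p1 + p0) = 0} = d"
    and \<Psi>: "line_poly \<Psi>" "x0 \<in> W" "\<Psi> x0 \<noteq> 0" and irred: "\<not> reducible s W d f"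
  shows "\<exists>b\<in>W. \<Psi> b \<noteq> 0 \<and>
    (\<forall>E. S.subspace E \<longrightarrow> E \<subseteq> W \<longrightarrow> {p1, p0, b} \<subseteq> E \<longrightarrow> \<not> reducible s E d (restr E f))"
proof (rule ccontr)
  assume contra: "\<not> ?thesis"
  have "\<exists>R K. R dvd bip p1 p0 v f \<and> bip p1 p0 v f dvd R ^ K \<and> degree R = card {x. f (s x p1 + p0) = 0}"
    if "v \<in> W" for v
    using degree_bip[OF p f that fp1] sep
    by (intro exI[of _ "bip p1 p0 v f"] exI[of _ 1]) simp
  then obtain \<alpha> M where \<alpha>: "\<And>a. a \<in># M \<Longrightarrow> graded (\<alpha> a)" "set_mset M \<subseteq> {x. f (s x p1 + p0) = 0}"
      "\<And>v. v \<in> W \<Longrightarrow> ps (bip p1 p0 v f) = smult (fps_const (f p1)) (\<Prod>a\<in>#M. [:- \<alpha> a v, 1:])"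
      using graded_roots[OF f p fp1 refl] by metis
  have "reducible s W d f"
  proof (rule reducible_if_generic_directions_split[OF f p fp1 \<alpha>(1) \<alpha>(3) \<Psi>])
    fix v assume v: "v \<in> W" "\<Psi> v \<noteq> 0"
    then obtain E where E: "S.subspace E" "E \<subseteq> W" "p1 \<in> E" "p0 \<in> E" "v \<in> E" "reducible s E d (restr E f)"
      using contra by auto
    interpret E: cspace s E by unfold_locales (use vs E in auto)
    have "restr E f p1 \<noteq> 0" using E fp1 by (simp add: fun_simps)
    then show "\<exists>G H. bip p1 p0 v f = G * H \<and> 0 < degree G \<and> degree G < d"
      using E.reducible_splits_bip[OF E(6,3,4,5)] bip_restrict[OF E(1-5) f] by simp
  qed auto
  then show False using irred by blast
qed

end

section \<open>Partial derivatives of forms\<close>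

text \<open>The derivative in \<open>t\<close>; the one in \<open>x\<close> is \<open>pderiv\<close>.\<close>

definition dt :: "complex poly poly \<Rightarrow> complex poly poly" where
  "dt Q = map_poly pderiv Q"

lemma coeff_dt: "coeff (dt Q) i = pderiv (coeff Q i)"
  by (simp add: dt_def coeff_map_poly)

lemma dt_pCons: "dt (pCons c Q) = pCons (pderiv c) (dt Q)"
  by (rule poly_eqI) (simp add: coeff_dt coeff_pCons split: nat.splits)

lemma dt_0: "dt 0 = 0"
  by (simp add: dt_def)

lemma dt_add: "dt (P + Q) = dt P + dt Q"
  by (rule poly_eqI) (simp add: coeff_dt pderiv_add)

lemma dt_diff: "dt (P - Q) = dt P - dt Q"
  by (rule poly_eqI) (simp add: coeff_dt pderiv_diff)

lemma dt_smult: "dt (smult c Q) = smult c (dt Q) + smult (pderiv c) Q"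
  by (rule poly_eqI) (simp add: coeff_dt pderiv_mult mult.commute)

lemma dt_mult: "dt (P * Q) = dt P * Q + P * dt Q"
  by (induction P) (simp_all add: dt_0 dt_add dt_smult dt_pCons algebra_simps)

lemma dt_pderiv: "dt (pderiv Q) = pderiv (dt Q)"
proof (rule poly_eqI)
  fix n
  have "pderiv (of_nat k * p) = of_nat k * pderiv p" for k and p :: "complex poly"
    by (induction k) (simp_all add: pderiv_add pderiv_mult distrib_right)
  then show "coeff (dt (pderiv Q)) n = coeff (pderiv (dt Q)) n"
    by (simp only: coeff_dt coeff_pderiv)
qed

lemma poly_dt: "poly (dt Q) [:x:] = pderiv (poly Q [:x:])"
  by (induction Q) (simp_all add: dt_0 dt_pCons pderiv_add pderiv_mult pderiv_pCons pderiv_smult)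

context cspace
begin

lemma partial_eqI:
  assumes "\<And>t. F (x + s t v) = poly q t"
  shows "partial s v F x = poly (pderiv q) 0"
  unfolding partial_def assms by (rule DERIV_imp_deriv) (rule poly_DERIV)

lemma form_line:
  assumes "g \<in> forms s W k" "x \<in> W" "v \<in> W"
  obtains q where "\<And>t. g (x + s t v) = poly q t" "g x = poly q 0"
proof -
  obtain q where q: "\<forall>t. g (x + s t v) = poly q t"
    using forms_line_poly[OF assms(1)] assms(2,3) unfolding line_poly_def by meson
  moreover have "g x = poly q 0" using q[rule_format, of 0] by simp
  ultimately show thesis using that by blast
qed

lemma partial_outside:
  assumes "v \<in> W" "x \<notin> W" "\<And>y. y \<notin> W \<Longrightarrow> F y = 0"
  shows "partial s v F x = 0"
proof -
  have "F (x + s t v) = poly 0 t" for t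
    using assms mem_add_iff[of "s t v" x] mem_scale by simp
  then show ?thesis using partial_eqI[of F x v 0] by simp
qed

context
  fixes v assumes v: "v \<in> W"
begin

lemma partial_zero: "partial s v 0 = 0"
proof
  fix x
  have "(0 :: 'a \<Rightarrow> complex) (x + s t v) = poly 0 t" for t by (simp add: fun_simps)
  then show "partial s v 0 x = 0 x" using partial_eqI[of 0 x v 0] by (simp add: fun_simps)
qed

lemma partial_one: "partial s v (restr W (\<lambda>_. c)) = 0"
proof
  fix x
  show "partial s v (restr W (\<lambda>_. c)) x = 0 x"
  proof (cases "x \<in> W")
    case True
    then have "restr W (\<lambda>_. c) (x + s t v) = poly [:c:] t" for t
      using v by (simp add: fun_simps mem_add mem_scale)
    then show ?thesis using partial_eqI[of _ x v "[:c:]"] by (simp add: fun_simps)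
  next
    case False
    then show ?thesis using partial_outside[OF v, of x "restr W (\<lambda>_. c)"] by (simp add: fun_simps)
  qed
qed

lemma partial_dual:
  assumes "\<phi> \<in> dual s W"
  shows "partial s v \<phi> = restr W (\<lambda>_. \<phi> v)"
proof
  fix x
  show "partial s v \<phi> x = restr W (\<lambda>_. \<phi> v) x"
  proof (cases "x \<in> W")
    case True
    then have "\<phi> (x + s t v) = poly [:\<phi> x, \<phi> v:] t" for t
      using v assms by (simp add: dual_add dual_scale mem_scale)
    then show ?thesis
      using partial_eqI[of \<phi> x v "[:\<phi> x, \<phi> v:]"] True by (simp add: fun_simps pderiv_pCons)
  next
    case False
    then show ?thesis
      using partial_outside[OF v, of x \<phi>] dual_outside[OF assms] by (simp add: fun_simps)
  qed
qed

lemma partial_add: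
  assumes "g \<in> forms s W k" "h \<in> forms s W l"
  shows "partial s v (g + h) = partial s v g + partial s v h"
proof
  fix x
  show "partial s v (g + h) x = (partial s v g + partial s v h) x"
  proof (cases "x \<in> W")
    case True
    obtain q where q: "\<And>t. g (x + s t v) = poly q t" using form_line[OF assms(1) True v] by blast
    obtain r where r: "\<And>t. h (x + s t v) = poly r t" using form_line[OF assms(2) True v] by blast
    have "(g + h) (x + s t v) = poly (q + r) t" for t by (simp add: fun_simps q r)
    from partial_eqI[of "g + h" x v, OF this] partial_eqI[of g x v, OF q] partial_eqI[of h x v, OF r]
    show ?thesis by (simp add: fun_simps pderiv_add)
  next
    case False
    then show ?thesis
      using partial_outside[OF v False, of "g + h"] partial_outside[OF v False, of g]
        partial_outside[OF v False, of h] forms_outside[OF assms(1)] forms_outside[OF assms(2)]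
      by (simp add: fun_simps)
  qed
qed

lemma partial_scale:
  assumes "g \<in> forms s W k"
  shows "partial s v (fscale c g) = fscale c (partial s v g)"
proof
  fix x
  show "partial s v (fscale c g) x = fscale c (partial s v g) x"
  proof (cases "x \<in> W")
    case True
    obtain q where q: "\<And>t. g (x + s t v) = poly q t" using form_line[OF assms(1) True v] by blast
    have "fscale c g (x + s t v) = poly (smult c q) t" for t by (simp add: fun_simps q)
    from partial_eqI[of "fscale c g" x v, OF this] partial_eqI[of g x v, OF q]
    show ?thesis by (simp add: fun_simps pderiv_smult)
  next
    case False
    then show ?thesis
      using partial_outside[OF v, of x] forms_outside assms by (simp add: fun_simps)
  qed
qed

lemma partial_mult:
  assumes "g \<in> forms s W k" "h \<in> forms s W l"
  shows "partial s v (g * h) = partial s v g * h + g * partial s v h"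
proof
  fix x
  show "partial s v (g * h) x = (partial s v g * h + g * partial s v h) x"
  proof (cases "x \<in> W")
    case True
    obtain q where q: "\<And>t. g (x + s t v) = poly q t" "g x = poly q 0" using form_line[OF assms(1) True v] by blast
    obtain r where r: "\<And>t. h (x + s t v) = poly r t" "h x = poly r 0" using form_line[OF assms(2) True v] by blast
    have "(g * h) (x + s t v) = poly (q * r) t" for t by (simp add: fun_simps q r)
    from partial_eqI[of "g * h" x v, OF this] partial_eqI[of g x v, OF q(1)] partial_eqI[of h x v, OF r(1)]
    show ?thesis by (simp add: fun_simps pderiv_mult q(2) r(2))
  next
    case False
    then show ?thesis
      using partial_outside[OF v, of x] forms_outside assms by (simp add: fun_simps)
  qed
qed

lemma partial_diff:
  assumes "g \<in> forms s W k" "h \<in> forms s W l"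
  shows "partial s v (g - h) = partial s v g - partial s v h"
proof -
  have e: "g - h = g + fscale (- 1) h" by (rule ext) (simp add: fun_simps)
  show ?thesis
    unfolding e partial_add[OF assms(1) forms_scale[OF assms(2)]] partial_scale[OF assms(2)]
    by (rule ext) (simp add: fun_simps)
qed

lemma const_mult: "h \<in> forms s W k \<Longrightarrow> restr W (\<lambda>_. c) * h = fscale c h"
  by (rule ext) (simp add: fun_simps forms_outside)

lemma partial_mult_dual:
  assumes "\<phi> \<in> dual s W" "g \<in> forms s W k"
  shows "partial s v (\<phi> * g) = fscale (\<phi> v) g + \<phi> * partial s v g"
  using partial_mult[OF dual_forms[OF assms(1)] assms(2)] partial_dual[OF assms(1)] const_mult[OF assms(2)]
  by simp

lemma partial_forms_aux:
  assumes "g \<in> forms s W k"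
  shows "partial s v g \<in> forms s W (k - 1) \<and> (k = 0 \<longrightarrow> partial s v g = 0)"
  using assms
proof (induction rule: forms_induct)
  case (zero k)
  show ?case by (simp add: partial_zero forms_zero)
next
  case (add k g h)
  then show ?case by (simp add: partial_add[OF add(1,2)] forms_add)
next
  case (scale k c g)
  then show ?case by (simp add: partial_scale[OF scale(1)] forms_scale)
next
  case one
  show ?case by (simp add: partial_one forms_zero)
next
  case (mult k \<phi> g)
  have "\<phi> * partial s v g \<in> forms s W k"
  proof (cases k)
    case 0
    then show ?thesis using mult(3) by (simp add: forms_zero)
  next
    case (Suc k')
    then show ?thesis using mult(3) forms_mult_dual[OF mult(1), of "partial s v g" k'] by simp
  qed
  then show ?case
    unfolding partial_mult_dual[OF mult(1,2)] using forms_add forms_scale[OF mult(2)] by simp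
qed

lemma partial_forms: "g \<in> forms s W k \<Longrightarrow> partial s v g \<in> forms s W (k - 1)"
  using partial_forms_aux by blast

lemma partial_power:
  assumes "\<phi> \<in> dual s W"
  shows "partial s v (restr W (\<lambda>x. \<phi> x ^ Suc m)) = fscale (of_nat (Suc m) * \<phi> v) (restr W (\<lambda>x. \<phi> x ^ m))"
proof
  fix x
  show "partial s v (restr W (\<lambda>x. \<phi> x ^ Suc m)) x = fscale (of_nat (Suc m) * \<phi> v) (restr W (\<lambda>x. \<phi> x ^ m)) x"
  proof (cases "x \<in> W")
    case True
    then have "restr W (\<lambda>x. \<phi> x ^ Suc m) (x + s t v) = poly ([:\<phi> x, \<phi> v:] ^ Suc m) t" for t
      using v assms by (simp add: dual_add dual_scale mem_scale mem_add fun_simps algebra_simps)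
    from partial_eqI[of "restr W (\<lambda>x. \<phi> x ^ Suc m)" x v, OF this]
    show ?thesis
      using True by (simp only: pderiv_power_Suc) (simp add: fun_simps pderiv_pCons)
  next
    case False
    then show ?thesis
      using partial_outside[OF v, of x "restr W (\<lambda>x. \<phi> x ^ Suc m)"] by (simp add: fun_simps)
  qed
qed

end

lemma partial_add_dir:
  assumes "u \<in> W" "v \<in> W" "g \<in> forms s W k"
  shows "partial s (u + v) g = partial s u g + partial s v g"
  using assms(3)
proof (induction rule: forms_induct)
  case (mult k \<phi> g)
  have e: "fscale (\<phi> u + \<phi> v) g = fscale (\<phi> u) g + fscale (\<phi> v) g"
    by (rule ext) (simp add: fun_simps algebra_simps)
  show ?case
    using mult by (simp add: partial_mult_dual assms mem_add dual_add e algebra_simps)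
next
  case (add k g h)
  then show ?case by (simp add: partial_add[OF _ add(1,2)] assms mem_add)
next
  case (scale k c g)
  then show ?case by (simp add: partial_scale[OF _ scale(1)] assms mem_add FS.scale_right_distrib)
qed (simp_all add: partial_zero partial_one assms mem_add)

lemma partial_scale_dir:
  assumes "u \<in> W" "g \<in> forms s W k"
  shows "partial s (s c u) g = fscale c (partial s u g)"
  using assms(2)
proof (induction rule: forms_induct)
  case (mult k \<phi> g)
  have e: "\<phi> * fscale c h = fscale c (\<phi> * h)" for h
    by (rule ext) (simp add: fun_simps algebra_simps)
  show ?case
    using mult by (simp add: partial_mult_dual assms mem_scale dual_scale e FS.scale_right_distrib)
next
  case (add k g h)
  then show ?case by (simp add: partial_add[OF _ add(1,2)] assms mem_scale FS.scale_right_distrib)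
next
  case (scale k a g)
  have "fscale a (fscale c h) = fscale c (fscale a h)" for h by (rule ext) (simp add: fun_simps)
  then show ?case using scale by (simp add: partial_scale[OF _ scale(1)] assms mem_scale)
qed (simp_all add: partial_zero partial_one assms mem_scale)

lemma partial_commute:
  assumes "u \<in> W" "v \<in> W" "g \<in> forms s W k"
  shows "partial s u (partial s v g) = partial s v (partial s u g)"
  using assms(3)
proof (induction rule: forms_induct)
  case (mult k \<phi> g)
  have 1: "partial s a (partial s b (\<phi> * g)) =
      fscale (\<phi> b) (partial s a g) + (fscale (\<phi> a) (partial s b g) + \<phi> * partial s a (partial s b g))"
    if "a \<in> W" "b \<in> W" for a b
  proof -
    have pb: "partial s b g \<in> forms s W (k - 1)" using partial_forms[OF that(2) mult(2)] .
    show ?thesis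
      using partial_add[OF that(1) forms_scale[OF mult(2)] forms_mult_dual[OF mult(1) pb]]
      by (simp add: partial_mult_dual[OF that(2) mult(1,2)] partial_scale[OF that(1) mult(2)]
          partial_mult_dual[OF that(1) mult(1) pb])
  qed
  show ?case
    unfolding 1[OF assms(1,2)] 1[OF assms(2,1)] mult(3) by (simp add: algebra_simps)
next
  case (add k g h)
  note p = partial_forms[OF assms(1) add(1)] partial_forms[OF assms(1) add(2)]
    partial_forms[OF assms(2) add(1)] partial_forms[OF assms(2) add(2)]
  show ?case
    using add(3,4)
    by (simp add: partial_add[OF assms(1) add(1,2)] partial_add[OF assms(2) add(1,2)]
        partial_add[OF assms(1) p(3,4)] partial_add[OF assms(2) p(1,2)])
next
  case (scale k c g)
  note p = partial_forms[OF assms(1) scale(1)] partial_forms[OF assms(2) scale(1)]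
  show ?case
    using scale(2)
    by (simp add: partial_scale[OF assms(1) scale(1)] partial_scale[OF assms(2) scale(1)]
        partial_scale[OF assms(1) p(2)] partial_scale[OF assms(2) p(1)])
qed (simp_all add: partial_zero partial_one assms)

lemma euler:
  assumes "g \<in> forms s W k" "x \<in> W"
  shows "partial s x g x = of_nat k * g x"
  using assms(1)
proof (induction rule: forms_induct)
  case (mult k \<phi> g)
  show ?case
    by (simp only: partial_mult_dual[OF assms(2) mult(1,2)]) (simp add: fun_simps mult(3) algebra_simps)
next
  case (add k g h)
  show ?case
    by (simp only: partial_add[OF assms(2) add(1,2)]) (simp add: fun_simps add(3,4) algebra_simps)
next
  case (scale k c g)
  show ?case
    by (simp only: partial_scale[OF assms(2) scale(1)]) (simp add: fun_simps scale(2))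
next
  case (zero k)
  show ?case by (simp only: partial_zero[OF assms(2)]) (simp add: fun_simps)
next
  case one
  show ?case by (simp only: partial_one[OF assms(2)]) (simp add: fun_simps)
qed

lemma bip_partial_1:
  assumes p: "p1 \<in> W" "p0 \<in> W" and v: "v \<in> W" and g: "g \<in> forms s W k"
  shows "bip p1 p0 v (partial s p1 g) = pderiv (bip p1 p0 v g)"
proof (rule bip_eqI[OF v])
  fix x t
  let ?Q = "bip p1 p0 v g"
  let ?q = "pcompose (ev t ?Q) [:x, 1:]"
  have "g (s x p1 + p0 + s t v + s \<tau> p1) = poly ?q \<tau>" for \<tau>
  proof -
    have "s x p1 + p0 + s t v + s \<tau> p1 = s (x + \<tau>) p1 + p0 + s t v"
      by (simp only: S.scale_left_distrib ac_simps)
    then have "g (s x p1 + p0 + s t v + s \<tau> p1) = poly (ev t ?Q) (x + \<tau>)"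
      by (simp only: poly_ev_bip[OF p g v])
    then show ?thesis by (simp add: poly_pcompose)
  qed
  from partial_eqI[of g, OF this]
  show "poly (poly (pderiv ?Q) [:x:]) t = partial s p1 g (s x p1 + p0 + s t v)"
    by (simp add: pderiv_pcompose poly_pcompose pderiv_pCons flip: poly_ev ev_pderiv)
qed

lemma bip_partial_v:
  assumes p: "p1 \<in> W" "p0 \<in> W" and v: "v \<in> W" and g: "g \<in> forms s W k"
  shows "bip p1 p0 v (partial s v g) = dt (bip p1 p0 v g)"
proof (rule bip_eqI[OF v])
  fix x t
  let ?Q = "bip p1 p0 v g"
  let ?q = "pcompose (poly ?Q [:x:]) [:t, 1:]"
  have "g (s x p1 + p0 + s t v + s \<tau> v) = poly ?q \<tau>" for \<tau>
  proof -
    have "s x p1 + p0 + s t v + s \<tau> v = s x p1 + p0 + s (t + \<tau>) v"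
      by (simp only: S.scale_left_distrib ac_simps)
    then have "g (s x p1 + p0 + s t v + s \<tau> v) = poly (poly ?Q [:x:]) (t + \<tau>)"
      by (simp only: poly_bip[OF p g v])
    then show ?thesis by (simp add: poly_pcompose)
  qed
  from partial_eqI[of g, OF this]
  show "poly (poly (dt ?Q) [:x:]) t = partial s v g (s x p1 + p0 + s t v)"
    by (simp add: pderiv_pcompose poly_pcompose pderiv_pCons poly_dt)
qed

text \<open>Euler's relation gives the derivative in the direction \<open>p\<^sub>0\<close> on the affine chart.\<close>

lemma bip_partial_0:
  assumes p: "p1 \<in> W" "p0 \<in> W" and v: "v \<in> W" and g: "g \<in> forms s W k"
  shows "bip p1 p0 v (partial s p0 g) = smult (of_nat k) (bip p1 p0 v g)
     - [:0, 1:] * pderiv (bip p1 p0 v g) - smult [:0, 1:] (dt (bip p1 p0 v g))"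
proof (rule bip_eqI[OF v])
  fix x t
  let ?Q = "bip p1 p0 v g" and ?y = "s x p1 + p0 + s t v"
  have y: "?y \<in> W" using mem_plane p v by blast
  have m: "s x p1 \<in> W" "s t v \<in> W" "s x p1 + p0 \<in> W" using p v by (simp_all add: mem_scale mem_add)
  have "partial s ?y g = partial s (s x p1) g + partial s p0 g + partial s (s t v) g"
    by (simp add: partial_add_dir[OF m(3,2) g] partial_add_dir[OF m(1) p(2) g])
  then have "of_nat k * g ?y = x * partial s p1 g ?y + partial s p0 g ?y + t * partial s v g ?y"
    using euler[OF g y] by (simp add: partial_scale_dir[OF p(1) g] partial_scale_dir[OF v g] fun_simps)
  moreover have "partial s p1 g ?y = poly (poly (pderiv ?Q) [:x:]) t"
    using poly_bip[OF p partial_forms[OF p(1) g] v] bip_partial_1[OF p v g] by simp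
  moreover have "partial s v g ?y = poly (poly (dt ?Q) [:x:]) t"
    using poly_bip[OF p partial_forms[OF v g] v] bip_partial_v[OF p v g] by simp
  moreover have "g ?y = poly (poly ?Q [:x:]) t" using poly_bip[OF p g v] by simp
  ultimately show "poly (poly (smult (of_nat k) ?Q - [:0, 1:] * pderiv ?Q - smult [:0, 1:] (dt ?Q)) [:x:]) t
      = partial s p0 g ?y"
    by (simp add: of_nat_poly algebra_simps)
qed

lemma forms_domain:
  assumes "g \<in> forms s W k" "h \<in> forms s W l" "g * h = 0"
  shows "g = 0 \<or> h = 0"
proof (rule ccontr)
  assume "\<not> (g = 0 \<or> h = 0)"
  then obtain x y where xy: "g x \<noteq> 0" "h y \<noteq> 0" by (metis ext zero_fun_apply)
  then have "x \<in> W" "y \<in> W" using forms_outside assms by blast+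
  then obtain z where "g z \<noteq> 0" "h z \<noteq> 0"
    using line_poly_common_nonzero[OF forms_line_poly[OF assms(1)] forms_line_poly[OF assms(2)]] xy by blast
  then have "(g * h) z \<noteq> 0" by (simp add: fun_simps)
  then show False unfolding assms(3) by (simp add: fun_simps)
qed

end

section \<open>Divergence-free fields tangent to an irreducible plane curve\<close>

lemma fps_deriv_ps:
  "fps_deriv (poly (ps Q) \<alpha>) = poly (ps (pderiv Q)) \<alpha> * fps_deriv \<alpha> + poly (ps (dt Q)) \<alpha>"
proof (induction Q)
  case (pCons c Q)
  have e: "ps (pCons c Q) = pCons (fps_of_poly c) (ps Q)" for c Q
    by (rule poly_eqI) (simp add: coeff_ps coeff_pCons split: nat.splits)
  have a: "ps (P + Q) = ps P + ps Q" for P Q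
    by (rule poly_eqI) (simp add: coeff_ps fps_of_poly_add)
  show ?case
    by (simp add: e a pderiv_pCons dt_pCons pCons fps_of_poly_pderiv algebra_simps)
qed (simp add: dt_0)

text \<open>
  A polynomial of smaller degree cannot share a factor with the irreducible \<open>F\<close>.  If it is not \<open>0\<close>, a
  combination of both is a non-zero polynomial in \<open>t\<close> alone, which does not vanish on a power series.
\<close>

lemma root_of_irreducible:
  fixes F N :: "complex poly poly"
  assumes F0: "F \<noteq> 0" and irr: "\<And>G H. F = G * H \<Longrightarrow> 0 < degree G \<Longrightarrow> degree F \<le> degree G"
    and deg: "N = 0 \<or> degree N < degree F"
    and root: "poly (ps F) \<alpha> = 0" "poly (ps N) \<alpha> = 0"
  shows "N = 0"
proof (rule ccontr)
  assume N: "N \<noteq> 0"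
  have cop: "degree D = 0" if D: "D dvd F" "D dvd N" for D
  proof (rule ccontr)
    assume "degree D \<noteq> 0"
    then have "degree F \<le> degree D" using irr D(1) by (metis dvdE gr0I)
    moreover have "degree D \<le> degree N" using D(2) N by (rule dvd_imp_degree_le)
    ultimately show False using deg N by simp
  qed
  obtain U V \<rho> where \<rho>: "\<rho> \<noteq> 0" "U * F + V * N = [:\<rho>:]" by (rule coprime_bezout[OF F0 cop])
  have a: "ps (P + Q) = ps P + ps Q" for P Q
    by (rule poly_eqI) (simp add: coeff_ps fps_of_poly_add)
  have "poly (ps (U * F + V * N)) \<alpha> = 0" using root by (simp add: a ps_mult)
  moreover have "ps [:\<rho>:] = [:fps_of_poly \<rho>:]"
    by (rule poly_eqI) (simp add: coeff_ps coeff_pCons split: nat.splits)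
  ultimately show False using \<rho> by (simp add: fps_of_poly_0_iff)
qed

lemma fps_ratio_const:
  fixes u w :: "complex fps"
  assumes "w * fps_deriv u = u * fps_deriv w" "w $ 0 \<noteq> 0"
  shows "\<exists>c. u = fps_const c * w"
proof -
  have iw: "w * inverse w = 1" using assms(2) by (simp add: inverse_mult_eq_1')
  have "fps_deriv (u * inverse w) = inverse w * inverse w * (w * fps_deriv u - u * fps_deriv w)"
    using iw by (simp add: fps_inverse_deriv[OF assms(2)] power2_eq_square algebra_simps)
  then have "fps_deriv (u * inverse w) = 0" using assms(1) by simp
  then obtain c where "u * inverse w = fps_const c" by (metis fps_deriv_eq_0_iff)
  then have "u = fps_const c * w" using iw by (metis mult.assoc mult.commute mult.right_neutral)
  then show ?thesis by blast
qed

text \<open>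
  With \<open>(A, C, B)\<close> the field in the coordinates \<open>(x, z, t)\<close> at \<open>z = 1\<close>, the form
  \<open>\<eta> = (C t - B) dx + (A - x C) dt\<close> is such that \<open>\<eta> / F\<close> is closed; this is what \<open>star\<close> and \<open>closed\<close>
  say.  The residue of \<open>\<eta> / F\<close> at the root \<open>x = \<alpha> t\<close> of \<open>F\<close> is therefore a constant \<open>\<mu>\<close>, so that
  \<open>\<eta> - \<mu> dF\<close> vanishes along that root.  Since \<open>F\<close> is irreducible, \<open>\<eta> = \<mu> dF\<close>, and comparing degrees
  yields \<open>\<eta> = 0\<close>.
\<close>

lemma tangent_field_zero:
  fixes F A B C :: "complex poly poly"
  assumes d: "2 \<le> d"
    and tangent: "A * pderiv F + C * (smult (of_nat d) F - [:0, 1:] * pderiv F - smult [:0, 1:] (dt F)) + B * dt F = 0"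
    and div: "pderiv A + (smult (of_nat (d - 2)) C - [:0, 1:] * pderiv C - smult [:0, 1:] (dt C)) + dt B = 0"
    and deg: "degree A \<le> d - 2" "degree B \<le> d - 2" "degree C \<le> d - 2" "degree F = d"
    and lead: "coeff F d = [:l:]" "l \<noteq> 0"
    and irr: "\<And>G H. F = G * H \<Longrightarrow> 0 < degree G \<Longrightarrow> degree F \<le> degree G"
    and root: "poly (ps F) \<alpha> = 0" "poly (ps (pderiv F)) \<alpha> $ 0 \<noteq> 0"
  shows "A = 0 \<and> B = 0 \<and> C = 0"
proof -
  define X T :: "complex poly poly" where "X = [:0, 1:]" and "T = [:[:0, 1:]:]"
  have XT: "pderiv X = 1" "pderiv T = 0" "dt X = 0" "dt T = 1"
    by (simp_all add: X_def T_def pderiv_pCons dt_pCons dt_0 one_pCons)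
  have sT: "smult [:0, 1:] P = T * P" for P by (simp add: T_def)
  define k :: "complex poly poly" where "k = of_nat d"
  have kd: "pderiv k = 0" "dt k = 0"
    by (simp_all add: k_def of_nat_poly pderiv_pCons dt_pCons dt_0)
  have sn: "smult (of_nat n) P = of_nat n * P" for n and P :: "complex poly poly"
    by (simp add: of_nat_poly)
  have sk: "smult (of_nat d) P = k * P" for P :: "complex poly poly" unfolding sn k_def ..
  have k2: "smult (of_nat (d - 2)) P = k * P - 2 * P" for P :: "complex poly poly"
    unfolding sn k_def using d by (simp add: of_nat_diff left_diff_distrib)
  have k0: "k \<noteq> 0" using d by (simp add: k_def)
  define \<eta> \<theta> where "\<eta> = C * T - B" and "\<theta> = A - X * C"
  have star: "\<theta> * pderiv F - \<eta> * dt F = - k * C * F"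
    using tangent unfolding sT sk X_def[symmetric] \<eta>_def \<theta>_def by (simp add: algebra_simps)
  have closed: "pderiv \<theta> - dt \<eta> = - k * C"
  proof -
    have "pderiv \<theta> - dt \<eta> = pderiv A + dt B - X * pderiv C - T * dt C - 2 * C"
      by (simp add: \<theta>_def \<eta>_def pderiv_diff pderiv_mult dt_diff dt_mult XT algebra_simps)
    also have "\<dots> = - k * C"
      using div unfolding sT k2 X_def[symmetric] by (simp add: algebra_simps)
    finally show ?thesis .
  qed
  define e where "e P = poly (ps P) \<alpha>" for P
  have e_mult: "e (P * Q) = e P * e Q" for P Q by (simp add: e_def ps_mult)
  have e_add: "e (P + Q) = e P + e Q" for P Q
  proof -
    have "ps (P + Q) = ps P + ps Q" by (rule poly_eqI) (simp add: coeff_ps fps_of_poly_add)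
    then show ?thesis by (simp add: e_def)
  qed
  have e_0: "e 0 = 0" by (simp add: e_def)
  have e_minus: "e (- P) = - e P" for P using e_add[of P "- P"] e_0 by (simp add: eq_neg_iff_add_eq_0 add.commute)
  have e_diff: "e (P - Q) = e P - e Q" for P Q using e_add[of P "- Q"] e_minus by simp
  have e_deriv: "fps_deriv (e P) = e (pderiv P) * fps_deriv \<alpha> + e (dt P)" for P
    unfolding e_def by (rule fps_deriv_ps)
  have eF: "e F = 0" using root by (simp add: e_def)
  define a where "a = fps_deriv \<alpha>"
  have Ft: "e (dt F) = - e (pderiv F) * a"
    using e_deriv[of F] eF by (simp add: a_def eq_neg_iff_add_eq_0 add.commute)
  have w0: "e (pderiv F) $ 0 \<noteq> 0" using root by (simp add: e_def)
  then have wnz: "e (pderiv F) \<noteq> 0" by auto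
  have "e (\<theta> * pderiv F - \<eta> * dt F) = e (- k * C * F)" unfolding star ..
  then have "e \<theta> * e (pderiv F) - e \<eta> * e (dt F) = 0"
    by (simp add: e_diff e_mult e_minus eF)
  then have "(e \<theta> + e \<eta> * a) * e (pderiv F) = 0" unfolding Ft by (simp add: algebra_simps)
  then have \<theta>: "e \<theta> = - e \<eta> * a" using wnz by (simp add: eq_neg_iff_add_eq_0)
  \<comment> \<open>The \<open>x\<close>-derivative of \<open>star\<close>, restricted to the root, says that the residue has derivative \<open>0\<close>.\<close>
  have "pderiv (\<theta> * pderiv F - \<eta> * dt F) = pderiv (- k * C * F)" unfolding star ..
  then have "pderiv \<theta> * pderiv F + \<theta> * pderiv (pderiv F) - pderiv \<eta> * dt F - \<eta> * pderiv (dt F)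
      = - k * pderiv C * F - k * C * pderiv F"
    by (simp add: pderiv_diff pderiv_mult pderiv_minus kd algebra_simps)
  then have "pderiv \<theta> * pderiv F + \<theta> * pderiv (pderiv F) - pderiv \<eta> * dt F - \<eta> * pderiv (dt F)
      = - k * pderiv C * F + (pderiv \<theta> - dt \<eta>) * pderiv F"
    unfolding closed by (simp add: algebra_simps)
  then have "dt \<eta> * pderiv F + \<theta> * pderiv (pderiv F) - pderiv \<eta> * dt F - \<eta> * pderiv (dt F) + k * pderiv C * F = 0"
    by (simp add: algebra_simps)
  then have "e (dt \<eta> * pderiv F + \<theta> * pderiv (pderiv F) - pderiv \<eta> * dt F - \<eta> * pderiv (dt F) + k * pderiv C * F) = 0"
    by (simp add: e_0)
  then have "e (dt \<eta>) * e (pderiv F) + e \<theta> * e (pderiv (pderiv F)) - e (pderiv \<eta>) * e (dt F) - e \<eta> * e (pderiv (dt F)) = 0"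
    by (simp add: e_add e_diff e_mult eF)
  then have "e (pderiv F) * fps_deriv (e \<eta>) = e \<eta> * fps_deriv (e (pderiv F))"
    unfolding e_deriv \<theta> Ft a_def[symmetric] dt_pderiv by (simp add: algebra_simps)
  then obtain \<mu> where \<mu>: "e \<eta> = fps_const \<mu> * e (pderiv F)"
    using fps_ratio_const w0 by blast
  define L :: "complex poly poly" where "L = [:[:\<mu>:]:]"
  have eL: "e L = fps_const \<mu>"
  proof -
    have "ps L = [:fps_const \<mu>:]"
      by (rule poly_eqI) (simp add: L_def coeff_ps coeff_pCons fps_of_poly_const split: nat.splits)
    then show ?thesis by (simp add: e_def)
  qed
  have F0: "F \<noteq> 0" using lead by auto
  have dF: "degree (pderiv F) = d - 1" using deg(4) by (simp add: degree_pderiv)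
  have dtF: "degree (dt F) \<le> d - 1"
  proof (rule degree_le, intro allI impI)
    fix i assume i: "d - 1 < i"
    show "coeff (dt F) i = 0"
    proof (cases "i = d")
      case True
      then show ?thesis using lead by (simp add: coeff_dt pderiv_pCons)
    next
      case False
      then show ?thesis using i deg(4) by (simp add: coeff_dt coeff_eq_0)
    qed
  qed
  have dL: "degree (L * P) \<le> degree P" for P by (simp add: L_def)
  have dX: "degree (X * C) \<le> d - 1"
  proof -
    have "degree (X * C) \<le> 1 + degree C" using degree_mult_le[of X C] by (simp add: X_def)
    then show ?thesis using deg(3) d by linarith
  qed
  have dT: "degree (C * T) \<le> degree C" using degree_mult_le[of C T] by (simp add: T_def)
  have N1: "\<eta> - L * pderiv F = 0"
  proof (rule root_of_irreducible[OF F0 irr])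
    have "degree (\<eta> - L * pderiv F) \<le> d - 1"
      unfolding \<eta>_def using deg dT dL[of "pderiv F"] dF by (intro degree_diff_le) linarith+
    then show "\<eta> - L * pderiv F = 0 \<or> degree (\<eta> - L * pderiv F) < degree F" using deg(4) d by linarith
    have "e (\<eta> - L * pderiv F) = 0" by (simp add: e_diff e_mult eL \<mu>)
    then show "poly (ps (\<eta> - L * pderiv F)) \<alpha> = 0" unfolding e_def .
  qed (use root in auto)
  have N2: "\<theta> - L * dt F = 0"
  proof (rule root_of_irreducible[OF F0 irr])
    have "degree (\<theta> - L * dt F) \<le> d - 1"
      unfolding \<theta>_def using deg dX dL[of "dt F"] dtF by (intro degree_diff_le) linarith+
    then show "\<theta> - L * dt F = 0 \<or> degree (\<theta> - L * dt F) < degree F" using deg(4) d by linarith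
    have "e (\<theta> - L * dt F) = 0" by (simp add: e_diff e_mult eL \<theta> \<mu> Ft)
    then show "poly (ps (\<theta> - L * dt F)) \<alpha> = 0" unfolding e_def .
  qed (use root in auto)
  have \<eta>L: "\<eta> = L * pderiv F" and \<theta>L: "\<theta> = L * dt F" using N1 N2 by simp_all
  have "k * C * F = 0" using star unfolding \<eta>L \<theta>L by (simp add: algebra_simps)
  then have C0: "C = 0" using k0 F0 by simp
  then have B: "- B = L * pderiv F" using \<eta>L by (simp add: \<eta>_def)
  have "coeff (- B) (d - 1) = 0" using deg(2) d by (simp add: coeff_eq_0)
  moreover have "coeff (L * pderiv F) (d - 1) = [:\<mu>:] * (of_nat d * [:l:])"
    using d lead by (simp add: L_def coeff_pderiv)
  ultimately have "[:\<mu>:] * (of_nat d * [:l:]) = 0" using B by simp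
  then have "\<mu> = 0" using lead d by (simp add: of_nat_poly)
  then have "L = 0" by (simp add: L_def)
  then show ?thesis using B C0 \<theta>L by (simp add: \<theta>_def)
qed

section \<open>Forms in three variables\<close>

text \<open>A three-dimensional space with basis \<open>p\<^sub>1\<close>, \<open>p\<^sub>0\<close>, \<open>b\<close> and dual basis \<open>X\<close>, \<open>Z\<close>, \<open>T\<close>; the chart of \<open>bip\<close> is \<open>Z = 1\<close>.\<close>

locale cspace3 = cspace s W for s :: "complex \<Rightarrow> 'a::ab_group_add \<Rightarrow> 'a" and W :: "'a set" +
  fixes p1 p0 b :: 'a and X Z T :: "'a \<Rightarrow> complex"
  assumes p: "p1 \<in> W" "p0 \<in> W" and b: "b \<in> W"
    and XZT: "X \<in> dual s W" "Z \<in> dual s W" "T \<in> dual s W"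
    and X: "X p1 = 1" "X p0 = 0" "X b = 0"
    and Z: "Z p1 = 0" "Z p0 = 1" "Z b = 0"
    and T: "T p1 = 0" "T p0 = 0" "T b = 1"
    and coords: "v \<in> W \<Longrightarrow> v = s (X v) p1 + s (Z v) p0 + s (T v) b"
begin

text \<open>By homogeneity the forms agree where \<open>Z \<noteq> 0\<close>, and then also on \<open>Z = 0\<close>, along lines in direction \<open>p\<^sub>0\<close>.\<close>

lemma form_eqI:
  assumes f: "f \<in> forms s W d" and h: "h \<in> forms s W d" and eq: "bip p1 p0 b f = bip p1 p0 b h"
  shows "f = h"
proof (rule ext)
  have chart: "f v = h v" if v: "v \<in> W" "Z v \<noteq> 0" for v
  proof -
    define y where "y = s (X v / Z v) p1 + p0 + s (T v / Z v) b"
    have "s (Z v) y = s (X v) p1 + s (Z v) p0 + s (T v) b"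
      using v(2) by (simp add: y_def S.scale_right_distrib)
    then have vy: "v = s (Z v) y" using coords[OF v(1)] by simp
    have y: "y \<in> W" unfolding y_def by (rule mem_plane[OF p b])
    have "f y = h y"
      using poly_bip[OF p f b, of "X v / Z v" "T v / Z v"] poly_bip[OF p h b, of "X v / Z v" "T v / Z v"] eq
      by (simp add: y_def)
    then show ?thesis
      using forms_homogeneous[OF f y, of "Z v"] forms_homogeneous[OF h y, of "Z v"] vy by simp
  qed
  fix v
  show "f v = h v"
  proof (cases "v \<in> W")
    case True
    obtain q where q: "\<And>t. f (v + s t p0) = poly q t" "f v = poly q 0" using form_line[OF f True p(2)] by blast
    obtain r where r: "\<And>t. h (v + s t p0) = poly r t" "h v = poly r 0" using form_line[OF h True p(2)] by blast
    have "poly ((q - r) * [:Z v, 1:]) t = 0" for t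
    proof (cases "Z v + t = 0")
      case False
      have "v + s t p0 \<in> W" using True p by (simp add: mem_add mem_scale)
      moreover have "Z (v + s t p0) \<noteq> 0"
        using False True p XZT Z by (simp add: dual_add dual_scale mem_scale)
      ultimately show ?thesis using chart q(1) r(1) by (metis eq_iff_diff_eq_0 mult_zero_left poly_diff poly_mult)
    next
      case True
      then have "poly [:Z v, 1:] t = 0" by simp
      then show ?thesis by (simp only: poly_mult mult_zero_right)
    qed
    then have "(q - r) * [:Z v, 1:] = 0" using poly_all_0_iff_0 by blast
    then have "q = r" by (metis eq_iff_diff_eq_0 mult_eq_0_iff one_neq_zero pCons_eq_0_iff)
    then show ?thesis using q(2) r(2) by simp
  qed (use forms_outside f h in metis)
qed

lemma bip_coords:
  "bip p1 p0 b X = [:0, 1:]" "bip p1 p0 b Z = 1" "bip p1 p0 b T = [:[:0, 1:]:]"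
  using bip_dual[OF p XZT(1) b] bip_dual[OF p XZT(2) b] bip_dual[OF p XZT(3) b]
  by (simp_all add: lin_bip_def X Z T one_pCons)

lemma bip_power:
  assumes "\<phi> \<in> dual s W"
  shows "bip p1 p0 b (restr W (\<lambda>x. \<phi> x ^ m)) = bip p1 p0 b \<phi> ^ m"
proof (induction m)
  case 0
  then show ?case using bip_one[OF p b] by simp
next
  case (Suc m)
  have "restr W (\<lambda>x. \<phi> x ^ Suc m) = \<phi> * restr W (\<lambda>x. \<phi> x ^ m)"
    by (rule ext) (simp add: fun_simps)
  then show ?case
    using bip_mult[OF p dual_forms[OF assms] forms_power[OF dual_forms[OF assms], of m]] Suc by simp
qed

definition mono :: "nat \<Rightarrow> nat \<Rightarrow> nat \<Rightarrow> 'a \<Rightarrow> complex" where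
  "mono i j k = restr W (\<lambda>v. X v ^ i * T v ^ j * Z v ^ k)"

lemma mono_eq: "mono i j k = restr W (\<lambda>x. X x ^ i) * restr W (\<lambda>x. T x ^ j) * restr W (\<lambda>x. Z x ^ k)"
  unfolding mono_def by (rule ext) (simp add: fun_simps)

lemma mono_forms: "mono i j k \<in> forms s W (i + j + k)"
proof -
  have "restr W (\<lambda>x. \<phi> x ^ m) \<in> forms s W m" if "\<phi> \<in> dual s W" for \<phi> m
    using forms_power[OF dual_forms[OF that], of m] by simp
  then show ?thesis unfolding mono_eq using XZT by (intro forms_mult) auto
qed

lemma bip_mono: "bip p1 p0 b (mono i j k) = monom (monom 1 j) i"
proof -
  have f: "restr W (\<lambda>x. \<phi> x ^ m) \<in> forms s W m" if "\<phi> \<in> dual s W" for \<phi> m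
    using forms_power[OF dual_forms[OF that], of m] by simp
  have m: "[:0, 1:] ^ i = monom (1 :: 'c::comm_semiring_1) i" for i
    by (induction i) (simp_all add: monom_0 monom_Suc one_pCons)
  have c: "[:q:] ^ j = [:q ^ j:]" for q :: "complex poly"
    by (induction j) (simp_all add: one_pCons)
  have "bip p1 p0 b (mono i j k) = [:0, 1:] ^ i * [:[:0, 1:]:] ^ j * 1 ^ k"
  proof -
    note fs = f[OF XZT(1), of i] f[OF XZT(3), of j] f[OF XZT(2), of k]
    show ?thesis
      unfolding mono_eq bip_mult[OF p forms_mult[OF fs(1,2)] fs(3)] bip_mult[OF p fs(1,2)]
        bip_power[OF XZT(1)] bip_power[OF XZT(2)] bip_power[OF XZT(3)] bip_coords ..
  qed
  also have "\<dots> = monom (monom 1 j) i"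
    unfolding m c by (simp add: smult_monom)
  finally show ?thesis .
qed

text \<open>Every polynomial of total degree at most \<open>k\<close> is the restriction of a form of degree \<open>k\<close> to the chart.\<close>

definition homogenize :: "nat \<Rightarrow> complex poly poly \<Rightarrow> 'a \<Rightarrow> complex" where
  "homogenize k G = (\<Sum>i\<le>k. \<Sum>j\<le>k - i. fscale (coeff (coeff G i) j) (mono i j (k - i - j)))"

lemma homogenize_forms: "homogenize k G \<in> forms s W k"
  unfolding homogenize_def
proof (intro forms_sum)
  fix i j assume "i \<in> {..k}" "j \<in> {..k - i}"
  then show "fscale (coeff (coeff G i) j) (mono i j (k - i - j)) \<in> forms s W k"
    using forms_scale[OF mono_forms[of i j "k - i - j"]] by simp
qed

lemma bip_sum:
  assumes "finite I" "\<And>i. i \<in> I \<Longrightarrow> g i \<in> forms s W k"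
  shows "bip p1 p0 b (\<Sum>i\<in>I. g i) = (\<Sum>i\<in>I. bip p1 p0 b (g i))"
  using assms
proof (induction I rule: finite_induct)
  case empty
  then show ?case by (simp add: bip_0[OF p])
next
  case (insert i I)
  have "(\<Sum>i\<in>I. g i) \<in> forms s W k" using insert.prems by (intro forms_sum) auto
  then have "bip p1 p0 b (g i + (\<Sum>i\<in>I. g i)) = bip p1 p0 b (g i) + bip p1 p0 b (\<Sum>i\<in>I. g i)"
    using insert.prems by (intro bip_add[OF p]) auto
  then show ?case using insert by simp
qed

lemma bip_homogenize:
  assumes "total_degree_le k G"
  shows "bip p1 p0 b (homogenize k G) = G"
proof -
  have mf: "fscale (coeff (coeff G i) j) (mono i j (k - i - j)) \<in> forms s W k" if "i \<le> k" "j \<le> k - i" for i j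
    using forms_scale[OF mono_forms[of i j "k - i - j"]] that by simp
  have 1: "bip p1 p0 b (\<Sum>j\<le>k - i. fscale (coeff (coeff G i) j) (mono i j (k - i - j))) = monom (coeff G i) i"
    if i: "i \<le> k" for i
  proof -
    have "bip p1 p0 b (\<Sum>j\<le>k - i. fscale (coeff (coeff G i) j) (mono i j (k - i - j)))
       = (\<Sum>j\<le>k - i. bip p1 p0 b (fscale (coeff (coeff G i) j) (mono i j (k - i - j))))"
      using mf[OF i] by (intro bip_sum) auto
    also have "\<dots> = (\<Sum>j\<le>k - i. monom (monom (coeff (coeff G i) j) j) i)"
    proof (rule sum.cong[OF refl])
      fix j
      have "smult [:c:] (monom (monom 1 j) i) = monom (monom c j) i" for c :: complex
        by (simp add: smult_monom)
      then show "bip p1 p0 b (fscale (coeff (coeff G i) j) (mono i j (k - i - j))) = monom (monom (coeff (coeff G i) j) j) i"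
        using bip_scale[OF p mono_forms] by (simp add: bip_mono)
    qed
    also have "\<dots> = monom (\<Sum>j\<le>k - i. monom (coeff (coeff G i) j) j) i"
      by (simp add: monom_sum)
    also have "(\<Sum>j\<le>k - i. monom (coeff (coeff G i) j) j) = coeff G i"
    proof (rule poly_as_sum_of_monoms')
      show "degree (coeff G i) \<le> k - i"
        using assms total_degree_le_coeff[OF assms, of i] by (cases "coeff G i = 0") auto
    qed
    finally show ?thesis .
  qed
  have "bip p1 p0 b (homogenize k G) = (\<Sum>i\<le>k. monom (coeff G i) i)"
  proof -
    have "bip p1 p0 b (homogenize k G)
        = (\<Sum>i\<le>k. bip p1 p0 b (\<Sum>j\<le>k - i. fscale (coeff (coeff G i) j) (mono i j (k - i - j))))"
      unfolding homogenize_def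
      by (rule bip_sum[of _ _ k]) (auto intro!: forms_sum mf simp del: diff_diff_left)
    also have "\<dots> = (\<Sum>i\<le>k. monom (coeff G i) i)"
      by (rule sum.cong[OF refl]) (rule 1, simp)
    finally show ?thesis .
  qed
  also have "\<dots> = G" using total_degree_le_degree[OF assms] by (rule poly_as_sum_of_monoms')
  finally show ?thesis .
qed

text \<open>A factorization of the restriction to the chart can be homogenized.\<close>

lemma irreducible_bip:
  assumes f: "f \<in> forms s W d" and fp1: "f p1 \<noteq> 0" and irred: "\<not> reducible s W d f"
    and GH: "bip p1 p0 b f = G * H" "0 < degree G"
  shows "d \<le> degree G"
proof (rule ccontr)
  assume less: "\<not> d \<le> degree G"
  have nz: "G * H \<noteq> 0" using coeff_bip_top[OF p f b] fp1 GH(1) by auto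
  have deg: "degree (G * H) = d" using degree_bip[OF p f b fp1] GH by simp
  have td: "total_degree_le d (G * H)" using total_degree_bip[OF p f, of b] GH by simp
  have dH: "degree H = d - degree G" using deg nz degree_mult_eq[of G H] by simp
  have tG: "total_degree_le (degree G) G" by (rule total_degree_factor[OF td deg nz])
  have tH: "total_degree_le (degree H) H"
    using total_degree_factor[of d H G] td deg nz by (simp add: mult.commute)
  let ?g = "homogenize (degree G) G" and ?h = "homogenize (degree H) H"
  have gh: "?g * ?h \<in> forms s W d"
    using forms_mult[OF homogenize_forms homogenize_forms, of "degree G" G "degree H" H] dH less by simp
  have "f = ?g * ?h"
    by (rule form_eqI[OF f gh])
      (simp add: GH bip_mult[OF p homogenize_forms homogenize_forms] bip_homogenize[OF tG] bip_homogenize[OF tH])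
  then have "reducible s W d f"
    unfolding reducible_def using GH(2) less dH homogenize_forms
    by (intro exI[of _ "degree G"] exI[of _ ?g] exI[of _ ?h]) auto
  then show False using irred by blast
qed

text \<open>Divergence-free fields of degree \<open>d - 2\<close> tangent to an irreducible curve of degree \<open>d\<close> vanish.\<close>

lemma tangent_fields_irreducible:
  assumes f: "f \<in> forms s W d" and d: "2 \<le> d" and fp1: "f p1 \<noteq> 0"
    and sep: "card {x. f (s x p1 + p0) = 0} = d" and irred: "\<not> reducible s W d f"
    and g: "gx \<in> forms s W (d - 2)" "gz \<in> forms s W (d - 2)" "gt \<in> forms s W (d - 2)"
    and div: "partial s p1 gx + partial s p0 gz + partial s b gt = 0"
    and tangent: "gx * partial s p1 f + gz * partial s p0 f + gt * partial s b f = 0"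
  shows "gx = 0 \<and> gz = 0 \<and> gt = 0"
proof -
  let ?B = "bip p1 p0 b"
  let ?F = "?B f"
  note pf = partial_forms[OF p(1) f] partial_forms[OF p(2) f] partial_forms[OF b f]
  note pg = partial_forms[OF p(1) g(1)] partial_forms[OF p(2) g(2)] partial_forms[OF b g(3)]
  have F0: "?F \<noteq> 0" using coeff_bip_top[OF p f b] fp1 by auto
  have simple: "\<exists>a. poly (ev 0 ?F) a = 0 \<and> poly (pderiv (ev 0 ?F)) a \<noteq> 0"
  proof -
    let ?U = "ev 0 ?F"
    have cU: "coeff ?U d = f p1" using coeff_bip_top[OF p f b] by (simp add: coeff_ev)
    have dU: "degree ?U = d"
    proof (rule antisym)
      show "degree ?U \<le> d"
        using degree_bip[OF p f b fp1] by (intro degree_le) (simp add: coeff_ev coeff_eq_0)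
      show "d \<le> degree ?U" using cU fp1 by (intro le_degree) simp
    qed
    have "{x. poly ?U x = 0} = {x. f (s x p1 + p0) = 0}"
      using poly_ev_bip[OF p f b, of 0] by simp
    then have c: "card {x. poly ?U x = 0} = d" using sep by simp
    have U0: "?U \<noteq> 0" using cU fp1 by auto
    have "card {x. poly ?U x = 0} \<noteq> 0" using c d by linarith
    then have "{x. poly ?U x = 0} \<noteq> {}" by (rule contrapos_nn) (simp only: card.empty)
    then obtain a where a: "poly ?U a = 0" by blast
    have "poly (pderiv ?U) a \<noteq> 0" by (rule distinct_roots_simple[OF U0 _ a]) (simp only: c dU)
    with a show ?thesis by blast
  qed
  then obtain a where a: "poly (ev 0 ?F) a = 0" "poly (pderiv (ev 0 ?F)) a \<noteq> 0" by blast
  have "\<exists>\<alpha>. \<alpha> $ 0 = a \<and> poly (ps ?F) \<alpha> = 0"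
    by (rule hensel) (use a in \<open>simp_all add: poly_ps_nth_0 ev_pderiv flip: ps_pderiv\<close>)
  then obtain \<beta> where \<beta>: "\<beta> $ 0 = a" "poly (ps ?F) \<beta> = 0" by blast
  have "?B (partial s p1 gx + partial s p0 gz + partial s b gt) = 0"
    unfolding div by (rule bip_0[OF p])
  then have div': "pderiv (?B gx) + (smult (of_nat (d - 2)) (?B gz) - [:0, 1:] * pderiv (?B gz)
      - smult [:0, 1:] (dt (?B gz))) + dt (?B gt) = 0"
    by (simp only: bip_add[OF p forms_add[OF pg(1,2)] pg(3)] bip_add[OF p pg(1,2)]
        bip_partial_1[OF p b g(1)] bip_partial_0[OF p b g(2)] bip_partial_v[OF p b g(3)])
  have "?B (gx * partial s p1 f + gz * partial s p0 f + gt * partial s b f) = 0"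
    unfolding tangent by (rule bip_0[OF p])
  then have tangent': "?B gx * pderiv ?F + ?B gz * (smult (of_nat d) ?F - [:0, 1:] * pderiv ?F
      - smult [:0, 1:] (dt ?F)) + ?B gt * dt ?F = 0"
    by (simp only: bip_add[OF p forms_add[OF forms_mult[OF g(1) pf(1)] forms_mult[OF g(2) pf(2)]] forms_mult[OF g(3) pf(3)]]
        bip_add[OF p forms_mult[OF g(1) pf(1)] forms_mult[OF g(2) pf(2)]]
        bip_mult[OF p g(1) pf(1)] bip_mult[OF p g(2) pf(2)] bip_mult[OF p g(3) pf(3)]
        bip_partial_1[OF p b f] bip_partial_0[OF p b f] bip_partial_v[OF p b f])
  have dg: "degree (?B h) \<le> d - 2" if "h \<in> forms s W (d - 2)" for h
    by (rule total_degree_le_degree[OF total_degree_bip[OF p that]])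
  have "?B gx = 0 \<and> ?B gt = 0 \<and> ?B gz = 0"
  proof (rule tangent_field_zero[OF d tangent' div' dg[OF g(1)] dg[OF g(3)] dg[OF g(2)]])
    show "degree ?F = d" by (rule degree_bip[OF p f b fp1])
    show "coeff ?F d = [:f p1:]" by (rule coeff_bip_top[OF p f b])
    show "degree ?F \<le> degree G" if "?F = G * H" "0 < degree G" for G H
      using irreducible_bip[OF f fp1 irred that] degree_bip[OF p f b fp1] by simp
    show "poly (ps (pderiv ?F)) \<beta> $ 0 \<noteq> 0"
      using a \<beta> by (simp add: poly_ps_nth_0 ev_pderiv)
  qed (use fp1 \<beta> in auto)
  then show ?thesis
    using form_eqI[OF g(1) forms_zero] form_eqI[OF g(2) forms_zero] form_eqI[OF g(3) forms_zero] bip_0[OF p]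
    by simp
qed

text \<open>
  The Hamiltonian field \<open>\<nabla>G \<times> \<nabla>Q\<close>: it is divergence-free and annihilates \<open>G\<close> and \<open>Q\<close>, hence also
  their product.
\<close>

definition cross :: "('a \<Rightarrow> complex) \<Rightarrow> ('a \<Rightarrow> complex) \<Rightarrow> ('a \<Rightarrow> complex) \<times> ('a \<Rightarrow> complex) \<times> ('a \<Rightarrow> complex)" where
  "cross G Q = (partial s p0 G * partial s b Q - partial s b G * partial s p0 Q,
                partial s b G * partial s p1 Q - partial s p1 G * partial s b Q,
                partial s p1 G * partial s p0 Q - partial s p0 G * partial s p1 Q)"

lemma partial_mult_diff:
  assumes v: "v \<in> W" and "g1 \<in> forms s W k" "h1 \<in> forms s W l" "g2 \<in> forms s W k" "h2 \<in> forms s W l"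
  shows "partial s v (g1 * h1 - g2 * h2) = partial s v g1 * h1 + g1 * partial s v h1 - (partial s v g2 * h2 + g2 * partial s v h2)"
  unfolding partial_diff[OF v forms_mult[OF assms(2,3)] forms_mult[OF assms(4,5)]]
    partial_mult[OF v assms(2,3)] partial_mult[OF v assms(4,5)] ..

lemma cross_divergence_free:
  assumes G: "G \<in> forms s W k" and Q: "Q \<in> forms s W l" and c: "cross G Q = (cx, cz, ct)"
  shows "partial s p1 cx + partial s p0 cz + partial s b ct = 0"
proof -
  note PG = partial_forms[OF p(1) G] partial_forms[OF p(2) G] partial_forms[OF b G]
  note PQ = partial_forms[OF p(1) Q] partial_forms[OF p(2) Q] partial_forms[OF b Q]
  have c': "cx = partial s p0 G * partial s b Q - partial s b G * partial s p0 Q"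
    "cz = partial s b G * partial s p1 Q - partial s p1 G * partial s b Q"
    "ct = partial s p1 G * partial s p0 Q - partial s p0 G * partial s p1 Q"
    using c by (simp_all add: cross_def)
  have comm: "partial s p0 (partial s p1 h) = partial s p1 (partial s p0 h)"
    "partial s b (partial s p1 h) = partial s p1 (partial s b h)"
    "partial s b (partial s p0 h) = partial s p0 (partial s b h)" if "h \<in> forms s W m" for h m
    using partial_commute p b that by blast+
  show ?thesis
    unfolding c' partial_mult_diff[OF p(1) PG(2) PQ(3) PG(3) PQ(2)]
      partial_mult_diff[OF p(2) PG(3) PQ(1) PG(1) PQ(3)] partial_mult_diff[OF b PG(1) PQ(2) PG(2) PQ(1)]
      comm[OF G] comm[OF Q]
    by (simp add: algebra_simps)
qed

lemma cross_forms:
  assumes G: "G \<in> forms s W k" and Q: "Q \<in> forms s W l" and "1 \<le> k" "1 \<le> l"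
    and c: "cross G Q = (cx, cz, ct)"
  shows "cx \<in> forms s W (k + l - 2)" "cz \<in> forms s W (k + l - 2)" "ct \<in> forms s W (k + l - 2)"
proof -
  have e: "k + l - 2 = (k - 1) + (l - 1)" using assms(3,4) by simp
  have "partial s u G * partial s v Q - partial s u' G * partial s v' Q \<in> forms s W (k + l - 2)"
    if "u \<in> W" "v \<in> W" "u' \<in> W" "v' \<in> W" for u v u' v'
    unfolding e using that by (intro forms_diff forms_mult partial_forms G Q)
  then show "cx \<in> forms s W (k + l - 2)" "cz \<in> forms s W (k + l - 2)" "ct \<in> forms s W (k + l - 2)"
    using c p b by (auto simp: cross_def)
qed

lemma gradient_zero:
  assumes G: "G \<in> forms s W k" "1 \<le> k" and z: "partial s p1 G = 0" "partial s p0 G = 0" "partial s b G = 0"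
  shows "G = 0"
proof (rule ext)
  fix v
  show "G v = 0 v"
  proof (cases "v \<in> W")
    case True
    note m = mem_scale[OF p(1)] mem_scale[OF p(2)] mem_scale[OF b]
    have "partial s v G = partial s (s (X v) p1) G + partial s (s (Z v) p0) G + partial s (s (T v) b) G"
      by (subst coords[OF True]) (simp add: partial_add_dir[OF mem_add[OF m(1,2)] m(3) G(1)] partial_add_dir[OF m(1,2) G(1)])
    also have "\<dots> = 0"
      by (simp add: partial_scale_dir[OF p(1) G(1)] partial_scale_dir[OF p(2) G(1)] partial_scale_dir[OF b G(1)] z)
    finally have "of_nat k * G v = 0" using euler[OF G(1) True] by (simp add: fun_simps)
    then show ?thesis using G(2) by (simp add: fun_simps)
  next
    case False
    then show ?thesis using forms_outside[OF G(1)] by (simp add: fun_simps)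
  qed
qed

text \<open>
  If \<open>f = G H\<close>, then \<open>\<nabla>G \<times> \<nabla>H\<close> is tangent to \<open>f = 0\<close>.  Should it vanish, then \<open>\<nabla>H\<close> is parallel to
  \<open>\<nabla>G\<close>, and \<open>\<nabla>G \<times> \<nabla>Q\<close> is tangent for every \<open>Q\<close>; a power of a coordinate serves as \<open>Q\<close>.
\<close>

lemma tangent_field_reducible:
  assumes red: "reducible s W d f" and d: "3 \<le> d"
  shows "\<exists>gx gz gt. gx \<in> forms s W (d - 2) \<and> gz \<in> forms s W (d - 2) \<and> gt \<in> forms s W (d - 2) \<and>
     partial s p1 gx + partial s p0 gz + partial s b gt = 0 \<and>
     gx * partial s p1 f + gz * partial s p0 f + gt * partial s b f = 0 \<and> (gx, gz, gt) \<noteq> (0, 0, 0)"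
proof -
  obtain k G H where k: "1 \<le> k" "k \<le> d - 1" and G: "G \<in> forms s W k" and H: "H \<in> forms s W (d - k)"
    and f: "f = G * H" using red unfolding reducible_def by blast
  define l where "l = d - k"
  have l: "1 \<le> l" "k + l - 2 = d - 2" "k + l = d" using k d by (simp_all add: l_def)
  note H = H[folded l_def]
  have df: "partial s v f = partial s v G * H + G * partial s v H" if "v \<in> W" for v
    unfolding f by (rule partial_mult[OF that G H])
  have pow: "restr W (\<lambda>x. \<phi> x ^ m) \<in> forms s W m" if "\<phi> \<in> dual s W" for \<phi> m
    using forms_power[OF dual_forms[OF that], of m] by simp
  have X0: "restr W (\<lambda>x. X x ^ m) \<noteq> 0" for m
  proof
    assume "restr W (\<lambda>x. X x ^ m) = 0"
    then have "restr W (\<lambda>x. X x ^ m) p1 = 0 p1" by simp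
    then show False using p X by (simp add: fun_simps)
  qed
  have Z0: "restr W (\<lambda>x. Z x ^ m) \<noteq> 0" for m
  proof
    assume "restr W (\<lambda>x. Z x ^ m) = 0"
    then have "restr W (\<lambda>x. Z x ^ m) p0 = 0 p0" by simp
    then show False using p Z by (simp add: fun_simps)
  qed
  show ?thesis
  proof (cases "G = 0")
    case True
    have T0: "restr W (\<lambda>x. X x ^ (d - 2)) \<noteq> 0" by (rule X0)
    obtain m where m: "d - 2 = Suc m" using d by (metis Suc_diff_Suc Suc_le_eq numeral_2_eq_2 numeral_3_eq_3)
    have "partial s b (restr W (\<lambda>x. X x ^ (d - 2))) = 0"
      unfolding m partial_power[OF b XZT(1)] X by simp
    moreover have "partial s v f = 0" if "v \<in> W" for v
      using that True by (simp add: f partial_zero)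
    ultimately show ?thesis
      using T0 pow[OF XZT(1), of "d - 2"] forms_zero p b
      by (intro exI[of _ 0] exI[of _ "restr W (\<lambda>x. X x ^ (d - 2))"]) (simp add: partial_zero)
  next
    case G0: False
    show ?thesis
    proof (cases "cross G H = (0, 0, 0)")
      case False
      obtain cx cz ct where c: "cross G H = (cx, cz, ct)" by (metis prod_cases3)
      have c': "cx = partial s p0 G * partial s b H - partial s b G * partial s p0 H"
        "cz = partial s b G * partial s p1 H - partial s p1 G * partial s b H"
        "ct = partial s p1 G * partial s p0 H - partial s p0 G * partial s p1 H"
        using c by (simp_all add: cross_def)
      have "cx * partial s p1 f + cz * partial s p0 f + ct * partial s b f = 0"
        unfolding df[OF p(1)] df[OF p(2)] df[OF b] c' by (simp add: algebra_simps)
      then show ?thesis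
        using cross_forms[OF G H k(1) l(1) c] cross_divergence_free[OF G H c] False c l(2)
        by (intro exI[of _ cx] exI[of _ cz] exI[of _ ct]) simp
    next
      case True
      then have par: "partial s p0 G * partial s b H = partial s b G * partial s p0 H"
        "partial s b G * partial s p1 H = partial s p1 G * partial s b H"
        "partial s p1 G * partial s p0 H = partial s p0 G * partial s p1 H"
        by (simp_all add: cross_def)
      obtain m where m: "l = Suc m" using l(1) by (metis Suc_le_D One_nat_def)
      have "\<exists>\<phi>\<in>dual s W. cross G (restr W (\<lambda>x. \<phi> x ^ l)) \<noteq> (0, 0, 0)"
      proof (rule ccontr)
        assume "\<not> ?thesis"
        then have cX: "cross G (restr W (\<lambda>x. X x ^ l)) = (0, 0, 0)"
          and cZ: "cross G (restr W (\<lambda>x. Z x ^ l)) = (0, 0, 0)" using XZT by auto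
        have sm: "g * fscale a h = fscale a (g * h)" for a and g h :: "'a \<Rightarrow> complex"
          by (rule ext) (simp add: fun_simps)
        have "fscale (of_nat (Suc m)) (partial s b G * restr W (\<lambda>x. X x ^ m)) = 0"
          "fscale (of_nat (Suc m)) (partial s p0 G * restr W (\<lambda>x. X x ^ m)) = 0"
          using cX unfolding cross_def m partial_power[OF p(1) XZT(1)] partial_power[OF p(2) XZT(1)] partial_power[OF b XZT(1)] X
          by (simp_all add: sm del: of_nat_Suc)
        then have "partial s b G * restr W (\<lambda>x. X x ^ m) = 0" "partial s p0 G * restr W (\<lambda>x. X x ^ m) = 0"
          by (simp_all del: of_nat_Suc)
        then have 1: "partial s b G = 0" "partial s p0 G = 0"
          using forms_domain[OF partial_forms[OF b G] pow[OF XZT(1)]] forms_domain[OF partial_forms[OF p(2) G] pow[OF XZT(1)]] X0 by blast+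
        have "fscale (of_nat (Suc m)) (partial s p1 G * restr W (\<lambda>x. Z x ^ m)) = 0"
          using cZ unfolding cross_def m partial_power[OF p(1) XZT(2)] partial_power[OF p(2) XZT(2)] partial_power[OF b XZT(2)] Z
          by (simp add: sm del: of_nat_Suc)
        then have "partial s p1 G * restr W (\<lambda>x. Z x ^ m) = 0" by (simp del: of_nat_Suc)
        then have 2: "partial s p1 G = 0"
          using forms_domain[OF partial_forms[OF p(1) G] pow[OF XZT(2)]] Z0 by blast
        show False using gradient_zero[OF G k(1) 2 1(2) 1(1)] G0 by blast
      qed
      then obtain \<phi> where \<phi>: "\<phi> \<in> dual s W" "cross G (restr W (\<lambda>x. \<phi> x ^ l)) \<noteq> (0, 0, 0)" by blast
      define Q where "Q = restr W (\<lambda>x. \<phi> x ^ l)"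
      have Q: "Q \<in> forms s W l" unfolding Q_def by (rule pow[OF \<phi>(1)])
      obtain cx cz ct where c: "cross G Q = (cx, cz, ct)" by (metis prod_cases3)
      have c': "cx = partial s p0 G * partial s b Q - partial s b G * partial s p0 Q"
        "cz = partial s b G * partial s p1 Q - partial s p1 G * partial s b Q"
        "ct = partial s p1 G * partial s p0 Q - partial s p0 G * partial s p1 Q"
        using c by (simp_all add: cross_def)
      have "cx * partial s p1 f + cz * partial s p0 f + ct * partial s b f
         = G * (partial s p1 Q * (partial s b G * partial s p0 H - partial s p0 G * partial s b H)
              + partial s p0 Q * (partial s p1 G * partial s b H - partial s b G * partial s p1 H)
              + partial s b Q * (partial s p0 G * partial s p1 H - partial s p1 G * partial s p0 H))"
        unfolding df[OF p(1)] df[OF p(2)] df[OF b] c' by (simp add: algebra_simps)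
      also have "\<dots> = 0" using par by simp
      finally show ?thesis
        using cross_forms[OF G Q k(1) l(1) c] cross_divergence_free[OF G Q c] \<phi>(2) c l(2)
        by (intro exI[of _ cx] exI[of _ cz] exI[of _ ct]) (simp add: Q_def)
    qed
  qed
qed

end

section \<open>Bases and coordinates\<close>

context cspace
begin

lemma ordered_basis_unique_length:
  assumes "ordered_basis s W bs" "ordered_basis s W cs"
  shows "length bs = length cs"
proof -
  have "card (set bs) \<le> card (set cs)"
    using assms S.span_superset by (intro conjunct2[OF S.independent_span_bound]) (auto simp: ordered_basis_def)
  moreover have "card (set cs) \<le> card (set bs)"
    using assms S.span_superset by (intro conjunct2[OF S.independent_span_bound]) (auto simp: ordered_basis_def)
  ultimately show ?thesis using assms by (simp add: ordered_basis_def distinct_card)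
qed

lemma exists_ordered_basis:
  assumes "finite D" "W \<subseteq> S.span D"
  shows "\<exists>bs. ordered_basis s W bs"
proof -
  obtain B where B: "B \<subseteq> W" "S.independent B" "W \<subseteq> S.span B" using S.maximal_independent_subset by metis
  have "finite B" using S.independent_span_bound[OF assms(1) B(2)] B(1) assms(2) by auto
  then obtain bs where "set bs = B" "distinct bs" using finite_distinct_list by blast
  moreover have "S.span B = W" using B sub S.span_minimal by blast
  ultimately show ?thesis using B(2) by (auto simp: ordered_basis_def)
qed

text \<open>Coordinate functionals on \<open>W\<close>, with value \<open>0\<close> outside of \<open>W\<close>.\<close>

definition coord :: "'a list \<Rightarrow> nat \<Rightarrow> 'a \<Rightarrow> complex" where
  "coord bs i v = (if v \<in> W then S.representation (set bs) v (bs ! i) else 0)"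

context
  fixes bs assumes bs: "ordered_basis s W bs"
begin

lemma basis_facts: "S.independent (set bs)" "S.span (set bs) = W" "distinct bs"
  using bs by (auto simp: ordered_basis_def)

lemma basis_mem: "i < length bs \<Longrightarrow> bs ! i \<in> W"
  using basis_facts(2) S.span_base[OF nth_mem] by blast

lemma coord_dual: "coord bs i \<in> dual s W"
  using basis_facts
  by (auto simp: dual_def coord_def mem_add mem_scale S.representation_add S.representation_scale)

lemma coord_basis: "i < length bs \<Longrightarrow> j < length bs \<Longrightarrow> coord bs i (bs ! j) = (if i = j then 1 else 0)"
  using S.representation_basis[OF basis_facts(1), of "bs ! j"] basis_mem[of j] basis_facts(3)
  by (auto simp: coord_def nth_eq_iff_index_eq)

lemma sum_over_basis:
  "(\<Sum>i<length bs. h (bs ! i)) = (\<Sum>x\<in>set bs. h x)"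
  for h :: "'a \<Rightarrow> 'c::comm_monoid_add"
proof -
  have "bij_betw (\<lambda>i. bs ! i) {..<length bs} (set bs)"
    using basis_facts(3) by (rule bij_betw_nth) auto
  then show ?thesis by (rule sum.reindex_bij_betw)
qed

lemma coord_sum:
  assumes "v \<in> W"
  shows "v = (\<Sum>i<length bs. s (coord bs i v) (bs ! i))"
proof -
  have "(\<Sum>x\<in>set bs. s (S.representation (set bs) v x) x) = v"
    using basis_facts assms by (intro S.sum_representation_eq) auto
  then show ?thesis
    using sum_over_basis[of "\<lambda>x. s (S.representation (set bs) v x) x"] assms by (simp add: coord_def)
qed

lemma coord_of_sum:
  assumes "j < length bs"
  shows "coord bs j (\<Sum>i<length bs. s (x i) (bs ! i)) = x j"
proof -
  have m: "s (x i) (bs ! i) \<in> W" if "i \<in> {..<length bs}" for i using that basis_mem by (simp add: mem_scale)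
  have "coord bs j (\<Sum>i<length bs. s (x i) (bs ! i)) = (\<Sum>i<length bs. coord bs j (s (x i) (bs ! i)))"
    using m by (intro dual_sum[OF coord_dual]) auto
  also have "\<dots> = (\<Sum>i\<in>{j}. x i)"
    using basis_mem assms
    by (intro sum.mono_neutral_cong_right) (auto simp: dual_scale[OF coord_dual] coord_basis)
  also have "\<dots> = x j" by simp
  finally show ?thesis .
qed

lemma zero_if_coords_zero: "v \<in> W \<Longrightarrow> (\<And>i. i < length bs \<Longrightarrow> coord bs i v = 0) \<Longrightarrow> v = 0"
  using coord_sum[of v] by simp

lemma dual_spanned: "dual s W \<subseteq> FS.span (coord bs ` {..<length bs})"
proof
  fix \<phi> assume \<phi>: "\<phi> \<in> dual s W"
  have "\<phi> = (\<Sum>i<length bs. fscale (\<phi> (bs ! i)) (coord bs i))"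
  proof
    fix v
    show "\<phi> v = (\<Sum>i<length bs. fscale (\<phi> (bs ! i)) (coord bs i)) v"
    proof (cases "v \<in> W")
      case True
      have "\<phi> (\<Sum>i<length bs. s (coord bs i v) (bs ! i)) = (\<Sum>i<length bs. \<phi> (s (coord bs i v) (bs ! i)))"
        using basis_mem by (intro dual_sum[OF \<phi>]) (auto simp: mem_scale)
      then have "\<phi> v = (\<Sum>i<length bs. \<phi> (s (coord bs i v) (bs ! i)))"
        using coord_sum[OF True] by simp
      then show ?thesis
        using basis_mem by (simp add: fun_sum_apply fun_simps dual_scale[OF \<phi>] mult.commute)
    next
      case False
      then show ?thesis using dual_outside[OF \<phi>] by (simp add: fun_sum_apply fun_simps coord_def)
    qed
  qed
  also have "\<dots> \<in> FS.span (coord bs ` {..<length bs})"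
    by (intro FS.span_sum FS.span_scale FS.span_base) auto
  finally show "\<phi> \<in> FS.span (coord bs ` {..<length bs})" .
qed

end

text \<open>Such functionals are the dual basis of the vectors \<open>e\<close> that witness the last assumption.\<close>

lemma basis_length_from_functionals:
  assumes fin: "finite I" and c: "\<And>i. i \<in> I \<Longrightarrow> c i \<in> dual s W"
    and sep: "\<And>v. v \<in> W \<Longrightarrow> (\<And>i. i \<in> I \<Longrightarrow> c i v = 0) \<Longrightarrow> v = 0"
    and delta: "\<And>i. i \<in> I \<Longrightarrow> \<exists>e\<in>W. c i e = 1 \<and> (\<forall>j\<in>I - {i}. c j e = 0)"
  shows "\<exists>bs. ordered_basis s W bs" and "ordered_basis s W bs \<Longrightarrow> length bs = card I"
proof -
  obtain e where e: "\<And>i. i \<in> I \<Longrightarrow> e i \<in> W" "\<And>i. i \<in> I \<Longrightarrow> c i (e i) = 1"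
    "\<And>i j. i \<in> I \<Longrightarrow> j \<in> I - {i} \<Longrightarrow> c j (e i) = 0" using delta by metis
  have cs: "c j (\<Sum>i\<in>I. s (x i) (e i)) = x j" if "j \<in> I" for x j
  proof -
    have "c j (\<Sum>i\<in>I. s (x i) (e i)) = (\<Sum>i\<in>I. c j (s (x i) (e i)))"
      using fin e by (intro dual_sum[OF c[OF that]]) (auto simp: mem_scale)
    also have "\<dots> = (\<Sum>i\<in>{j}. x i * c j (e i))"
      using fin that e by (intro sum.mono_neutral_cong_right) (auto simp: dual_scale[OF c[OF that]])
    finally show ?thesis using e(2)[OF that] by simp
  qed
  have rep: "v = (\<Sum>i\<in>I. s (c i v) (e i))" if v: "v \<in> W" for v
  proof -
    let ?u = "\<Sum>i\<in>I. s (c i v) (e i)"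
    have u: "?u \<in> W" using e by (intro mem_sum mem_scale) auto
    have "v - ?u = 0"
    proof (rule sep[OF mem_diff[OF v u]])
      fix i assume i: "i \<in> I"
      have "c i (v - ?u) = c i v - c i ?u"
        using dual_add[OF c[OF i] mem_diff[OF v u] u] by simp
      then show "c i (v - ?u) = 0" using cs[OF i] by simp
    qed
    then show ?thesis by simp
  qed
  have inj: "inj_on e I"
  proof (rule inj_onI, rule ccontr)
    fix i j assume "i \<in> I" "j \<in> I" "e i = e j" "i \<noteq> j"
    then show False using e(2)[of i] e(3)[of j i] by auto
  qed
  have span: "S.span (e ` I) = W"
  proof
    show "S.span (e ` I) \<subseteq> W" using e sub by (intro S.span_minimal) auto
    show "W \<subseteq> S.span (e ` I)"
    proof
      fix v assume "v \<in> W"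
      have "(\<Sum>i\<in>I. s (c i v) (e i)) \<in> S.span (e ` I)" by (intro S.span_sum S.span_scale S.span_base) auto
      then show "v \<in> S.span (e ` I)" using rep[OF \<open>v \<in> W\<close>] by simp
    qed
  qed
  have indep: "S.independent (e ` I)"
  proof
    assume "S.dependent (e ` I)"
    then obtain u where u: "\<exists>v\<in>e ` I. u v \<noteq> 0" "(\<Sum>v\<in>e ` I. s (u v) v) = 0"
      using S.dependent_finite[of "e ` I"] fin by auto
    then have z: "(\<Sum>i\<in>I. s (u (e i)) (e i)) = 0" using inj by (simp add: sum.reindex)
    obtain j where j: "j \<in> I" "u (e j) \<noteq> 0" using u by auto
    have "c j 0 = u (e j)" using cs[OF j(1), of "\<lambda>i. u (e i)"] z by simp
    then show False using j dual_0[OF c[OF j(1)]] by simp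
  qed
  obtain es where es: "set es = e ` I" "distinct es" using finite_distinct_list[of "e ` I"] fin by auto
  have ob: "ordered_basis s W es" using es indep span by (simp add: ordered_basis_def)
  then show "\<exists>bs. ordered_basis s W bs" by blast
  have "length es = card I" using es inj by (metis card_image distinct_card)
  then show "length bs = card I" if "ordered_basis s W bs"
    using ordered_basis_unique_length[OF that ob] by simp
qed

lemma span_mult:
  fixes A B :: "('x \<Rightarrow> complex) set"
  assumes "x \<in> FS.span A" "y \<in> FS.span B"
  shows "x * y \<in> FS.span {a * b | a b. a \<in> A \<and> b \<in> B}" (is "_ \<in> FS.span ?C")
proof -
  have 1: "a * y \<in> FS.span ?C" if "a \<in> A" for a
    using assms(2)
  proof (induction rule: FS.span_induct_alt)
    case base
    then show ?case using FS.span_zero[of ?C] by simp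
  next
    case (step c b y)
    have "a * b \<in> FS.span ?C" using that step by (intro FS.span_base) blast
    then have "fscale c (a * b) + a * y \<in> FS.span ?C" using step by (intro FS.span_add FS.span_scale) auto
    moreover have "a * (fscale c b + y) = fscale c (a * b) + a * y"
      by (rule ext) (simp add: fun_simps algebra_simps)
    ultimately show ?case by (simp only:)
  qed
  show ?thesis
    using assms(1)
  proof (induction rule: FS.span_induct_alt)
    case base
    then show ?case using FS.span_zero[of ?C] by simp
  next
    case (step c a x)
    then have "fscale c (a * y) + x * y \<in> FS.span ?C" using 1 by (intro FS.span_add FS.span_scale) auto
    moreover have "(fscale c a + x) * y = fscale c (a * y) + x * y"
      by (rule ext) (simp add: fun_simps algebra_simps)
    ultimately show ?case by (simp only:)
  qed
qed

text \<open>Products of \<open>k\<close> linear forms expand into products of \<open>k\<close> coordinates.\<close>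

lemma forms_finitely_spanned:
  assumes "ordered_basis s W bs"
  shows "\<exists>D. finite D \<and> forms s W k \<subseteq> FS.span D"
proof -
  define C where "C = coord bs ` {..<length bs}"
  define D where "D = rec_nat {restr W (\<lambda>_. 1)} (\<lambda>_ B. {a * b | a b. a \<in> C \<and> b \<in> B})"
  have D: "D 0 = {restr W (\<lambda>_. 1)}" "D (Suc k) = {a * b | a b. a \<in> C \<and> b \<in> D k}" for k
    by (simp_all add: D_def)
  have "finite (D k)" for k
  proof (induction k)
    case (Suc k)
    then show ?case unfolding D by (intro finite_image_set2) (simp_all add: C_def)
  qed (simp add: D)
  moreover have "g \<in> FS.span (D k)" if "g \<in> forms s W k" for g k
    using that
  proof (induction rule: forms_induct)
    case (mult k \<phi> g)
    have "\<phi> \<in> FS.span C" using dual_spanned[OF assms] mult(1) by (auto simp: C_def)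
    then show ?case unfolding D using mult(3) by (rule span_mult)
  qed (auto simp: D intro: FS.span_zero FS.span_add FS.span_scale FS.span_base)
  ultimately show ?thesis by blast
qed

lemma cspace3_of_basis:
  assumes "ordered_basis s W [p1, p0, b]"
  shows "\<exists>X Z T. cspace3 s W p1 p0 b X Z T"
proof -
  let ?bs = "[p1, p0, b]"
  note c = coord_basis[OF assms]
  have "cspace3 s W p1 p0 b (coord ?bs 0) (coord ?bs 1) (coord ?bs 2)"
  proof unfold_locales
    show "p1 \<in> W" "p0 \<in> W" "b \<in> W"
      using basis_mem[OF assms, of 0] basis_mem[OF assms, of 1] basis_mem[OF assms, of 2] by simp_all
    show "coord ?bs 0 p1 = 1" "coord ?bs 0 p0 = 0" "coord ?bs 0 b = 0"
      using c[of 0 0] c[of 0 1] c[of 0 2] by simp_all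
    show "coord ?bs 1 p1 = 0" "coord ?bs 1 p0 = 1" "coord ?bs 1 b = 0"
      using c[of 1 0] c[of 1 1] c[of 1 2] by simp_all
    show "coord ?bs 2 p1 = 0" "coord ?bs 2 p0 = 0" "coord ?bs 2 b = 1"
      using c[of 2 0] c[of 2 1] c[of 2 2] by simp_all
    show "v = s (coord ?bs 0 v) p1 + s (coord ?bs 1 v) p0 + s (coord ?bs 2 v) b" if "v \<in> W" for v
      using coord_sum[OF assms that] by (simp add: lessThan_Suc numeral_2_eq_2 numeral_3_eq_3 algebra_simps)
  qed (rule coord_dual[OF assms])+
  then show ?thesis by blast
qed

lemma list3: "length es = 3 \<Longrightarrow> es = [es ! 0, es ! 1, es ! 2]"
  by (auto simp: numeral_3_eq_3 numeral_2_eq_2 length_Suc_conv)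

end

section \<open>The dimension of the space of divergence-free fields\<close>

lemma coeff_euler:
  fixes C :: "complex poly poly"
  shows "coeff (coeff (smult (of_nat e) C - [:0, 1:] * pderiv C - smult [:0, 1:] (dt C)) i) j
    = (of_nat e - of_nat i - of_nat j) * coeff (coeff C i) j"
proof -
  have 1: "coeff (coeff ([:0, 1:] * pderiv C) i) j = of_nat i * coeff (coeff C i) j"
    by (cases i) (simp_all add: coeff_pderiv of_nat_poly flip: of_nat_Suc)
  have 2: "coeff (coeff (smult [:0, 1:] (dt C)) i) j = of_nat j * coeff (coeff C i) j"
    by (cases j) (simp_all add: coeff_dt coeff_pderiv flip: of_nat_Suc)
  have 3: "coeff (coeff (smult (of_nat e) C) i) j = of_nat e * coeff (coeff C i) j"
    by (simp add: of_nat_poly)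
  show ?thesis unfolding coeff_diff 1 2 3 by (simp add: algebra_simps)
qed

text \<open>The first component is found by integrating in \<open>x\<close>, up to a polynomial in \<open>t\<close>.\<close>

lemma divergence_free_completion:
  fixes B C :: "complex poly poly" and a :: "complex poly"
  assumes B: "total_degree_le e B" and C: "total_degree_le e C" and a: "degree a \<le> e"
  shows "\<exists>A. total_degree_le e A \<and> coeff A 0 = a \<and>
    pderiv A + (smult (of_nat e) C - [:0, 1:] * pderiv C - smult [:0, 1:] (dt C)) + dt B = 0"
proof -
  define R where "R = (smult (of_nat e) C - [:0, 1:] * pderiv C - smult [:0, 1:] (dt C)) + dt B"
  have coeffR: "coeff (coeff R i) j = (of_nat e - of_nat i - of_nat j) * coeff (coeff C i) j
      + of_nat (Suc j) * coeff (coeff B i) (Suc j)" for i j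
    unfolding R_def coeff_add coeff_euler by (simp add: coeff_dt coeff_pderiv)
  have zero: "coeff (coeff R i) j = 0" if "e \<le> i + j" for i j
  proof (cases "e = i + j")
    case True
    then show ?thesis unfolding coeffR using total_degree_leD[OF B, of i "Suc j"] by simp
  next
    case False
    then show ?thesis
      unfolding coeffR using total_degree_leD[OF B, of i "Suc j"] total_degree_leD[OF C, of i j] that by simp
  qed
  define D where "D = (\<Sum>i\<le>degree R. monom (smult (- 1 / of_nat (Suc i)) (coeff R i)) i)"
  have coeffD: "coeff D i = smult (- 1 / of_nat (Suc i)) (coeff R i)" for i
    unfolding D_def by (simp add: coeff_sum coeff_eq_0 if_distrib cong: if_cong)
  have "total_degree_le e (pCons a D)"
    unfolding total_degree_le_def
  proof (intro allI impI)
    fix i j assume nz: "coeff (coeff (pCons a D) i) j \<noteq> 0"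
    show "i + j \<le> e"
    proof (cases i)
      case 0
      then show ?thesis using nz a le_degree[of a j] by simp
    next
      case (Suc i')
      then have "coeff (coeff R i') j \<noteq> 0" using nz by (auto simp: coeffD)
      then show ?thesis using zero[of i' j] Suc by (cases "e \<le> i' + j") auto
    qed
  qed
  moreover have "pderiv (pCons a D) + R = 0"
  proof (rule poly_eqI, rule poly_eqI)
    fix i j
    have "of_nat (Suc i) * p = smult (of_nat (Suc i)) p" for p :: "complex poly"
      by (simp add: of_nat_poly del: of_nat_Suc)
    then have "coeff (pderiv (pCons a D)) i = - coeff R i"
      by (simp add: coeff_pderiv coeffD del: of_nat_Suc)
    then show "coeff (coeff (pderiv (pCons a D) + R) i) j = coeff (coeff 0 i) j" by simp
  qed
  ultimately show ?thesis
    unfolding R_def by (intro exI[of _ "pCons a D"]) (simp add: add.assoc)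
qed

lemma card_triangle: "2 * card {(i, j). i + j \<le> (e::nat)} = (e + 1) * (e + 2)"
proof -
  have "{(i, j). i + j \<le> e} = Sigma {..e} (\<lambda>i. {..e - i})" by auto
  then have "card {(i, j). i + j \<le> e} = (\<Sum>i\<le>e. Suc (e - i))" by simp
  also have "\<dots> = (\<Sum>i\<le>e. Suc i)"
    using sum.atLeastAtMost_rev[of Suc 0 e] by (simp add: atLeast0AtMost)
  finally have c: "card {(i, j). i + j \<le> e} = (\<Sum>i\<le>e. Suc i)" .
  have "2 * (\<Sum>i\<le>n. Suc i) = (n + 1) * (n + 2)" for n by (induction n) auto
  then show ?thesis unfolding c .
qed

context cspace3
begin

abbreviation "sl e \<equiv> sl_space s W [p1, p0, b] e"

lemma mem_sl: "g \<in> sl e \<longleftrightarrow> g 0 \<in> forms s W e \<and> g 1 \<in> forms s W e \<and> g 2 \<in> forms s W e \<and>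
  (\<forall>i\<ge>3. g i = 0) \<and> partial s p1 (g 0) + partial s p0 (g 1) + partial s b (g 2) = 0"
proof -
  have all: "(\<forall>i<3. P i) \<longleftrightarrow> P 0 \<and> P 1 \<and> P (2::nat)" for P
    by (auto simp: numeral_3_eq_3 numeral_2_eq_2 less_Suc_eq)
  have "length [p1, p0, b] = 3" by simp
  moreover have "(\<Sum>i<3. partial s ([p1, p0, b] ! i) (g i)) = partial s p1 (g 0) + partial s p0 (g 1) + partial s b (g 2)"
    by (simp add: numeral_3_eq_3 numeral_2_eq_2 add.assoc)
  moreover have ge: "(\<forall>i\<ge>length [p1, p0, b]. g i = 0) \<longleftrightarrow> (\<forall>i\<ge>3. g i = 0)" by (simp add: numeral_3_eq_3)
  ultimately show ?thesis unfolding sl_space_def mem_Collect_eq by (simp only: all conj_assoc)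
qed

lemma sl_cspace: "cspace (pointwise fscale) (sl e)"
proof -
  interpret PS: vector_space "pointwise fscale :: complex \<Rightarrow> (nat \<Rightarrow> 'a \<Rightarrow> complex) \<Rightarrow> nat \<Rightarrow> 'a \<Rightarrow> complex"
    by (rule vector_space_pointwise[OF vector_space_fscale])
  have pw: "pointwise fscale c g i = fscale c (g i)" for c i and g :: "nat \<Rightarrow> 'a \<Rightarrow> complex"
    by (simp add: pointwise_def)
  show ?thesis
  proof
    show "PS.subspace (sl e)"
    proof (rule PS.subspaceI)
      have z: "(0 :: nat \<Rightarrow> 'a \<Rightarrow> complex) i = 0" for i by (rule zero_fun_apply)
      show "0 \<in> sl e"
        unfolding mem_sl z using forms_zero partial_zero[OF p(1)] partial_zero[OF p(2)] partial_zero[OF b] by simp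
    next
      fix g h assume "g \<in> sl e" "h \<in> sl e"
      then have g: "g 0 \<in> forms s W e" "g 1 \<in> forms s W e" "g 2 \<in> forms s W e" "\<forall>i\<ge>3. g i = 0"
          "partial s p1 (g 0) + partial s p0 (g 1) + partial s b (g 2) = 0"
        and h: "h 0 \<in> forms s W e" "h 1 \<in> forms s W e" "h 2 \<in> forms s W e" "\<forall>i\<ge>3. h i = 0"
          "partial s p1 (h 0) + partial s p0 (h 1) + partial s b (h 2) = 0" unfolding mem_sl by blast+
      have "partial s p1 (g 0 + h 0) + partial s p0 (g 1 + h 1) + partial s b (g 2 + h 2)
          = (partial s p1 (g 0) + partial s p0 (g 1) + partial s b (g 2)) + (partial s p1 (h 0) + partial s p0 (h 1) + partial s b (h 2))"
        by (simp only: partial_add[OF p(1) g(1) h(1)] partial_add[OF p(2) g(2) h(2)] partial_add[OF b g(3) h(3)] ac_simps)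
      moreover have pl: "(g + h) i = g i + h i" for i by (rule plus_fun_apply)
      ultimately show "g + h \<in> sl e"
        unfolding mem_sl pl using g h by (simp add: forms_add)
    next
      fix c g assume "g \<in> sl e"
      then have g: "g 0 \<in> forms s W e" "g 1 \<in> forms s W e" "g 2 \<in> forms s W e" "\<forall>i\<ge>3. g i = 0"
          "partial s p1 (g 0) + partial s p0 (g 1) + partial s b (g 2) = 0" unfolding mem_sl by blast+
      have "partial s p1 (fscale c (g 0)) + partial s p0 (fscale c (g 1)) + partial s b (fscale c (g 2))
          = fscale c (partial s p1 (g 0) + partial s p0 (g 1) + partial s b (g 2))"
        by (simp only: partial_scale[OF p(1) g(1)] partial_scale[OF p(2) g(2)] partial_scale[OF b g(3)] FS.scale_right_distrib)
      then show "pointwise fscale c g \<in> sl e"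
        unfolding mem_sl pw using g by (simp add: forms_scale)
    qed
  qed
qed

text \<open>
  On the chart, a divergence-free field is determined by its last two components, which are arbitrary
  and have \<open>(e + 1) (e + 2) / 2\<close> coefficients each, and by the terms free of \<open>x\<close> of the first, which
  have \<open>e + 1\<close> coefficients.
\<close>

lemma sl_basis_length:
  assumes e: "1 \<le> e"
  shows "\<exists>bs. ordered_basis (pointwise fscale) (sl e) bs"
    and "ordered_basis (pointwise fscale) (sl e) bs \<Longrightarrow> length bs = (e + 1) * (e + 3)"
proof -
  let ?B = "bip p1 p0 b"
  interpret L: cspace "pointwise fscale" "sl e" by (rule sl_cspace)
  define Tr where "Tr = {(i, j). i + j \<le> e}"
  have finT: "finite Tr" unfolding Tr_def by (rule finite_subset[of _ "{..e} \<times> {..e}"]) auto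
  \<comment> \<open>\<open>(k, i, j)\<close> stands for the coefficient of \<open>x\<^sup>i t\<^sup>j\<close> in component \<open>k\<close>.\<close>
  define I :: "(nat \<times> nat \<times> nat) set" where "I = {0} \<times> {0} \<times> {..e} \<union> {1, 2} \<times> Tr"
  have finI: "finite I" using finT by (simp add: I_def)
  have cardI: "card I = (e + 1) * (e + 3)"
  proof -
    have "card I = card ({0::nat} \<times> {0::nat} \<times> {..e}) + card ({1, 2::nat} \<times> Tr)"
      unfolding I_def using finT by (intro card_Un_disjoint) auto
    also have "\<dots> = (e + 1) + 2 * card Tr" by (simp add: card_cartesian_product)
    also have "\<dots> = (e + 1) * (e + 3)" unfolding Tr_def card_triangle by (simp add: algebra_simps)
    finally show ?thesis .
  qed
  define c where "c = (\<lambda>(k, i, j). restr (sl e) (\<lambda>g. coeff (coeff (?B (g k)) i) j))"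
  have gk: "g k \<in> forms s W e" if "g \<in> sl e" for g k
    using that forms_zero unfolding mem_sl
    by (metis One_nat_def Suc_1 less_2_cases_iff less_Suc_eq not_le numeral_3_eq_3)
  have cI: "c i \<in> dual (pointwise fscale) (sl e)" for i
  proof -
    obtain k a j where i: "i = (k, a, j)" by (metis prod_cases3)
    show ?thesis
      unfolding dual_def mem_Collect_eq
    proof (intro conjI ballI allI impI)
      fix g h assume gh: "g \<in> sl e" "h \<in> sl e"
      then show "c i (g + h) = c i g + c i h"
        using L.mem_add[OF gh] bip_add[OF p gk[OF gh(1)] gk[OF gh(2)]]
        by (simp add: c_def i restr_apply plus_fun_apply)
    next
      fix a' g assume g: "g \<in> sl e"
      then show "c i (pointwise fscale a' g) = a' * c i g"
        using L.mem_scale[OF g, of a'] bip_scale[OF p gk[OF g]]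
        by (simp add: c_def i restr_apply pointwise_def[of fscale])
    next
      fix g assume "g \<notin> sl e"
      then show "c i g = 0" by (simp add: c_def i restr_apply)
    qed
  qed
  have bip0: "g = 0" if "?B g = 0" "g \<in> forms s W e" for g
    using form_eqI[OF that(2) forms_zero] bip_0[OF p] that(1) by simp
  have td: "total_degree_le e (?B (g k))" if "g \<in> sl e" for g k by (rule total_degree_bip[OF p gk[OF that]])
  have Beq: "?B g = 0" if "total_degree_le e (?B g)" "\<And>i j. (i, j) \<in> Tr \<Longrightarrow> coeff (coeff (?B g) i) j = 0" for g
  proof (intro poly_eqI)
    fix i j
    show "coeff (coeff (?B g) i) j = coeff (coeff 0 i) j"
      using total_degree_leD[OF that(1), of i j] that(2)[of i j] by (cases "i + j \<le> e") (auto simp: Tr_def)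
  qed
  have bip_div: "?B (partial s p1 g0 + partial s p0 g1 + partial s b g2) =
      pderiv (?B g0) + (smult (of_nat e) (?B g1) - [:0, 1:] * pderiv (?B g1) - smult [:0, 1:] (dt (?B g1))) + dt (?B g2)"
    if g: "g0 \<in> forms s W e" "g1 \<in> forms s W e" "g2 \<in> forms s W e" for g0 g1 g2
  proof -
    note pg = partial_forms[OF p(1) g(1)] partial_forms[OF p(2) g(2)] partial_forms[OF b g(3)]
    show ?thesis
      by (simp only: bip_add[OF p forms_add[OF pg(1,2)] pg(3)] bip_add[OF p pg(1,2)]
        bip_partial_1[OF p b g(1)] bip_partial_0[OF p b g(2)] bip_partial_v[OF p b g(3)])
  qed
  have sep: "g = 0" if g: "g \<in> sl e" and z: "\<And>i. i \<in> I \<Longrightarrow> c i g = 0" for g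
  proof -
    have z': "coeff (coeff (?B (g k)) i) j = 0" if "(k, i, j) \<in> I" for k i j
      using z[OF that] g by (simp add: c_def restr_apply)
    have B1: "?B (g 1) = 0" using td[OF g] by (rule Beq) (rule z', simp add: I_def)
    have B2: "?B (g 2) = 0" using td[OF g] by (rule Beq) (rule z', simp add: I_def)
    have "pderiv (?B (g 0)) = 0"
      using bip_div[OF gk[OF g] gk[OF g] gk[OF g], of 0 1 2] g bip_0[OF p] unfolding mem_sl B1 B2 by (simp add: dt_0)
    then obtain a where a: "?B (g 0) = [:a:]" using pderiv_iszero by blast
    have "coeff a j = 0" for j
    proof (cases "j \<le> e")
      case True
      then show ?thesis using z'[of 0 0 j] a by (simp add: I_def)
    next
      case False
      then show ?thesis using total_degree_leD[OF td[OF g, of 0], of 0 j] a by simp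
    qed
    then have "a = 0" by (simp add: poly_eq_iff)
    then have B0: "?B (g 0) = 0" using a by simp
    have "g k = 0" for k
    proof -
      consider "k = 0" | "k = 1" | "k = 2" | "3 \<le> k" by linarith
      then show ?thesis
      proof cases
        case 4
        then show ?thesis using g unfolding mem_sl by blast
      qed (use bip0 B0 B1 B2 gk[OF g] in auto)
    qed
    then show ?thesis by (intro ext) (simp add: fun_simps)
  qed
  have delta: "\<exists>g\<in>sl e. c i g = 1 \<and> (\<forall>j\<in>I - {i}. c j g = 0)" if i: "i \<in> I" for i
  proof -
    obtain k i1 j1 where ik: "i = (k, i1, j1)" by (metis prod_cases3)
    have le: "i1 + j1 \<le> e" using i by (auto simp: ik I_def Tr_def)
    define M where "M = monom (monom (1::complex) j1) i1"
    have cM: "coeff (coeff M i') j' = (if i' = i1 \<and> j' = j1 then 1 else 0)" for i' j'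
      by (auto simp: M_def)
    have tdM: "total_degree_le e M" using le by (auto simp: total_degree_le_def cM split: if_splits)
    have td0: "total_degree_le e 0" by (simp add: total_degree_le_def)
    define C where "C = (if k = 1 then M else 0)"
    define B where "B = (if k = 2 then M else 0)"
    define a where "a = (if k = 0 then monom (1::complex) j1 else 0)"
    have "degree a \<le> e" using le degree_monom_le[of "1::complex" j1] by (auto simp: a_def)
    moreover have tdB: "total_degree_le e B" and tdC: "total_degree_le e C"
      using tdM td0 by (auto simp: B_def C_def)
    ultimately obtain A where A: "total_degree_le e A" "coeff A 0 = a"
      "pderiv A + (smult (of_nat e) C - [:0, 1:] * pderiv C - smult [:0, 1:] (dt C)) + dt B = 0"
      using divergence_free_completion by blast
    define g where "g = (\<lambda>n. if n = 0 then homogenize e A else if n = 1 then homogenize e C else if n = (2::nat) then homogenize e B else 0)"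
    have g: "g 0 = homogenize e A" "g 1 = homogenize e C" "g 2 = homogenize e B" "\<forall>i\<ge>3. g i = 0"
      by (simp_all add: g_def)
    have Bg: "?B (g 0) = A" "?B (g 1) = C" "?B (g 2) = B"
      unfolding g using bip_homogenize A(1) tdB tdC by blast+
    have fg: "g 0 \<in> forms s W e" "g 1 \<in> forms s W e" "g 2 \<in> forms s W e"
      unfolding g by (rule homogenize_forms)+
    have "partial s p1 (g 0) + partial s p0 (g 1) + partial s b (g 2) = 0"
    proof (rule form_eqI[of _ "e - 1"])
      show "partial s p1 (g 0) + partial s p0 (g 1) + partial s b (g 2) \<in> forms s W (e - 1)"
        using fg p b by (intro forms_add partial_forms)
      show "?B (partial s p1 (g 0) + partial s p0 (g 1) + partial s b (g 2)) = ?B 0"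
        unfolding bip_div[OF fg] Bg A(3) bip_0[OF p] ..
    qed (rule forms_zero)
    then have gsl: "g \<in> sl e" using fg g unfolding mem_sl by blast
    have cg: "c (k', i', j') g = coeff (coeff (?B (g k')) i') j'" for k' i' j'
      using gsl by (simp add: c_def restr_apply)
    have c0: "c (0, 0, j') g = coeff a j'" for j' unfolding cg Bg using A(2) by simp
    have c12: "c (1, i', j') g = coeff (coeff C i') j'" "c (2, i', j') g = coeff (coeff B i') j'" for i' j'
      unfolding cg Bg by simp_all
    have k: "k = 0 \<and> i1 = 0 \<or> k = 1 \<or> k = 2" using i by (auto simp: ik I_def)
    have "c i g = 1" using k unfolding ik by (auto simp: c0 c12 c12[unfolded One_nat_def] a_def B_def C_def cM)
    moreover have "c j g = 0" if j: "j \<in> I - {i}" for j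
    proof -
      obtain k' i' j' where jk: "j = (k', i', j')" by (metis prod_cases3)
      have "k' = 0 \<and> i' = 0 \<or> k' = 1 \<or> k' = 2" using j by (auto simp: jk I_def)
      moreover have "(k', i', j') \<noteq> (k, i1, j1)" using j by (simp add: jk ik)
      ultimately show ?thesis
        using k unfolding jk by (auto simp: c0 c12 c12[unfolded One_nat_def] a_def B_def C_def cM)
    qed
    ultimately show ?thesis using gsl by blast
  qed
  show "\<exists>bs. ordered_basis (pointwise fscale) (sl e) bs"
    by (rule L.basis_length_from_functionals(1)[OF finI cI sep delta])
  show "length bs = (e + 1) * (e + 3)" if "ordered_basis (pointwise fscale) (sl e) bs"
    using L.basis_length_from_functionals(2)[OF finI cI sep delta that] cardI by simp
qed

text \<open>Only the differential operators \<open>\<Sum> g\<^sub>i \<partial>\<^sub>i\<close> matter, not the basis in which they are written.\<close>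

lemma ruppert_kernel_irreducible:
  assumes es: "ordered_basis s W es" "length es = 3"
    and f: "f \<in> forms s W d" and d: "2 \<le> d" and fp1: "f p1 \<noteq> 0"
    and sep: "card {x. f (s x p1 + p0) = 0} = d" and irred: "\<not> reducible s W d f"
    and g: "g \<in> sl_space s W es (d - 2)" and kernel: "ruppert_map s es f g = 0"
  shows "g = 0"
proof -
  have gf: "g i \<in> forms s W (d - 2)" if "i < 3" for i
    using g es(2) that by (simp add: sl_space_def)
  have em: "es ! i \<in> W" if "i < 3" for i using basis_mem[OF es(1)] es(2) that by simp
  define gx gz gt where "gx = (\<Sum>i<3. fscale (X (es ! i)) (g i))"
    and "gz = (\<Sum>i<3. fscale (Z (es ! i)) (g i))" and "gt = (\<Sum>i<3. fscale (T (es ! i)) (g i))"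
  have mem: "gx \<in> forms s W (d - 2)" "gz \<in> forms s W (d - 2)" "gt \<in> forms s W (d - 2)"
    unfolding gx_def gz_def gt_def using gf by (auto intro!: forms_sum forms_scale)
  have dir: "partial s (es ! i) h = fscale (X (es ! i)) (partial s p1 h) + fscale (Z (es ! i)) (partial s p0 h)
      + fscale (T (es ! i)) (partial s b h)" if "i < 3" "h \<in> forms s W m" for i h m
  proof -
    note m = mem_scale[OF p(1)] mem_scale[OF p(2)] mem_scale[OF b]
    have "partial s (es ! i) h = partial s (s (X (es ! i)) p1) h + partial s (s (Z (es ! i)) p0) h + partial s (s (T (es ! i)) b) h"
      by (subst coords[OF em[OF that(1)]]) (simp add: partial_add_dir[OF mem_add[OF m(1,2)] m(3) that(2)] partial_add_dir[OF m(1,2) that(2)])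
    then show ?thesis
      by (simp add: partial_scale_dir[OF p(1) that(2)] partial_scale_dir[OF p(2) that(2)] partial_scale_dir[OF b that(2)])
  qed
  have psum: "partial s v (\<Sum>i<3. fscale (c i) (g i)) = (\<Sum>i<3. fscale (c i) (partial s v (g i)))" if v: "v \<in> W" for v c
  proof -
    note gs = gf[of 0] gf[of 1] gf[of 2]
    have "partial s v (fscale (c 0) (g 0) + fscale (c 1) (g 1) + fscale (c 2) (g 2)) =
        fscale (c 0) (partial s v (g 0)) + fscale (c 1) (partial s v (g 1)) + fscale (c 2) (partial s v (g 2))"
      using gs by (simp add: partial_add[OF v forms_add[OF forms_scale forms_scale] forms_scale]
          partial_add[OF v forms_scale forms_scale] partial_scale[OF v])
    then show ?thesis by (simp add: numeral_3_eq_3 numeral_2_eq_2 add.assoc)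
  qed
  have "partial s p1 gx + partial s p0 gz + partial s b gt = (\<Sum>i<3. partial s (es ! i) (g i))"
    unfolding gx_def gz_def gt_def psum[OF p(1)] psum[OF p(2)] psum[OF b]
    using dir[OF _ gf] by (simp add: sum.distrib[symmetric])
  also have "\<dots> = 0" using g es(2) by (simp add: sl_space_def)
  finally have div: "partial s p1 gx + partial s p0 gz + partial s b gt = 0" .
  have "ruppert_map s es f g = (\<Sum>i<3. g i * partial s (es ! i) f)" by (simp add: ruppert_map_def es(2))
  also have "\<dots> = (\<Sum>i<3. fscale (X (es ! i)) (g i) * partial s p1 f + fscale (Z (es ! i)) (g i) * partial s p0 f
      + fscale (T (es ! i)) (g i) * partial s b f)"
  proof (rule sum.cong[OF refl])
    fix i :: nat assume "i \<in> {..<3}"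
    then have "i < 3" by simp
    show "g i * partial s (es ! i) f = fscale (X (es ! i)) (g i) * partial s p1 f + fscale (Z (es ! i)) (g i) * partial s p0 f
      + fscale (T (es ! i)) (g i) * partial s b f"
      unfolding dir[OF \<open>i < 3\<close> f] by (rule ext) (simp add: fun_simps algebra_simps)
  qed
  also have "\<dots> = gx * partial s p1 f + gz * partial s p0 f + gt * partial s b f"
    unfolding gx_def gz_def gt_def by (simp add: sum.distrib sum_distrib_right)
  finally have tan: "gx * partial s p1 f + gz * partial s p0 f + gt * partial s b f = 0" using kernel by simp
  have zero: "gx = 0 \<and> gz = 0 \<and> gt = 0"
    by (rule tangent_fields_irreducible[OF f d fp1 sep irred mem div tan])
  have gi: "g i v = 0" if i: "i < 3" for i v
  proof -
    have c: "\<phi> (\<Sum>j<3. s (g j v) (es ! j)) = (\<Sum>j<3. fscale (\<phi> (es ! j)) (g j)) v" if "\<phi> \<in> dual s W" for \<phi>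
    proof -
      have "\<phi> (\<Sum>j<3. s (g j v) (es ! j)) = (\<Sum>j<3. \<phi> (s (g j v) (es ! j)))"
        using em by (intro dual_sum[OF that]) (auto simp: mem_scale)
      then show ?thesis using em by (simp add: dual_scale[OF that] fun_sum_apply fun_simps mult.commute)
    qed
    have "(\<Sum>j<3. s (g j v) (es ! j)) \<in> W" using em by (intro mem_sum mem_scale) auto
    from coords[OF this] have "(\<Sum>j<3. s (g j v) (es ! j)) = 0"
      using c[OF XZT(1)] c[OF XZT(2)] c[OF XZT(3)] zero
      unfolding gx_def gz_def gt_def by (simp add: zero_fun_apply)
    then have "coord es i 0 = g i v"
      using coord_of_sum[OF es(1), of i "\<lambda>j. g j v"] es(2) i by simp
    then show ?thesis using dual_0[OF coord_dual[OF es(1)]] by simp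
  qed
  show ?thesis
  proof (rule ext)
    fix i
    have z: "(0 :: nat \<Rightarrow> 'a \<Rightarrow> complex) i = 0" by (rule zero_fun_apply)
    show "g i = 0 i"
    proof (cases "i < 3")
      case True
      show ?thesis unfolding z by (rule ext) (simp add: gi[OF True] zero_fun_apply)
    next
      case False
      then show ?thesis unfolding z using g es(2) by (simp add: sl_space_def)
    qed
  qed
qed

end

section \<open>The rank of the Ruppert map\<close>

context cspace
begin

text \<open>Exchange of two basis vectors.\<close>

lemma complete_basis:
  assumes es: "ordered_basis s W es" "length es = 3" and p: "p1 \<in> W" "p0 \<in> W" and ind: "S.independent {p1, p0}" "p1 \<noteq> p0"
  shows "\<exists>b\<in>W. ordered_basis s W [p1, p0, b]"
proof -
  have e: "S.independent (set es)" "S.span (set es) = W" "card (set es) = 3"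
    using es by (auto simp: ordered_basis_def distinct_card)
  have "\<not> set es \<subseteq> S.span {p1, p0}"
  proof
    assume "set es \<subseteq> S.span {p1, p0}"
    then have "card (set es) \<le> card {p1, p0}"
      using S.independent_span_bound[OF _ e(1), of "{p1, p0}"] by simp
    also have "\<dots> \<le> 2" by (simp add: card_insert_if)
    finally show False using e(3) by simp
  qed
  then obtain b where b: "b \<in> set es" "b \<notin> S.span {p1, p0}" by blast
  have bW: "b \<in> W" using b(1) e(2) S.span_base by blast
  have ib: "S.independent {b, p1, p0}" using ind(1) b(2) by (simp add: S.independent_insertI)
  have nb: "b \<noteq> p1" "b \<noteq> p0" using b(2) S.span_base by blast+
  have span: "W \<subseteq> S.span {b, p1, p0}"
  proof (rule ccontr)
    assume "\<not> W \<subseteq> S.span {b, p1, p0}"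
    then obtain c where c: "c \<in> W" "c \<notin> S.span {b, p1, p0}" by blast
    have "S.independent {c, b, p1, p0}" by (rule S.independent_insertI[OF c(2) ib])
    moreover have "{c, b, p1, p0} \<subseteq> S.span (set es)" using c(1) bW p e(2) by auto
    ultimately have "card {c, b, p1, p0} \<le> card (set es)"
      using S.independent_span_bound[of "set es"] by blast
    moreover have "c \<noteq> b" "c \<noteq> p1" "c \<noteq> p0"
      using c(2) S.span_base[of _ "{b, p1, p0}"] by auto
    ultimately show False using nb ind(2) e(3) by simp
  qed
  have "S.span {b, p1, p0} \<subseteq> W" using bW p sub by (intro S.span_minimal) auto
  moreover have "set [p1, p0, b] = {b, p1, p0}" by auto
  ultimately have "ordered_basis s W [p1, p0, b]"
    using span ib nb ind(2) unfolding ordered_basis_def by auto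
  then show ?thesis using bW by blast
qed

lemma separable_line_independent:
  assumes f: "f \<in> forms s W d" and d: "2 \<le> d" and p1: "p1 \<in> W" and fp1: "f p1 \<noteq> 0"
    and sep: "card {x. f (s x p1 + p0) = 0} = d"
  shows "S.independent {p1, p0}" "p1 \<noteq> p0"
proof -
  have "p1 \<noteq> 0"
  proof
    assume "p1 = 0"
    then show False using forms_homogeneous[OF f p1, of 0] fp1 d by (auto simp: power_0_left split: if_splits)
  qed
  have ns: "p0 \<notin> S.span {p1}"
  proof
    assume "p0 \<in> S.span {p1}"
    then obtain c where c: "p0 = s c p1" by (auto simp: S.span_singleton)
    have "{x. f (s x p1 + p0) = 0} \<subseteq> {- c}"
    proof
      fix x assume "x \<in> {x. f (s x p1 + p0) = 0}"
      then have "f (s (x + c) p1) = 0" by (simp add: c S.scale_left_distrib)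
      then have "x + c = 0" using forms_homogeneous[OF f p1, of "x + c"] fp1 by simp
      then show "x \<in> {- c}" by (simp add: add_eq_0_iff2)
    qed
    then have "card {x. f (s x p1 + p0) = 0} \<le> card {- c}" by (intro card_mono) auto
    then show False using sep d by simp
  qed
  then show "p1 \<noteq> p0" using S.span_base by blast
  have "S.independent {p1}" using \<open>p1 \<noteq> 0\<close> by simp
  then have "S.independent {p0, p1}" using ns by (simp add: S.independent_insertI)
  then show "S.independent {p1, p0}" by (simp add: insert_commute)
qed

text \<open>
  Ruppert's criterion.  A factorization provides a Hamiltonian field in the kernel.  If \<open>f\<close> is
  irreducible, some line \<open>p\<^sub>1\<close>, \<open>p\<^sub>0\<close> meets \<open>f = 0\<close> in distinct points, and in a basis containing
  \<open>p\<^sub>1\<close> and \<open>p\<^sub>0\<close> the fields of the kernel are seen to vanish.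
\<close>

theorem ruppert_criterion:
  assumes es: "ordered_basis s W es" "length es = 3" and f: "f \<in> forms s W d" and d: "3 \<le> d"
  shows "reducible s W d f \<longleftrightarrow> (\<exists>g\<in>sl_space s W es (d - 2). g \<noteq> 0 \<and> ruppert_map s es f g = 0)"
proof
  assume red: "reducible s W d f"
  define p1 p0 b where "p1 = es ! 0" and "p0 = es ! 1" and "b = es ! 2"
  have es3: "es = [p1, p0, b]" using list3[OF es(2)] by (simp add: p1_def p0_def b_def)
  obtain X Z T where "cspace3 s W p1 p0 b X Z T" using cspace3_of_basis es(1) es3 by blast
  then interpret C: cspace3 s W p1 p0 b X Z T .
  obtain gx gz gt where g: "gx \<in> forms s W (d - 2)" "gz \<in> forms s W (d - 2)" "gt \<in> forms s W (d - 2)"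
     "partial s p1 gx + partial s p0 gz + partial s b gt = 0"
     "gx * partial s p1 f + gz * partial s p0 f + gt * partial s b f = 0" "(gx, gz, gt) \<noteq> (0, 0, 0)"
    using C.tangent_field_reducible[OF red d] by blast
  define g' where "g' = (\<lambda>n. if n = 0 then gx else if n = 1 then gz else if n = (2::nat) then gt else 0)"
  have g': "g' 0 = gx" "g' 1 = gz" "g' 2 = gt" "\<forall>i\<ge>3. g' i = 0" by (simp_all add: g'_def)
  have "g' \<in> sl_space s W es (d - 2)" unfolding es3 C.mem_sl using g g' by simp
  moreover have "g' \<noteq> 0"
  proof
    assume "g' = 0"
    then have "g' i = 0" for i by (simp add: zero_fun_apply)
    then show False using g(6) g'(1-3) by simp
  qed
  moreover have "ruppert_map s es f g' = 0"
    using g(5) g' by (simp add: ruppert_map_def es3 add.assoc numeral_2_eq_2)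
  ultimately show "\<exists>g\<in>sl_space s W es (d - 2). g \<noteq> 0 \<and> ruppert_map s es f g = 0" by blast
next
  assume ex: "\<exists>g\<in>sl_space s W es (d - 2). g \<noteq> 0 \<and> ruppert_map s es f g = 0"
  show "reducible s W d f"
  proof (rule ccontr)
    assume irred: "\<not> reducible s W d f"
    have "f \<noteq> 0"
    proof
      assume "f = 0"
      then have "f = 0 * 0" by simp
      then have "reducible s W d f"
        unfolding reducible_def using d forms_zero by (intro exI[of _ 1] exI[of _ 0]) simp
      then show False using irred by blast
    qed
    then obtain p1 where fp1: "f p1 \<noteq> 0" by (metis ext zero_fun_apply)
    then have p1: "p1 \<in> W" using forms_outside[OF f] by blast
    obtain p0 where p0: "p0 \<in> W" "card {x. f (s x p1 + p0) = 0} = d"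
      using exists_separable_line[OF f _ p1 fp1 line_poly_const[of 1] mem_0 _ irred] d by auto
    have d2: "2 \<le> d" using d by simp
    obtain b where b: "b \<in> W" "ordered_basis s W [p1, p0, b]"
      using complete_basis[OF es p1 p0(1) separable_line_independent[OF f d2 p1 fp1 p0(2)]] by blast
    obtain X Z T where "cspace3 s W p1 p0 b X Z T" using cspace3_of_basis b(2) by blast
    then interpret C: cspace3 s W p1 p0 b X Z T .
    show False using ex C.ruppert_kernel_irreducible[OF es f d2 fp1 p0(2) irred] by blast
  qed
qed

end

section \<open>Maximal minors of the matrix of the Ruppert map\<close>

lemma submatrix_eq:
  assumes "A \<in> carrier_mat n m" "I \<subseteq> {..<n}" "card I = r" "J \<subseteq> {..<m}" "card J = r"
  shows "submatrix A I J = mat r r (\<lambda>(i, j). A $$ (pick I i, pick J j))"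
proof -
  have "{i. i < dim_row A \<and> i \<in> I} = I" "{j. j < dim_col A \<and> j \<in> J} = J" using assms by auto
  then show ?thesis using assms unfolding submatrix_def by simp
qed

lemma pick_lessThan: "j < m \<Longrightarrow> pick {..<m} j = j"
proof -
  assume j: "j < m"
  then have "{a \<in> {..<m}. a < j} = {..<j}" by auto
  then show ?thesis using pick_card_in_set[of j "{..<m}"] j by simp
qed

lemma maximal_minors_zero_iff:
  fixes A :: "complex mat"
  assumes A: "A \<in> carrier_mat n m"
  shows "(\<forall>I J. I \<subseteq> {..<n} \<and> card I = m \<and> J \<subseteq> {..<m} \<and> card J = m \<longrightarrow> Determinant.det (submatrix A I J) = 0)
    \<longleftrightarrow> (\<exists>x. (\<exists>j<m. x j \<noteq> 0) \<and> (\<forall>i<n. (\<Sum>j<m. A $$ (i, j) * x j) = 0))" (is "?L \<longleftrightarrow> ?R")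
proof
  assume L: ?L
  show ?R
  proof (rule ccontr)
    assume no: "\<not> ?R"
    then have "\<And>x. (\<forall>i<n. (\<Sum>j<m. A $$ (i, j) * x j) = 0) \<Longrightarrow> (\<forall>j<m. x j = 0)" by blast
    from exists_maximal_minor[where A = "\<lambda>i j. A $$ (i, j)" and n = n and m = m, OF this]
    obtain I where I: "I \<subseteq> {..<n}" "card I = m" "Determinant.det (mat m m (\<lambda>(i, j). A $$ (pick I i, j))) \<noteq> 0"
      by blast
    have "submatrix A I {..<m} = mat m m (\<lambda>(i, j). A $$ (pick I i, pick {..<m} j))"
      using A I by (intro submatrix_eq) auto
    also have "\<dots> = mat m m (\<lambda>(i, j). A $$ (pick I i, j))"
      by (rule cong_mat) (auto simp: pick_lessThan)
    finally have "Determinant.det (submatrix A I {..<m}) \<noteq> 0" using I(3) by simp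
    then show False using L I(1,2) by auto
  qed
next
  assume ?R
  then obtain x where x: "\<exists>j<m. x j \<noteq> 0" "\<forall>i<n. (\<Sum>j<m. A $$ (i, j) * x j) = 0" by blast
  show ?L
  proof (intro allI impI)
    fix I J assume IJ: "I \<subseteq> {..<n} \<and> card I = m \<and> J \<subseteq> {..<m} \<and> card J = m"
    then have J: "J = {..<m}" by (intro card_subset_eq) auto
    define N where "N = submatrix A I J"
    have N: "N = mat m m (\<lambda>(i, j). A $$ (pick I i, j))"
    proof -
      have "N = mat m m (\<lambda>(i, j). A $$ (pick I i, pick J j))"
        unfolding N_def using A IJ by (intro submatrix_eq) auto
      also have "\<dots> = mat m m (\<lambda>(i, j). A $$ (pick I i, j))"
        by (rule cong_mat) (auto simp: pick_lessThan J)
      finally show ?thesis .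
    qed
    have Nc: "N \<in> carrier_mat m m" by (simp add: N)
    define v where "v = vec m x"
    have v: "v \<in> carrier_vec m" by (simp add: v_def)
    obtain j0 where j0: "j0 < m" "x j0 \<noteq> 0" using x(1) by blast
    have v0: "v \<noteq> 0\<^sub>v m"
    proof
      assume "v = 0\<^sub>v m"
      then have "vec_index v j0 = vec_index (0\<^sub>v m) j0" by simp
      then show False using j0 by (simp add: v_def)
    qed
    have "N *\<^sub>v v = 0\<^sub>v m"
    proof (rule eq_vecI)
      fix i assume "i < dim_vec (0\<^sub>v m :: complex vec)"
      then have i: "i < m" by simp
      have "pick I i \<in> I" using i IJ by (intro pick_in_set_le) simp
      then have "pick I i < n" using IJ by auto
      then have "(\<Sum>j<m. A $$ (pick I i, j) * x j) = 0" using x(2) by blast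
      then show "vec_index (N *\<^sub>v v) i = vec_index (0\<^sub>v m) i"
        using i by (simp add: N v_def scalar_prod_def atLeast0LessThan)
    qed (simp add: N)
    then show "Determinant.det (submatrix A I J) = 0"
      using det_0_iff_vec_prod_zero_field[OF Nc] v v0 unfolding N_def by blast
  qed
qed

lemma ruppert_map_sum:
  "ruppert_map s es F (\<Sum>j\<in>J. pointwise fscale (x j) (g j)) = (\<Sum>j\<in>J. fscale (x j) (ruppert_map s es F (g j)))"
proof (induction J rule: infinite_finite_induct)
  case (insert j J)
  have "ruppert_map s es F (pointwise fscale (x j) (g j) + h) = fscale (x j) (ruppert_map s es F (g j)) + ruppert_map s es F h" for h
  proof -
    have "ruppert_map s es F (pointwise fscale (x j) (g j) + h)
      = (\<Sum>i<length es. fscale (x j) (g j i * partial s (es ! i) F) + h i * partial s (es ! i) F)"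
      unfolding ruppert_map_def
    proof (rule sum.cong[OF refl])
      fix i
      have 1: "(pointwise fscale (x j) (g j) + h) i = fscale (x j) (g j i) + h i"
        by (simp add: plus_fun_apply pointwise_def[of fscale])
      show "(pointwise fscale (x j) (g j) + h) i * partial s (es ! i) F = fscale (x j) (g j i * partial s (es ! i) F) + h i * partial s (es ! i) F"
        unfolding 1 by (rule ext) (simp add: fun_simps algebra_simps)
    qed
    then show ?thesis by (simp add: ruppert_map_def sum.distrib FS.scale_sum_right)
  qed
  then show ?case using insert by simp
next
  case empty
  have z: "(0 :: nat \<Rightarrow> 'a \<Rightarrow> complex) i = 0" for i by (rule zero_fun_apply)
  show ?case by (simp add: ruppert_map_def z)
next
  case (infinite J)
  have z: "(0 :: nat \<Rightarrow> 'a \<Rightarrow> complex) i = 0" for i by (rule zero_fun_apply)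
  show ?case using infinite by (simp add: ruppert_map_def z)
qed

context cspace
begin

lemma ruppert_map_forms:
  assumes es: "ordered_basis s W es" and f: "f \<in> forms s W d" and d: "1 \<le> d" and g: "g \<in> sl_space s W es e"
  shows "ruppert_map s es f g \<in> forms s W (e + d - 1)"
  unfolding ruppert_map_def
proof (rule forms_sum)
  fix i assume "i \<in> {..<length es}"
  then have "g i \<in> forms s W e" "partial s (es ! i) f \<in> forms s W (d - 1)"
    using g partial_forms[OF basis_mem[OF es] f] by (auto simp: sl_space_def)
  from forms_mult[OF this] show "g i * partial s (es ! i) f \<in> forms s W (e + d - 1)" using d by simp
qed

lemma sl_cspace_basis:
  assumes "ordered_basis s W es" "length es = 3"
  shows "cspace (pointwise fscale) (sl_space s W es e)"
    and "1 \<le> e \<Longrightarrow> \<exists>bs. ordered_basis (pointwise fscale) (sl_space s W es e) bs"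
    and "1 \<le> e \<Longrightarrow> ordered_basis (pointwise fscale) (sl_space s W es e) bs \<Longrightarrow> length bs = (e + 1) * (e + 3)"
proof -
  have es3: "es = [es ! 0, es ! 1, es ! 2]" using list3[OF assms(2)] .
  obtain X Z T where C: "cspace3 s W (es ! 0) (es ! 1) (es ! 2) X Z T" using cspace3_of_basis assms(1) es3 by metis
  show "cspace (pointwise fscale) (sl_space s W es e)" using cspace3.sl_cspace[OF C] es3 by metis
  show "1 \<le> e \<Longrightarrow> \<exists>bs. ordered_basis (pointwise fscale) (sl_space s W es e) bs"
    using cspace3.sl_basis_length(1)[OF C] es3 by metis
  show "1 \<le> e \<Longrightarrow> ordered_basis (pointwise fscale) (sl_space s W es e) bs \<Longrightarrow> length bs = (e + 1) * (e + 3)"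
    using cspace3.sl_basis_length(2)[OF C] es3 by metis
qed

lemma forms_cspace: "cspace fscale (forms s W k)"
  by unfold_locales (rule subspace_forms)

lemma exists_ruppert_bases:
  assumes es: "ordered_basis s W es" "length es = 3" and e: "1 \<le> e"
  shows "\<exists>bs cs. ruppert_bases s W d e es bs cs"
proof -
  obtain bs where "ordered_basis (pointwise fscale) (sl_space s W es e) bs" using sl_cspace_basis(2)[OF es e] by blast
  moreover obtain D where "finite D" "forms s W (e + d - 1) \<subseteq> FS.span D" using forms_finitely_spanned[OF es(1)] by blast
  then have "\<exists>cs. ordered_basis fscale (forms s W (e + d - 1)) cs"
    by (rule cspace.exists_ordered_basis[OF forms_cspace])
  ultimately show ?thesis using es(1) by (auto simp: ruppert_bases_def)
qed

lemma square_minus_1: "3 \<le> d \<Longrightarrow> (d - 2 + 1) * (d - 2 + 3) = d\<^sup>2 - (1::nat)"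
proof -
  assume "3 \<le> d"
  then obtain k where "d = k + 3" by (metis add.commute le_Suc_ex)
  then show ?thesis by (simp add: power2_eq_square algebra_simps)
qed

text \<open>
  As the Ruppert map has a source of dimension \<open>d\<^sup>2 - 1\<close>, its minors of this size are maximal and all
  vanish if and only if it is not injective.
\<close>

lemma ruppert_minors_zero_iff:
  assumes b: "ruppert_bases s W d (d - 2) es bs cs" and es: "length es = 3" and d: "3 \<le> d" and f: "f \<in> forms s W d"
  shows "(\<forall>I J. I \<subseteq> {..<length cs} \<and> card I = d\<^sup>2 - 1 \<and> J \<subseteq> {..<length bs} \<and> card J = d\<^sup>2 - 1
      \<longrightarrow> Determinant.det (submatrix (matrix_wrt (ruppert_map s es f) bs cs) I J) = 0)
    \<longleftrightarrow> reducible s W d f"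
proof -
  let ?e = "d - 2"
  let ?\<rho> = "ruppert_map s es f"
  let ?M = "matrix_wrt ?\<rho> bs cs"
  define m where "m = ?e + d - 1"
  have ob: "ordered_basis s W es" "ordered_basis (pointwise fscale) (sl_space s W es ?e) bs"
    "ordered_basis fscale (forms s W m) cs" using b unfolding ruppert_bases_def m_def by blast+
  have e: "1 \<le> ?e" using d by simp
  interpret L: cspace "pointwise fscale" "sl_space s W es ?e" by (rule sl_cspace_basis(1)[OF ob(1) es])
  interpret C: cspace fscale "forms s W m" by (rule forms_cspace)
  have len: "length bs = d\<^sup>2 - 1" using sl_cspace_basis(3)[OF ob(1) es e ob(2)] square_minus_1[OF d] by simp
  define r where "r = length bs"
  have M: "?M \<in> carrier_mat (length cs) r" by (simp add: matrix_wrt_def r_def)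
  have \<rho>: "?\<rho> g \<in> forms s W m" if "g \<in> sl_space s W es ?e" for g
    unfolding m_def using d by (intro ruppert_map_forms[OF ob(1) f _ that]) simp
  have bsm: "bs ! j \<in> sl_space s W es ?e" if "j < r" for j using L.basis_mem[OF ob(2)] that by (simp add: r_def)
  define u where "u x = (\<Sum>j<r. pointwise fscale (x j) (bs ! j))" for x
  have u: "u x \<in> sl_space s W es ?e" for x unfolding u_def using bsm by (intro L.mem_sum L.mem_scale) auto
  have entries: "(\<Sum>j<r. ?M $$ (i, j) * x j) = C.coord cs i (?\<rho> (u x))" if i: "i < length cs" for i x
  proof -
    have rm: "fscale (x j) (?\<rho> (bs ! j)) \<in> forms s W m" if "j \<in> {..<r}" for j
      using that by (intro forms_scale \<rho> bsm) simp
    have "C.coord cs i (?\<rho> (u x)) = C.coord cs i (\<Sum>j<r. fscale (x j) (?\<rho> (bs ! j)))"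
      unfolding u_def ruppert_map_sum ..
    also have "\<dots> = (\<Sum>j<r. C.coord cs i (fscale (x j) (?\<rho> (bs ! j))))"
      by (rule C.dual_sum[OF C.coord_dual[OF ob(3)] finite_lessThan rm])
    also have "\<dots> = (\<Sum>j<r. x j * C.coord cs i (?\<rho> (bs ! j)))"
      using \<rho>[OF bsm] by (intro sum.cong) (simp_all add: C.dual_scale[OF C.coord_dual[OF ob(3)]])
    also have "\<dots> = (\<Sum>j<r. ?M $$ (i, j) * x j)"
      using \<rho>[OF bsm] i by (intro sum.cong) (simp_all add: matrix_wrt_def C.coord_def r_def)
    finally show ?thesis by simp
  qed
  have "(\<exists>x. (\<exists>j<r. x j \<noteq> 0) \<and> (\<forall>i<length cs. (\<Sum>j<r. ?M $$ (i, j) * x j) = 0))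
    \<longleftrightarrow> (\<exists>g\<in>sl_space s W es ?e. g \<noteq> 0 \<and> ?\<rho> g = 0)" (is "?L \<longleftrightarrow> ?R")
  proof
    assume ?L
    then obtain x j where x: "j < r" "x j \<noteq> 0" "\<forall>i<length cs. (\<Sum>j<r. ?M $$ (i, j) * x j) = 0" by blast
    have "?\<rho> (u x) = 0"
      using x(3) entries by (intro C.zero_if_coords_zero[OF ob(3) \<rho>[OF u]]) simp
    moreover have "u x \<noteq> 0"
    proof
      assume "u x = 0"
      then have "x j = L.coord bs j 0"
        using L.coord_of_sum[OF ob(2), of j x] x(1) by (simp add: u_def r_def)
      then show False using L.dual_0[OF L.coord_dual[OF ob(2)]] x(2) by simp
    qed
    ultimately show ?R using u by blast
  next
    assume ?R
    then obtain g where g: "g \<in> sl_space s W es ?e" "g \<noteq> 0" "?\<rho> g = 0" by blast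
    define x where "x j = L.coord bs j g" for j
    have gu: "g = u x" unfolding u_def x_def r_def by (rule L.coord_sum[OF ob(2) g(1)])
    have "\<exists>j<r. x j \<noteq> 0" using g(2) L.zero_if_coords_zero[OF ob(2) g(1)] by (auto simp: x_def r_def)
    moreover have "\<forall>i<length cs. (\<Sum>j<r. ?M $$ (i, j) * x j) = 0"
      using entries g(3) gu C.dual_0[OF C.coord_dual[OF ob(3)]] by simp
    ultimately show ?L by blast
  qed
  then show ?thesis
    using maximal_minors_zero_iff[OF M] ruppert_criterion[OF ob(1) es f d] len by (simp add: r_def)
qed

lemma det_forms:
  assumes "\<And>i j. i < r \<Longrightarrow> j < r \<Longrightarrow> \<phi> i j \<in> dual s W"
  shows "restr W (\<lambda>x. Determinant.det (mat r r (\<lambda>(i, j). \<phi> i j x))) \<in> forms s W r"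
proof -
  have "restr W (\<lambda>x. Determinant.det (mat r r (\<lambda>(i, j). \<phi> i j x)))
    = (\<Sum>\<pi>\<in>{\<pi>. \<pi> permutes {0..<r}}. fscale (signof \<pi>) (restr W (\<lambda>x. \<Prod>i<r. \<phi> i (\<pi> i) x)))"
  proof (rule ext)
    fix x
    have "(\<Prod>i = 0..<r. mat r r (\<lambda>(i, j). \<phi> i j x) $$ (i, \<pi> i)) = (\<Prod>i<r. \<phi> i (\<pi> i) x)"
      if "\<pi> permutes {0..<r}" for \<pi>
      unfolding atLeast0LessThan using permutes_in_image[OF that] by (intro prod.cong) auto
    then show "restr W (\<lambda>x. Determinant.det (mat r r (\<lambda>(i, j). \<phi> i j x))) x
      = (\<Sum>\<pi>\<in>{\<pi>. \<pi> permutes {0..<r}}. fscale (signof \<pi>) (restr W (\<lambda>x. \<Prod>i<r. \<phi> i (\<pi> i) x))) x"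
      by (simp add: fun_sum_apply fun_simps det_def'[of _ r] cong: sum.cong_simp)
  qed
  also have "\<dots> \<in> forms s W r"
  proof (intro forms_sum forms_scale forms_gen)
    fix \<pi> i assume "\<pi> \<in> {\<pi>. \<pi> permutes {0..<r}}" "i < r"
    then show "\<phi> i (\<pi> i) \<in> dual s W" using permutes_in_image[of \<pi> "{0..<r}" i] by (intro assms) auto
  qed
  finally show ?thesis .
qed

text \<open>The entries of the matrix are linear in \<open>f\<close>, so a minor of size \<open>r\<close> is a form of degree \<open>r\<close> in \<open>f\<close>.\<close>

lemma minor_forms:
  assumes E: "S.subspace E" "E \<subseteq> W" and b: "ruppert_bases s E d e es bs cs" and d: "1 \<le> d"
    and IJ: "I \<subseteq> {..<length cs}" "card I = r" "J \<subseteq> {..<length bs}" "card J = r"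
  shows "restr (forms s W d) (\<lambda>f. Determinant.det (submatrix (matrix_wrt (ruppert_map s es (restr E f)) bs cs) I J))
    \<in> forms fscale (forms s W d) r"
proof -
  interpret E: cspace s E by unfold_locales (use vs E in auto)
  interpret F: cspace fscale "forms s W d" by (rule forms_cspace)
  define m where "m = e + d - 1"
  have ob: "ordered_basis s E es" "ordered_basis (pointwise fscale) (sl_space s E es e) bs"
    "ordered_basis fscale (forms s E m) cs" using b unfolding ruppert_bases_def m_def by blast+
  interpret C: cspace fscale "forms s E m" by (rule E.forms_cspace)
  let ?M = "\<lambda>f. matrix_wrt (ruppert_map s es (restr E f)) bs cs"
  define \<phi> where "\<phi> i j = restr (forms s W d) (\<lambda>f. ?M f $$ (pick I i, pick J j))" for i j
  have M: "?M f \<in> carrier_mat (length cs) (length bs)" for f by (simp add: matrix_wrt_def)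
  have "restr (forms s W d) (\<lambda>f. Determinant.det (submatrix (?M f) I J))
      = restr (forms s W d) (\<lambda>f. Determinant.det (mat r r (\<lambda>(i, j). \<phi> i j f)))"
  proof (rule ext)
    fix f
    show "restr (forms s W d) (\<lambda>f. Determinant.det (submatrix (?M f) I J)) f
      = restr (forms s W d) (\<lambda>f. Determinant.det (mat r r (\<lambda>(i, j). \<phi> i j f))) f"
      using submatrix_eq[OF M IJ] by (simp add: restr_apply \<phi>_def)
  qed
  also have "\<dots> \<in> forms fscale (forms s W d) r"
  proof (rule F.det_forms)
    fix i j assume "i < r" "j < r"
    then have "pick I i \<in> I" "pick J j \<in> J" using IJ by (auto intro!: pick_in_set_le)
    then have ij: "pick I i < length cs" "pick J j < length bs" using IJ by auto
    define g where "g = bs ! pick J j"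
    interpret PS: vector_space "pointwise fscale :: complex \<Rightarrow> (nat \<Rightarrow> 'a \<Rightarrow> complex) \<Rightarrow> nat \<Rightarrow> 'a \<Rightarrow> complex"
      by (rule vector_space_pointwise[OF vector_space_fscale])
    have "set bs \<subseteq> sl_space s E es e"
      using ob(2) PS.span_superset[of "set bs"] by (simp add: ordered_basis_def)
    then have g: "g \<in> sl_space s E es e" using ij(2) by (auto simp: g_def)
    have gi: "g k \<in> forms s E e" if "k < length es" for k using g that by (simp add: sl_space_def)
    have entry: "?M f $$ (pick I i, pick J j) = C.coord cs (pick I i) (ruppert_map s es (restr E f) g)"
      if f: "f \<in> forms s W d" for f
      using ij E.ruppert_map_forms[OF ob(1) forms_restrict[OF E f] d g, folded m_def]
      by (simp add: matrix_wrt_def C.coord_def g_def)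
    have em: "es ! k \<in> E" if "k < length es" for k using E.basis_mem[OF ob(1) that] .
    show "\<phi> i j \<in> dual fscale (forms s W d)"
      unfolding dual_def mem_Collect_eq
    proof (intro conjI ballI allI impI)
      fix f h assume f: "f \<in> forms s W d" and h: "h \<in> forms s W d"
      have r: "restr E (f + h) = restr E f + restr E h" by (rule ext) (simp add: fun_simps)
      have "ruppert_map s es (restr E (f + h)) g = ruppert_map s es (restr E f) g + ruppert_map s es (restr E h) g"
        unfolding ruppert_map_def r sum.distrib[symmetric]
        using E.partial_add[OF em forms_restrict[OF E f] forms_restrict[OF E h]]
        by (intro sum.cong) (simp_all add: distrib_left)
      then show "\<phi> i j (f + h) = \<phi> i j f + \<phi> i j h"
        using C.dual_add[OF C.coord_dual[OF ob(3)] E.ruppert_map_forms[OF ob(1) forms_restrict[OF E f] d g, folded m_def]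
          E.ruppert_map_forms[OF ob(1) forms_restrict[OF E h] d g, folded m_def]] entry[OF f] entry[OF h] entry[OF forms_add[OF f h]]
          f h forms_add[OF f h]
        by (simp add: \<phi>_def restr_apply)
    next
      fix c f assume f: "f \<in> forms s W d"
      have r: "restr E (fscale c f) = fscale c (restr E f)" by (rule ext) (simp add: fun_simps)
      have "ruppert_map s es (restr E (fscale c f)) g = fscale c (ruppert_map s es (restr E f) g)"
        unfolding ruppert_map_def r FS.scale_sum_right
      proof (rule sum.cong[OF refl])
        fix k assume "k \<in> {..<length es}"
        then have k: "k < length es" by simp
        show "g k * partial s (es ! k) (fscale c (restr E f)) = fscale c (g k * partial s (es ! k) (restr E f))"
          unfolding E.partial_scale[OF em[OF k] forms_restrict[OF E f]] by (rule ext) (simp add: fun_simps)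
      qed
      then show "\<phi> i j (fscale c f) = c * \<phi> i j f"
        using C.dual_scale[OF C.coord_dual[OF ob(3)] E.ruppert_map_forms[OF ob(1) forms_restrict[OF E f] d g, folded m_def]]
          entry[OF f] entry[OF forms_scale[OF f]] f forms_scale[OF f]
        by (simp add: \<phi>_def restr_apply)
    next
      fix f assume "f \<notin> forms s W d"
      then show "\<phi> i j f = 0" by (simp add: \<phi>_def restr_apply)
    qed
  qed
  finally show ?thesis .
qed

lemma reducible_restrict:
  assumes "S.subspace E" "E \<subseteq> W" "reducible s W d f"
  shows "reducible s E d (restr E f)"
proof -
  obtain k g h where k: "1 \<le> k" "k \<le> d - 1" "g \<in> forms s W k" "h \<in> forms s W (d - k)" "f = g * h"
    using assms(3) unfolding reducible_def by blast
  have "restr E f = restr E g * restr E h" unfolding k(5) by (rule ext) (simp add: fun_simps)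
  then show ?thesis
    unfolding reducible_def using k forms_restrict[OF assms(1,2)] by blast
qed

lemma reducible_scale:
  assumes "reducible s W d f"
  shows "reducible s W d (fscale c f)"
proof -
  obtain k g h where k: "1 \<le> k" "k \<le> d - 1" "g \<in> forms s W k" "h \<in> forms s W (d - k)" "f = g * h"
    using assms unfolding reducible_def by blast
  have "fscale c f = fscale c g * h" unfolding k(5) by (rule ext) (simp add: fun_simps)
  then show ?thesis unfolding reducible_def using k forms_scale[OF k(3)] by blast
qed

lemma reducible_zero: "2 \<le> d \<Longrightarrow> reducible s W d 0"
  unfolding reducible_def using forms_zero by (intro exI[of _ 1] exI[of _ 0]) simp

section \<open>The coordinate ring\<close>

lemma polys_subspace: "FS.subspace (polys s W)"
  unfolding polys_def by (rule FS.subspace_span)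

lemma forms_polys: "forms s W k \<subseteq> polys s W"
  unfolding polys_def by (intro subsetI FS.span_base UN_I[OF UNIV_I])

lemma polys_mult: "x \<in> polys s W \<Longrightarrow> y \<in> polys s W \<Longrightarrow> x * y \<in> polys s W"
proof -
  assume "x \<in> polys s W" "y \<in> polys s W"
  then have "x * y \<in> FS.span {a * b | a b. a \<in> (\<Union>k. forms s W k) \<and> b \<in> (\<Union>k. forms s W k)}"
    unfolding polys_def by (rule span_mult)
  also have "\<dots> \<subseteq> polys s W"
    using forms_mult forms_polys by (intro FS.span_minimal polys_subspace) blast
  finally show ?thesis .
qed

lemma polys_outside: "x \<in> polys s W \<Longrightarrow> v \<notin> W \<Longrightarrow> x v = 0"
  unfolding polys_def
  by (induction rule: FS.span_induct_alt) (auto simp: fun_simps forms_outside)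

lemma coord_ring_cring: "cring (coord_ring s W)"
proof (rule cringI)
  show "abelian_group (coord_ring s W)"
  proof (rule abelian_groupI)
    fix x assume "x \<in> carrier (coord_ring s W)"
    then have "- x \<in> carrier (coord_ring s W)" "- x + x = 0"
      using FS.subspace_neg[OF polys_subspace] by (auto simp: coord_ring_def)
    then show "\<exists>y\<in>carrier (coord_ring s W). y \<oplus>\<^bsub>coord_ring s W\<^esub> x = \<zero>\<^bsub>coord_ring s W\<^esub>"
      by (intro bexI[of _ "- x"]) (auto simp: coord_ring_def)
  qed (use FS.subspace_add[OF polys_subspace] FS.subspace_0[OF polys_subspace] in \<open>auto simp: coord_ring_def add_ac\<close>)
  show "Group.comm_monoid (coord_ring s W)"
  proof (rule comm_monoidI)
    fix x assume "x \<in> carrier (coord_ring s W)"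
    then have x: "x \<in> polys s W" by (simp add: coord_ring_def)
    have "restr W (\<lambda>_. 1) * x = x" by (rule ext) (auto simp: fun_simps polys_outside[OF x])
    then show "\<one>\<^bsub>coord_ring s W\<^esub> \<otimes>\<^bsub>coord_ring s W\<^esub> x = x" by (simp add: coord_ring_def)
  qed (use polys_mult forms_polys[of 0] forms_one in \<open>auto simp: coord_ring_def mult_ac\<close>)
qed (auto simp: coord_ring_def distrib_right)

lemma vanishing_ideal: "ideal {q \<in> polys s W. q w = 0} (coord_ring s W)" (is "ideal ?V ?R")
proof (rule idealI)
  interpret R: cring ?R by (rule coord_ring_cring)
  show "ring ?R" by (rule R.ring_axioms)
  show "subgroup ?V (add_monoid ?R)"
  proof (rule R.add.subgroupI)
    show "?V \<subseteq> carrier ?R" by (auto simp: coord_ring_def)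
    show "?V \<noteq> {}" using FS.subspace_0[OF polys_subspace] by (auto intro!: exI[of _ 0] simp: fun_simps)
    show "x \<oplus>\<^bsub>?R\<^esub> y \<in> ?V" if "x \<in> ?V" "y \<in> ?V" for x y
      using that FS.subspace_add[OF polys_subspace] by (auto simp: coord_ring_def fun_simps)
    show "\<ominus>\<^bsub>?R\<^esub> x \<in> ?V" if x: "x \<in> ?V" for x
    proof -
      have n: "- x \<in> polys s W" using x FS.subspace_neg[OF polys_subspace] by blast
      have "\<ominus>\<^bsub>?R\<^esub> x = - x"
        using x n by (intro R.minus_equality) (auto simp: coord_ring_def)
      moreover have "(- x) w = 0" using x by simp
      ultimately show ?thesis using n by simp
    qed
  qed
  show "x \<otimes>\<^bsub>?R\<^esub> a \<in> ?V" "a \<otimes>\<^bsub>?R\<^esub> x \<in> ?V" if "a \<in> ?V" "x \<in> carrier ?R" for a x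
    using that polys_mult by (auto simp: coord_ring_def fun_simps)
qed

lemma ideal_sum_vanishing:
  assumes "\<And>I. I \<in> set Is \<Longrightarrow> I \<subseteq> {q \<in> polys s W. q w = 0}"
  shows "ideal_sum (coord_ring s W) Is \<subseteq> {q \<in> polys s W. q w = 0}"
  using assms
proof (induction Is)
  case Nil
  then show ?case using FS.subspace_0[OF polys_subspace] by (auto simp: ideal_sum_def coord_ring_def fun_simps)
next
  case (Cons I Is)
  have "ideal_sum (coord_ring s W) (I # Is) = {a + b | a b. a \<in> I \<and> b \<in> ideal_sum (coord_ring s W) Is}"
    by (auto simp: ideal_sum_def set_add_def set_mult_def coord_ring_def)
  moreover have "I \<subseteq> {q \<in> polys s W. q w = 0}" using Cons.prems by simp
  moreover have "ideal_sum (coord_ring s W) Is \<subseteq> {q \<in> polys s W. q w = 0}"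
    using Cons.prems by (intro Cons.IH) simp
  moreover have "a + b \<in> {q \<in> polys s W. q w = 0}"
    if "a \<in> {q \<in> polys s W. q w = 0}" "b \<in> {q \<in> polys s W. q w = 0}" for a b
    using that FS.subspace_add[OF polys_subspace, of a b] by (simp add: plus_fun_apply)
  ultimately show ?case by (simp only:) (intro subsetI, elim CollectE exE conjE, metis (no_types, lifting) subsetD)
qed

lemma ideal_sum_superset:
  assumes "\<And>I. I \<in> set Is \<Longrightarrow> 0 \<in> I" "I \<in> set Is" "a \<in> I"
  shows "a \<in> ideal_sum (coord_ring s W) Is"
proof -
  have step: "ideal_sum (coord_ring s W) (I # Is) = {a + b | a b. a \<in> I \<and> b \<in> ideal_sum (coord_ring s W) Is}" for I Is
    by (auto simp: ideal_sum_def set_add_def set_mult_def coord_ring_def)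
  have zero: "0 \<in> ideal_sum (coord_ring s W) Is" if "\<And>I. I \<in> set Is \<Longrightarrow> 0 \<in> I" for Is
    using that
  proof (induction Is)
    case Nil
    then show ?case by (simp add: ideal_sum_def coord_ring_def)
  next
    case (Cons I Is)
    then have "0 \<in> I" "0 \<in> ideal_sum (coord_ring s W) Is" by auto
    moreover have "(0 :: 'a \<Rightarrow> complex) = 0 + 0" by simp
    ultimately show ?case unfolding step by blast
  qed
  show ?thesis
    using assms
  proof (induction Is)
    case (Cons J Is)
    show ?case
    proof (cases "I = J")
      case True
      have "a = a + 0" "0 \<in> ideal_sum (coord_ring s W) Is" "a \<in> J"
        using True Cons.prems zero[of Is] by auto
      then show ?thesis unfolding step by blast
    next
      case False
      then have "a \<in> ideal_sum (coord_ring s W) Is" using Cons by auto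
      moreover have "a = 0 + a" "0 \<in> J" using Cons.prems(1) by auto
      ultimately show ?thesis unfolding step by blast
    qed
  qed simp
qed

end

section \<open>Pluecker coordinates of three-dimensional subspaces of the dual\<close>

lemma wedge3:
  "wedge [a, b, c] vs = (if length vs = 3
     then \<Sum>\<pi> | \<pi> permutes {0..<3}. signof \<pi> * (a (vs ! \<pi> 0) * b (vs ! \<pi> 1) * c (vs ! \<pi> 2)) else 0)"
proof (cases "length vs = 3")
  case True
  define A where "A = mat 3 3 (\<lambda>(i, j). ([a, b, c] ! j) (vs ! i))"
  have A: "A \<in> carrier_mat 3 3" by (simp add: A_def)
  have "wedge [a, b, c] vs = Determinant.det A" using True by (simp add: wedge_def A_def numeral_3_eq_3)
  also have "\<dots> = (\<Sum>\<pi> | \<pi> permutes {0..<3}. signof \<pi> * (\<Prod>j<3. A $$ (\<pi> j, j)))" by (rule det_col[OF A])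
  also have "\<dots> = (\<Sum>\<pi> | \<pi> permutes {0..<3}. signof \<pi> * (a (vs ! \<pi> 0) * b (vs ! \<pi> 1) * c (vs ! \<pi> 2)))"
  proof (rule sum.cong[OF refl])
    fix \<pi> :: "nat \<Rightarrow> nat" assume "\<pi> \<in> {\<pi>. \<pi> permutes {0..<3}}"
    then have "\<pi> j < 3" if "j < 3" for j using permutes_in_image[of \<pi> "{0..<3}" j] that by simp
    then have "A $$ (\<pi> j, j) = ([a, b, c] ! j) (vs ! \<pi> j)" if "j < 3" for j using that by (simp add: A_def)
    moreover have "(\<Prod>j<3. A $$ (\<pi> j, j)) = A $$ (\<pi> 0, 0) * A $$ (\<pi> 1, 1) * A $$ (\<pi> 2, 2)"
      by (simp add: numeral_3_eq_3 numeral_2_eq_2 mult.assoc)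
    ultimately show "signof \<pi> * (\<Prod>j<3. A $$ (\<pi> j, j)) = signof \<pi> * (a (vs ! \<pi> 0) * b (vs ! \<pi> 1) * c (vs ! \<pi> 2))"
      by simp
  qed
  finally show ?thesis using True by simp
next
  case False
  then show ?thesis by (simp add: wedge_def)
qed

lemma wedge_linear:
  "wedge [a + fscale t w, b, c] = wedge [a, b, c] + fscale t (wedge [w, b, c])"
  "wedge [a, b + fscale t w, c] = wedge [a, b, c] + fscale t (wedge [a, w, c])"
  "wedge [a, b, c + fscale t w] = wedge [a, b, c] + fscale t (wedge [a, b, w])"
  by (rule ext, simp add: wedge3 fun_simps sum_distrib_left algebra_simps flip: sum.distrib)+

lemma wedge_nonzero_independent:
  assumes us: "length us = 3" and nz: "wedge us vs \<noteq> 0" and z: "(\<Sum>j<3. fscale (x j) (us ! j)) = 0"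
  shows "\<forall>j<3. x j = 0"
proof (rule ccontr)
  assume "\<not> (\<forall>j<3. x j = 0)"
  then obtain j0 where j0: "j0 < 3" "x j0 \<noteq> 0" by blast
  define A where "A = mat 3 3 (\<lambda>(i, j). (us ! j) (vs ! i))"
  have A: "A \<in> carrier_mat 3 3" by (simp add: A_def)
  have len: "length vs = 3" using nz us by (auto simp: wedge_def split: if_splits)
  have "Determinant.det A \<noteq> 0" using nz us len by (simp add: wedge_def A_def)
  moreover have "A *\<^sub>v vec 3 x = 0\<^sub>v 3"
  proof (rule eq_vecI)
    fix i assume "i < dim_vec (0\<^sub>v 3 :: complex vec)"
    then have i: "i < 3" by simp
    have "(\<Sum>j<3. fscale (x j) (us ! j)) (vs ! i) = 0" unfolding z by (simp add: zero_fun_apply)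
    then show "vec_index (A *\<^sub>v vec 3 x) i = vec_index (0\<^sub>v 3) i"
      using i by (simp add: A_def scalar_prod_def atLeast0LessThan fun_sum_apply fun_simps mult.commute)
  qed (simp add: A_def)
  moreover have "vec 3 x \<noteq> 0\<^sub>v 3"
  proof
    assume "vec 3 x = 0\<^sub>v 3"
    then have "vec_index (vec 3 x) j0 = vec_index (0\<^sub>v 3) j0" by simp
    then show False using j0 by simp
  qed
  ultimately show False using det_0_iff_vec_prod_zero_field[OF A] vec_carrier by blast
qed

lemma (in vector_space) independent_list:
  assumes "\<And>x. (\<Sum>j<length us. scale (x j) (us ! j)) = 0 \<Longrightarrow> \<forall>j<length us. x j = 0"
  shows "distinct us \<and> independent (set us)"
proof
  show d: "distinct us"
    unfolding distinct_conv_nth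
  proof (intro allI impI notI)
    fix i j assume ij: "i < length us" "j < length us" "i \<noteq> j" "us ! i = us ! j"
    define x where "x k = (if k = i then 1 else if k = j then - 1 else 0 :: 'a)" for k
    have "(\<Sum>k<length us. scale (x k) (us ! k)) = (\<Sum>k\<in>{i, j}. scale (x k) (us ! k))"
      using ij by (intro sum.mono_neutral_right) (auto simp: x_def)
    also have "\<dots> = 0" using ij by (simp add: x_def)
    finally show False using assms[of x] ij by (auto simp: x_def)
  qed
  show "independent (set us)"
  proof
    assume "dependent (set us)"
    then obtain u where u: "\<exists>v\<in>set us. u v \<noteq> 0" "(\<Sum>v\<in>set us. scale (u v) v) = 0"
      using dependent_finite[of "set us"] by auto
    have "bij_betw (\<lambda>i. us ! i) {..<length us} (set us)" using d by (rule bij_betw_nth) auto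
    then have "(\<Sum>j<length us. scale (u (us ! j)) (us ! j)) = (\<Sum>v\<in>set us. scale (u v) v)"
      by (rule sum.reindex_bij_betw)
    then have "\<forall>j<length us. u (us ! j) = 0" using assms[of "\<lambda>j. u (us ! j)"] u(2) by simp
    then show False using u(1) by (auto simp: in_set_conv_nth)
  qed
qed

lemma zero_locus_iff:
  "L \<in> zero_locus s W P \<longleftrightarrow> (\<exists>f\<in>W. f \<noteq> 0 \<and> L = module.span s {f}) \<and> (\<forall>q\<in>P. \<forall>w\<in>L - {0}. q w = 0)"
  unfolding zero_locus_def proj_def by auto

text \<open>The space of dimension at least \<open>3\<close> whose dual carries the forms; \<open>vb\<close> is a basis of it.\<close>

locale finite_dual =
  fixes scale :: "complex \<Rightarrow> 'v::ab_group_add \<Rightarrow> 'v" and vb :: "'v list"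
  assumes vector_space: "vector_space scale" and vb: "ordered_basis scale UNIV vb" and vb3: "3 \<le> length vb"
begin

abbreviation "Vd \<equiv> dual scale UNIV"
abbreviation "G3 \<equiv> Gr fscale 3 Vd"
abbreviation "Ext \<equiv> ext_power_dual scale 3"

sublocale V: cspace scale UNIV
proof -
  interpret vector_space scale by (rule vector_space)
  show "cspace scale UNIV" by unfold_locales (rule subspace_UNIV)
qed

sublocale D: cspace fscale Vd
  by unfold_locales (rule V.subspace_dual)

sublocale X: cspace fscale Ext
  by unfold_locales (simp add: ext_power_dual_def)

lemma subspace_cspace: "FS.subspace E \<Longrightarrow> cspace fscale E" for E :: "('v \<Rightarrow> complex) set"
  by unfold_locales

lemma functional_zero:
  assumes "\<phi> \<in> Vd" "\<And>i. i < length vb \<Longrightarrow> \<phi> (vb ! i) = 0"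
  shows "\<phi> = 0"
proof
  fix v
  have "\<phi> v = \<phi> (\<Sum>i<length vb. scale (V.coord vb i v) (vb ! i))"
    using V.coord_sum[OF vb, of v] by simp
  also have "\<dots> = (\<Sum>i<length vb. \<phi> (scale (V.coord vb i v) (vb ! i)))"
    by (rule V.dual_sum[OF assms(1)]) auto
  also have "\<dots> = 0" using assms(2) by (simp add: V.dual_scale[OF assms(1)])
  finally show "\<phi> v = 0 v" by (simp add: zero_fun_apply)
qed

lemma Vd_finite: "Vd \<subseteq> FS.span (V.coord vb ` {..<length vb})"
  by (rule V.dual_spanned[OF vb])

lemma Gr_basis:
  assumes "E \<in> G3"
  obtains us where "ordered_basis fscale E us" "length us = 3"
proof -
  have E: "FS.subspace E" "E \<subseteq> Vd" "FS.dim E = 3" using assms by (auto simp: Gr_def)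
  obtain us where us: "ordered_basis fscale E us"
    using cspace.exists_ordered_basis[OF subspace_cspace[OF E(1)], of "V.coord vb ` {..<length vb}"] E(2) Vd_finite by auto
  have "FS.span E = E" using E(1) by (simp only: FS.span_eq_iff)
  then have "FS.span (set us) = FS.span E" using us by (simp only: ordered_basis_def)
  moreover have "FS.independent (set us)" using us by (simp add: ordered_basis_def)
  ultimately have "FS.dim E = card (set us)" by (rule FS.dim_eq_card)
  then show thesis using that us E(3) by (simp add: ordered_basis_def distinct_card)
qed

lemma Gr_span:
  assumes "set us \<subseteq> Vd" "distinct us" "FS.independent (set us)" "length us = 3"
  shows "FS.span (set us) \<in> G3" "ordered_basis fscale (FS.span (set us)) us"
proof -
  have "FS.dim (FS.span (set us)) = card (set us)"
    using assms(3) by (intro FS.dim_eq_card) (auto simp: FS.span_span)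
  then show "FS.span (set us) \<in> G3"
    using assms FS.span_minimal[OF assms(1) V.subspace_dual] by (simp add: Gr_def distinct_card)
  show "ordered_basis fscale (FS.span (set us)) us" using assms by (simp add: ordered_basis_def)
qed

lemma Gr_nonempty: "G3 \<noteq> {}"
proof -
  define us where "us = map (V.coord vb) [0..<3]"
  have len: "length us = 3" by (simp add: us_def)
  have "distinct us \<and> FS.independent (set us)"
  proof (rule FS.independent_list)
    fix x assume z: "(\<Sum>j<length us. fscale (x j) (us ! j)) = 0"
    show "\<forall>j<length us. x j = 0"
    proof (intro allI impI)
      fix k assume k: "k < length us"
      have "0 = (\<Sum>j<3. fscale (x j) (us ! j)) (vb ! k)" using z by (simp add: len zero_fun_apply)
      also have "\<dots> = (\<Sum>j<3. x j * (if j = k then 1 else 0))"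
        unfolding fun_sum_apply using k vb3
        by (intro sum.cong) (simp_all add: fun_simps us_def V.coord_basis[OF vb])
      also have "\<dots> = (\<Sum>j\<in>{k}. x j)" using k len by (intro sum.mono_neutral_cong_right) auto
      finally show "x k = 0" by simp
    qed
  qed
  moreover have "set us \<subseteq> Vd" using V.coord_dual[OF vb] by (auto simp: us_def)
  ultimately show ?thesis using Gr_span(1)[OF _ _ _ len] by blast
qed

lemma wedge_mem: "a \<in> Vd \<Longrightarrow> b \<in> Vd \<Longrightarrow> c \<in> Vd \<Longrightarrow> wedge [a, b, c] \<in> Ext"
  unfolding ext_power_dual_def by (rule FS.span_base) (auto intro!: exI[of _ "[a, b, c]"])

text \<open>
  In the matrix of values of the \<open>us\<close> on the basis \<open>vb\<close> the columns are independent, so it has a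
  non-zero minor of size \<open>3\<close>.
\<close>

lemma wedge_basis_nonzero:
  assumes us: "ordered_basis fscale E us" "length us = 3" and E: "FS.subspace E" "E \<subseteq> Vd"
  obtains vs where "wedge us vs \<noteq> 0"
proof -
  interpret E: cspace fscale E by (rule subspace_cspace[OF E(1)])
  have um: "us ! j \<in> Vd" if "j < 3" for j using E.basis_mem[OF us(1)] us(2) E(2) that by auto
  have "\<forall>j<3. x j = 0" if x: "\<forall>i<length vb. (\<Sum>j<3. (us ! j) (vb ! i) * x j) = 0" for x
  proof -
    define \<phi> where "\<phi> = (\<Sum>j<3. fscale (x j) (us ! j))"
    have "\<phi> \<in> Vd" unfolding \<phi>_def using um by (intro D.mem_sum D.mem_scale) auto
    moreover have "\<phi> (vb ! i) = 0" if "i < length vb" for i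
      using x that by (simp add: \<phi>_def fun_sum_apply fun_simps mult.commute)
    ultimately have "\<phi> = 0" by (rule functional_zero)
    then have "E.coord us j 0 = x j" if "j < 3" for j
      using E.coord_of_sum[OF us(1), of j x] us(2) that by (simp add: \<phi>_def)
    then show ?thesis using E.dual_0[OF E.coord_dual[OF us(1)]] by simp
  qed
  from exists_maximal_minor[where A = "\<lambda>i j. (us ! j) (vb ! i)" and n = "length vb" and m = 3, OF this]
  obtain I where I: "card I = 3" "Determinant.det (mat 3 3 (\<lambda>(i, j). (us ! j) (vb ! pick I i))) \<noteq> 0" by blast
  define vs where "vs = map (\<lambda>i. vb ! pick I i) [0..<3]"
  have "mat 3 3 (\<lambda>(i, j). (us ! j) (vs ! i)) = mat 3 3 (\<lambda>(i, j). (us ! j) (vb ! pick I i))"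
    by (rule cong_mat) (auto simp: vs_def)
  then have "wedge us vs \<noteq> 0" using I us(2) by (simp add: wedge_def vs_def)
  then show thesis by (rule that)
qed

text \<open>A change of basis multiplies the wedge product by its determinant.\<close>

lemma pluecker_eq:
  fixes E :: "('v \<Rightarrow> complex) set"
  assumes us: "ordered_basis fscale E us" "length us = 3" and E: "FS.subspace E"
  shows "pluecker E = FS.span {wedge us}"
proof -
  interpret E: cspace fscale E by (rule subspace_cspace[OF E])
  have "wedge ws \<in> FS.span {wedge us}" if ws: "ordered_basis fscale E ws" for ws
  proof -
    have len: "length ws = 3" using E.ordered_basis_unique_length[OF ws us(1)] us(2) by simp
    define M where "M = mat 3 3 (\<lambda>(k, j). E.coord us k (ws ! j))"
    have wj: "(ws ! j) v = (\<Sum>k<3. (us ! k) v * E.coord us k (ws ! j))" if "j < 3" for j v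
    proof -
      have "ws ! j = (\<Sum>k<3. fscale (E.coord us k (ws ! j)) (us ! k))"
        using E.coord_sum[OF us(1) E.basis_mem[OF ws]] us(2) len that by simp
      then have "(ws ! j) v = (\<Sum>k<3. fscale (E.coord us k (ws ! j)) (us ! k)) v" by (rule fun_cong)
      then show ?thesis by (simp add: fun_sum_apply fun_simps mult.commute)
    qed
    have "wedge ws = fscale (Determinant.det M) (wedge us)"
    proof
      fix vs :: "'v list"
      show "wedge ws vs = fscale (Determinant.det M) (wedge us) vs"
      proof (cases "length vs = 3")
        case True
        define U where "U = mat 3 3 (\<lambda>(i, k). (us ! k) (vs ! i))"
        have c: "U \<in> carrier_mat 3 3" "M \<in> carrier_mat 3 3" by (simp_all add: U_def M_def)
        have "mat 3 3 (\<lambda>(i, j). (ws ! j) (vs ! i)) = U * M"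
          by (rule eq_matI) (simp_all add: U_def M_def scalar_prod_def wj atLeast0LessThan)
        then show ?thesis
          using det_mult[OF c] True us(2) len by (simp add: wedge_def U_def fun_simps)
      next
        case False
        then show ?thesis using us(2) len by (simp add: wedge_def fun_simps)
      qed
    qed
    then show ?thesis by (simp add: FS.span_scale FS.span_base)
  qed
  then have "pluecker E \<subseteq> FS.span {wedge us}"
    unfolding pluecker_def by (intro FS.span_minimal FS.subspace_span) blast
  moreover have "FS.span {wedge us} \<subseteq> pluecker E"
    unfolding pluecker_def using us(1) by (intro FS.span_mono) blast
  ultimately show ?thesis by blast
qed

lemma pluecker_line_poly:
  assumes P: "P \<in> forms fscale Ext m" and F: "\<And>x. x \<in> Vd \<Longrightarrow> F x \<in> Ext"
    and lin: "\<And>x y t. F (x + fscale t y) = F x + fscale t (F y)"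
  shows "D.line_poly (\<lambda>x. P (F x) * F x vs0)"
  unfolding D.line_poly_def
proof (intro ballI)
  fix x y assume xy: "x \<in> Vd" "y \<in> Vd"
  obtain q where q: "\<And>t. P (F x + fscale t (F y)) = poly q t"
    using X.form_line[OF P F[OF xy(1)] F[OF xy(2)]] by blast
  have "P (F (x + fscale t y)) * F (x + fscale t y) vs0 = poly (q * [:F x vs0, F y vs0:]) t" for t
    unfolding lin q by (simp add: fun_simps q algebra_simps)
  then show "\<exists>q. \<forall>t. P (F (x + fscale t y)) * F (x + fscale t y) vs0 = poly q t" by blast
qed

section \<open>Reducibility and generic sections\<close>

text \<open>The whole Grassmannian is open: its complement is the zero locus of the constant \<open>1\<close>.\<close>

lemma generic_if_all:
  assumes "\<And>E. E \<in> G3 \<Longrightarrow> Q E"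
  shows "generic_Gr scale 3 Q"
proof -
  have one: "restr Ext (\<lambda>_. 1) \<in> forms fscale Ext 0" by (rule X.forms_one)
  have "pluecker E \<notin> zero_locus fscale Ext {restr Ext (\<lambda>_. 1)}" for E
  proof
    assume "pluecker E \<in> zero_locus fscale Ext {restr Ext (\<lambda>_. 1)}"
    then obtain w where w: "w \<in> Ext" "w \<noteq> 0" "pluecker E = FS.span {w}"
      and z: "\<forall>u\<in>pluecker E - {0}. restr Ext (\<lambda>_. 1) u = 0" by (auto simp: zero_locus_def proj_def)
    have "w \<in> pluecker E - {0}" using w by (simp add: FS.span_base)
    then have "restr Ext (\<lambda>_. 1) w = 0" using z by blast
    then show False using w(1) by (simp add: restr_apply)
  qed
  then have "zariski_closed_Gr scale 3 (G3 - G3)"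
    unfolding zariski_closed_Gr_def using one by (intro exI[of _ "{restr Ext (\<lambda>_. 1)}"]) auto
  then have "zariski_open_Gr scale 3 G3" by (simp add: zariski_open_Gr_def)
  then show ?thesis unfolding generic_Gr_def using Gr_nonempty assms by blast
qed

text \<open>
  A non-empty open set contains the span of \<open>p\<^sub>1\<close>, \<open>p\<^sub>0\<close>, \<open>b\<close> as soon as a certain function \<open>\<Psi>\<close>, a
  polynomial in each of the three vectors, does not vanish.  If \<open>f\<close> is irreducible, one can choose
  first \<open>p\<^sub>1\<close> with \<open>f p\<^sub>1 \<noteq> 0\<close>, then \<open>p\<^sub>0\<close> such that \<open>f\<close> has distinct roots on the line, and
  finally \<open>b\<close> by Bertini's theorem, keeping \<open>\<Psi>\<close> non-zero all along.
\<close>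

lemma reducible_if_generic:
  assumes f: "f \<in> forms fscale Vd d" and gen: "generic_Gr scale 3 (\<lambda>E. reducible fscale E d (restr E f))"
  shows "reducible fscale Vd d f"
proof (rule ccontr)
  assume irred: "\<not> reducible fscale Vd d f"
  obtain A where A: "zariski_open_Gr scale 3 A" "A \<noteq> {}" "\<And>E. E \<in> A \<Longrightarrow> reducible fscale E d (restr E f)"
    using gen by (auto simp: generic_Gr_def)
  then obtain E0 where E0: "E0 \<in> A" by blast
  have d: "2 \<le> d"
  proof -
    obtain k where "1 \<le> k" "k \<le> d - 1" using A(3)[OF E0] unfolding reducible_def by blast
    then show ?thesis by simp
  qed
  have sub: "A \<subseteq> G3" using A(1) by (simp add: zariski_open_Gr_def)
  obtain P where P: "P \<subseteq> (\<Union>m. forms fscale Ext m)"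
    "G3 - A = {E \<in> G3. pluecker E \<in> zero_locus fscale Ext P}"
    using A(1) unfolding zariski_open_Gr_def zariski_closed_Gr_def by blast
  have G0: "E0 \<in> G3" using E0 sub by blast
  then have E0s: "FS.subspace E0" "E0 \<subseteq> Vd" by (auto simp: Gr_def)
  obtain us where us: "ordered_basis fscale E0 us" "length us = 3" by (rule Gr_basis[OF G0])
  interpret E0: cspace fscale E0 by (rule subspace_cspace[OF E0s(1)])
  obtain vs0 where vs0: "wedge us vs0 \<noteq> 0" by (rule wedge_basis_nonzero[OF us E0s])
  define u1 u2 u3 where "u1 = us ! 0" and "u2 = us ! 1" and "u3 = us ! 2"
  have us3: "us = [u1, u2, u3]" using E0.list3 us(2) by (simp add: u1_def u2_def u3_def numeral_3_eq_3 length_Suc_conv, auto)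
  have um: "u1 \<in> Vd" "u2 \<in> Vd" "u3 \<in> Vd"
    using E0.basis_mem[OF us(1)] us(2) E0s(2) by (auto simp: u1_def u2_def u3_def)
  have pl: "pluecker E0 = FS.span {wedge us}" by (rule pluecker_eq[OF us E0s(1)])
  have w0: "wedge us \<noteq> 0" using vs0 by (auto simp: zero_fun_apply)
  have wE: "wedge us \<in> Ext" unfolding us3 using um by (rule wedge_mem)
  then have "pluecker E0 \<in> proj fscale Ext" unfolding proj_def pl using w0 by blast
  moreover have "pluecker E0 \<notin> zero_locus fscale Ext P" using P(2) E0 G0 by blast
  ultimately obtain p w where pw: "p \<in> P" "w \<in> pluecker E0" "w \<noteq> 0" "p w \<noteq> 0"
    by (auto simp: zero_locus_def)
  obtain m where pm: "p \<in> forms fscale Ext m" using P(1) pw(1) by blast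
  obtain c where c: "w = fscale c (wedge us)" using pw(2) unfolding pl FS.span_singleton by blast
  have pus: "p (wedge us) \<noteq> 0"
    using pw(4) X.forms_homogeneous[OF pm wE, of c] unfolding c by auto
  \<comment> \<open>The first factor says that the span lies in \<open>A\<close>, the second that the vectors are independent.\<close>
  define \<Psi> where "\<Psi> a b c = p (wedge [a, b, c]) * wedge [a, b, c] vs0" for a b c
  have \<Psi>u: "\<Psi> u1 u2 u3 \<noteq> 0" using pus vs0 by (simp add: \<Psi>_def us3)
  have lp1: "D.line_poly (\<lambda>a. \<Psi> a b c)" if "b \<in> Vd" "c \<in> Vd" for b c
    unfolding \<Psi>_def using that by (intro pluecker_line_poly[OF pm, of "\<lambda>a. wedge [a, b, c]"] wedge_mem wedge_linear)
  have lp2: "D.line_poly (\<lambda>b. \<Psi> a b c)" if "a \<in> Vd" "c \<in> Vd" for a c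
    unfolding \<Psi>_def using that by (intro pluecker_line_poly[OF pm, of "\<lambda>b. wedge [a, b, c]"] wedge_mem wedge_linear)
  have lp3: "D.line_poly (\<lambda>c. \<Psi> a b c)" if "a \<in> Vd" "b \<in> Vd" for a b
    unfolding \<Psi>_def using that by (intro pluecker_line_poly[OF pm, of "\<lambda>c. wedge [a, b, c]"] wedge_mem wedge_linear)
  have "f \<noteq> 0" using irred D.reducible_zero[OF d] by auto
  then obtain q where q: "f q \<noteq> 0" by (metis ext zero_fun_apply)
  then have qV: "q \<in> Vd" using D.forms_outside[OF f] by blast
  obtain p1 where p1: "p1 \<in> Vd" "\<Psi> p1 u2 u3 \<noteq> 0" "f p1 \<noteq> 0"
    using D.line_poly_common_nonzero[OF lp1[OF um(2,3)] D.forms_line_poly[OF f] um(1) \<Psi>u qV q] by blast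
  obtain p0 where p0: "p0 \<in> Vd" "\<Psi> p1 p0 u3 \<noteq> 0" "card {x. f (fscale x p1 + p0) = 0} = d"
    using D.exists_separable_line[OF f _ p1(1,3) lp2[OF p1(1) um(3)] um(2) p1(2) irred] d by auto
  obtain b where b: "b \<in> Vd" "\<Psi> p1 p0 b \<noteq> 0"
    "\<And>E. FS.subspace E \<Longrightarrow> E \<subseteq> Vd \<Longrightarrow> {p1, p0, b} \<subseteq> E \<Longrightarrow> \<not> reducible fscale E d (restr E f)"
    using D.bertini[OF f p1(1) p0(1) p1(3) p0(3) lp3[OF p1(1) p0(1)] um(3) p0(2) irred] by blast
  let ?ws = "[p1, p0, b]"
  have ne: "wedge ?ws vs0 \<noteq> 0" "p (wedge ?ws) \<noteq> 0" using b(2) by (auto simp: \<Psi>_def)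
  have len: "length ?ws = 3" by simp
  have "distinct ?ws \<and> FS.independent (set ?ws)"
  proof (rule FS.independent_list)
    fix x assume "(\<Sum>j<length ?ws. fscale (x j) (?ws ! j)) = 0"
    then show "\<forall>j<length ?ws. x j = 0"
      using wedge_nonzero_independent[OF len ne(1), of x] unfolding len by blast
  qed
  moreover have "set ?ws \<subseteq> Vd" using p1 p0 b by simp
  ultimately have E: "FS.span (set ?ws) \<in> G3" "ordered_basis fscale (FS.span (set ?ws)) ?ws"
    using Gr_span[OF _ _ _ len] by blast+
  let ?E = "FS.span (set ?ws)"
  have sE: "FS.subspace ?E" "?E \<subseteq> Vd" using E(1) by (auto simp: Gr_def)
  have "?E \<in> A"
  proof (rule ccontr)
    assume "?E \<notin> A"
    then have "pluecker ?E \<in> zero_locus fscale Ext P" using P(2) E(1) by blast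
    moreover have "wedge ?ws \<in> pluecker ?E" unfolding pluecker_eq[OF E(2) len sE(1)] by (rule FS.span_base) simp
    moreover have "wedge ?ws \<noteq> 0" using ne(1) by (auto simp: zero_fun_apply)
    ultimately have "p (wedge ?ws) = 0" using pw(1) unfolding zero_locus_def by blast
    then show False using ne(2) by contradiction
  qed
  then have "reducible fscale ?E d (restr ?E f)" by (rule A(3))
  moreover have "{p1, p0, b} \<subseteq> ?E" using FS.span_superset[of "set ?ws"] by auto
  ultimately show False using b(3)[OF sE] by blast
qed

lemma reducible_iff_sections:
  assumes f: "f \<in> forms fscale Vd d"
  shows "reducible fscale Vd d f \<longleftrightarrow> generic_Gr scale 3 (\<lambda>E. reducible fscale E d (restr E f))"
    and "reducible fscale Vd d f \<longleftrightarrow> (\<forall>E\<in>G3. reducible fscale E d (restr E f))"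
proof -
  have "reducible fscale E d (restr E f)" if "reducible fscale Vd d f" "E \<in> G3" for E
    using D.reducible_restrict that by (auto simp: Gr_def)
  moreover have "generic_Gr scale 3 (\<lambda>E. reducible fscale E d (restr E f))"
    if "\<forall>E\<in>G3. reducible fscale E d (restr E f)" by (rule generic_if_all) (use that in blast)
  ultimately show "reducible fscale Vd d f \<longleftrightarrow> generic_Gr scale 3 (\<lambda>E. reducible fscale E d (restr E f))"
    and "reducible fscale Vd d f \<longleftrightarrow> (\<forall>E\<in>G3. reducible fscale E d (restr E f))"
    using reducible_if_generic[OF f] by blast+
qed

section \<open>Finitely many sections suffice\<close>

text \<open>The generators of the ideal of one section.\<close>

definition minors :: "nat \<Rightarrow> ('v \<Rightarrow> complex) set \<Rightarrow> ('v \<Rightarrow> complex) list \<Rightarrow> (nat \<Rightarrow> ('v \<Rightarrow> complex) \<Rightarrow> complex) list \<Rightarrow>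
    (('v \<Rightarrow> complex) \<Rightarrow> complex) list \<Rightarrow> ((('v \<Rightarrow> complex) \<Rightarrow> complex) \<Rightarrow> complex) set" where
  "minors d E es bs cs = {restr (forms fscale Vd d)
     (\<lambda>f. Determinant.det (submatrix (matrix_wrt (ruppert_map fscale es (restr E f)) bs cs) I J)) | I J.
        I \<subseteq> {..<length cs} \<and> card I = d\<^sup>2 - 1 \<and> J \<subseteq> {..<length bs} \<and> card J = d\<^sup>2 - 1}"

lemma minors_forms:
  assumes "E \<in> G3" "3 \<le> d" "ruppert_bases fscale E d (d - 2) es bs cs"
  shows "minors d E es bs cs \<subseteq> forms fscale (forms fscale Vd d) (d\<^sup>2 - 1)"
proof
  fix q assume "q \<in> minors d E es bs cs"
  then obtain I J where IJ: "I \<subseteq> {..<length cs}" "card I = d\<^sup>2 - 1" "J \<subseteq> {..<length bs}" "card J = d\<^sup>2 - 1"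
    and q: "q = restr (forms fscale Vd d) (\<lambda>f. Determinant.det (submatrix (matrix_wrt (ruppert_map fscale es (restr E f)) bs cs) I J))"
    unfolding minors_def by blast
  show "q \<in> forms fscale (forms fscale Vd d) (d\<^sup>2 - 1)"
    unfolding q using assms(1,2) by (intro D.minor_forms[OF _ _ assms(3) _ IJ]) (auto simp: Gr_def)
qed

lemma minors_vanish_iff:
  assumes "E \<in> G3" "3 \<le> d" "ruppert_bases fscale E d (d - 2) es bs cs" and f: "f \<in> forms fscale Vd d"
  shows "(\<forall>q\<in>minors d E es bs cs. q f = 0) \<longleftrightarrow> reducible fscale E d (restr E f)"
proof -
  have E: "FS.subspace E" "E \<subseteq> Vd" using assms(1) by (auto simp: Gr_def)
  interpret E: cspace fscale E by (rule subspace_cspace[OF E(1)])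
  obtain us where us: "ordered_basis fscale E us" "length us = 3" by (rule Gr_basis[OF assms(1)])
  have "ordered_basis fscale E es" using assms(3) by (simp add: ruppert_bases_def)
  then have len: "length es = 3" using E.ordered_basis_unique_length[OF _ us(1)] us(2) by simp
  have "(\<forall>q\<in>minors d E es bs cs. q f = 0) \<longleftrightarrow>
    (\<forall>I J. I \<subseteq> {..<length cs} \<and> card I = d\<^sup>2 - 1 \<and> J \<subseteq> {..<length bs} \<and> card J = d\<^sup>2 - 1
      \<longrightarrow> Determinant.det (submatrix (matrix_wrt (ruppert_map fscale es (restr E f)) bs cs) I J) = 0)" (is "?L \<longleftrightarrow> ?R")
  proof
    assume L: ?L
    show ?R
    proof (intro allI impI)
      fix I J assume "I \<subseteq> {..<length cs} \<and> card I = d\<^sup>2 - 1 \<and> J \<subseteq> {..<length bs} \<and> card J = d\<^sup>2 - 1"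
      then have "restr (forms fscale Vd d) (\<lambda>f. Determinant.det (submatrix (matrix_wrt (ruppert_map fscale es (restr E f)) bs cs) I J))
          \<in> minors d E es bs cs" unfolding minors_def by blast
      from L[rule_format, OF this] f
      show "Determinant.det (submatrix (matrix_wrt (ruppert_map fscale es (restr E f)) bs cs) I J) = 0"
        by (simp add: restr_apply)
    qed
  next
    assume ?R
    then show ?L using f by (auto simp: minors_def restr_apply)
  qed
  also have "\<dots> \<longleftrightarrow> reducible fscale E d (restr E f)"
    by (rule E.ruppert_minors_zero_iff[OF assms(3) len assms(2) D.forms_restrict[OF E f]])
  finally show ?thesis .
qed

text \<open>
  All minors, for all \<open>E\<close>, lie in one finite-dimensional space of polynomials; the subspaces whose
  minors contribute to a basis of their span suffice.
\<close>

lemma finitely_many_sections: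
  assumes d: "3 \<le> d"
  shows "\<exists>Es. set Es \<subseteq> G3 \<and> (\<forall>f\<in>forms fscale Vd d.
    (\<forall>E\<in>set Es. reducible fscale E d (restr E f)) \<longrightarrow> reducible fscale Vd d f)"
proof -
  let ?S = "forms fscale Vd d"
  have "\<exists>es bs cs. ruppert_bases fscale E d (d - 2) es bs cs" if E: "E \<in> G3" for E
  proof -
    obtain us where us: "ordered_basis fscale E us" "length us = 3" by (rule Gr_basis[OF E])
    interpret E: cspace fscale E using E by (intro subspace_cspace) (simp add: Gr_def)
    have "1 \<le> d - 2" using d by linarith
    from E.exists_ruppert_bases[OF us this] show ?thesis by blast
  qed
  then obtain es bs cs where B: "\<And>E. E \<in> G3 \<Longrightarrow> ruppert_bases fscale E d (d - 2) (es E) (bs E) (cs E)" by metis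
  define M where "M E = minors d E (es E) (bs E) (cs E)" for E
  obtain db where db: "ordered_basis fscale Vd db"
    using D.exists_ordered_basis[OF _ Vd_finite] by auto
  obtain T where T: "finite T" "?S \<subseteq> FS.span T" using D.forms_finitely_spanned[OF db] by blast
  interpret F: cspace fscale ?S by (rule D.forms_cspace)
  obtain fb where fb: "ordered_basis fscale ?S fb" using F.exists_ordered_basis[OF T] by blast
  obtain T' where T': "finite T'" "forms fscale ?S (d\<^sup>2 - 1) \<subseteq> FS.span T'" using F.forms_finitely_spanned[OF fb] by blast
  define U where "U = (\<Union>E\<in>G3. M E)"
  have UT: "U \<subseteq> FS.span T'" using minors_forms[OF _ d B] T'(2) by (auto simp: U_def M_def)
  obtain C where C: "C \<subseteq> U" "FS.independent C" "U \<subseteq> FS.span C"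
    using FS.maximal_independent_subset[of U] by blast
  have finC: "finite C" using FS.independent_span_bound[OF T'(1) C(2)] C(1) UT by blast
  have "\<forall>q\<in>C. \<exists>E\<in>G3. q \<in> M E" using C(1) by (auto simp: U_def)
  then obtain h where h: "\<And>q. q \<in> C \<Longrightarrow> h q \<in> G3" "\<And>q. q \<in> C \<Longrightarrow> q \<in> M (h q)" by metis
  obtain Es where Es: "set Es = h ` C" using finite_list[of "h ` C"] finC by auto
  show ?thesis
  proof (intro exI[of _ Es] conjI ballI impI)
    show "set Es \<subseteq> G3" using Es h(1) by auto
    fix f assume f: "f \<in> ?S" and red: "\<forall>E\<in>set Es. reducible fscale E d (restr E f)"
    have "q f = 0" if "q \<in> C" for q
    proof -
      have "reducible fscale (h q) d (restr (h q) f)" using red Es that by auto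
      then have "\<forall>q'\<in>M (h q). q' f = 0"
        unfolding M_def using minors_vanish_iff[OF h(1)[OF that] d B[OF h(1)[OF that]] f] by blast
      then show ?thesis using h(2)[OF that] by blast
    qed
    then have "FS.span C \<subseteq> {q. q f = 0}"
      by (intro FS.span_minimal FS.subspaceI) (auto simp: fun_simps)
    then have z: "q f = 0" if "E \<in> G3" "q \<in> M E" for E q using that C(3) by (auto simp: U_def)
    have "reducible fscale E d (restr E f)" if E: "E \<in> G3" for E
      using minors_vanish_iff[OF E d B[OF E] f] z[OF E] by (auto simp: M_def)
    then show "reducible fscale Vd d f" using reducible_iff_sections(2)[OF f] by blast
  qed
qed

text \<open>
  The minors belong to the ideal, and all polynomials vanishing at a given reducible form are an
  ideal that contains the minors.
\<close>

lemma zero_locus_minors: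
  assumes d: "3 \<le> d" and Es: "set Es \<subseteq> G3"
    and suff: "\<And>f. f \<in> forms fscale Vd d \<Longrightarrow> (\<forall>E\<in>set Es. reducible fscale E d (restr E f)) \<Longrightarrow> reducible fscale Vd d f"
    and B: "\<And>j. j < length Es \<Longrightarrow> ruppert_bases fscale (Es ! j) d (d - 2) (es j) (bs j) (cs j)"
  shows "zero_locus fscale (forms fscale Vd d)
     (ideal_sum (coord_ring fscale (forms fscale Vd d))
       (map (\<lambda>j. ruppert_minor_ideal fscale Vd d (d\<^sup>2 - 1) (Es ! j) (es j) (bs j) (cs j)) [0..<length Es]))
     = reducible_variety fscale Vd d" (is "zero_locus _ ?S ?I = _")
proof -
  interpret F: cspace fscale ?S by (rule D.forms_cspace)
  let ?R = "coord_ring fscale ?S"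
  define M where "M j = minors d (Es ! j) (es j) (bs j) (cs j)" for j
  have rmi: "ruppert_minor_ideal fscale Vd d (d\<^sup>2 - 1) (Es ! j) (es j) (bs j) (cs j) = Idl\<^bsub>?R\<^esub> (M j)" for j
    by (simp add: ruppert_minor_ideal_def M_def minors_def)
  have G: "Es ! j \<in> G3" if "j < length Es" for j using Es that nth_mem by blast
  have iff: "(\<forall>q\<in>M j. q f = 0) \<longleftrightarrow> reducible fscale (Es ! j) d (restr (Es ! j) f)"
    if "j < length Es" "f \<in> ?S" for j f
    unfolding M_def by (rule minors_vanish_iff[OF G[OF that(1)] d B[OF that(1)] that(2)])
  have MI: "M j \<subseteq> ?I" if j: "j < length Es" for j
  proof
    fix q assume "q \<in> M j"
    then have "q \<in> Idl\<^bsub>?R\<^esub> (M j)" by (auto simp: genideal_def)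
    moreover have "0 \<in> Idl\<^bsub>?R\<^esub> (M k)" for k
    proof -
      have "0 \<in> I" if "ideal I ?R" for I
        using additive_subgroup.zero_closed[OF ideal.axioms(1)[OF that]] by (simp add: coord_ring_def)
      then show ?thesis by (auto simp: genideal_def)
    qed
    ultimately show "q \<in> ?I"
      using j unfolding rmi by (intro F.ideal_sum_superset[of _ "Idl\<^bsub>?R\<^esub> (M j)"]) auto
  qed
  have IV: "?I \<subseteq> {q \<in> polys fscale ?S. q w = 0}" if w: "w \<in> ?S" "reducible fscale Vd d w" for w
  proof (rule F.ideal_sum_vanishing)
    fix I assume "I \<in> set (map (\<lambda>j. ruppert_minor_ideal fscale Vd d (d\<^sup>2 - 1) (Es ! j) (es j) (bs j) (cs j)) [0..<length Es])"
    then obtain j where j: "j < length Es" "I = Idl\<^bsub>?R\<^esub> (M j)" unfolding rmi by auto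
    have "reducible fscale (Es ! j) d (restr (Es ! j) w)"
      using reducible_iff_sections(2)[OF w(1)] w(2) G[OF j(1)] by blast
    then have "M j \<subseteq> {q \<in> polys fscale ?S. q w = 0}"
      using iff[OF j(1) w(1)] minors_forms[OF G[OF j(1)] d B[OF j(1)]] F.forms_polys unfolding M_def by blast
    then show "I \<subseteq> {q \<in> polys fscale ?S. q w = 0}"
      using F.vanishing_ideal[of w] unfolding j(2) genideal_def by blast
  qed
  note ZI = zero_locus_iff[of _ fscale ?S ?I]
  show ?thesis
  proof (intro equalityI subsetI)
    fix L assume L: "L \<in> zero_locus fscale ?S ?I"
    obtain f where f: "f \<in> ?S" "f \<noteq> 0" "L = FS.span {f}" using L[unfolded ZI, THEN conjunct1] by (elim bexE conjE)
    have z: "q w = 0" if "q \<in> ?I" "w \<in> L - {0}" for q w by (rule L[unfolded ZI, THEN conjunct2, rule_format, OF that])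
    have "f \<in> L - {0}" using f by (simp add: FS.span_base)
    then have "q f = 0" if "q \<in> M j" "j < length Es" for q j
      by (rule z[OF subsetD[OF MI[OF that(2)] that(1)]])
    then have "reducible fscale (Es ! j) d (restr (Es ! j) f)" if "j < length Es" for j
      using iff[OF that f(1)] that by blast
    then have "\<forall>E\<in>set Es. reducible fscale E d (restr E f)" by (metis in_set_conv_nth)
    then have "reducible fscale Vd d f" by (rule suff[OF f(1)])
    then show "L \<in> reducible_variety fscale Vd d" unfolding reducible_variety_def using f by blast
  next
    fix L assume "L \<in> reducible_variety fscale Vd d"
    then obtain f where f: "f \<in> ?S" "f \<noteq> 0" "L = FS.span {f}" "reducible fscale Vd d f"
      unfolding reducible_variety_def by blast
    have "q w = 0" if q: "q \<in> ?I" and w: "w \<in> L" for q w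
    proof -
      obtain c where c: "w = fscale c f" using w unfolding f(3) FS.span_singleton by blast
      have "w \<in> ?S" unfolding c by (rule D.forms_scale[OF f(1)])
      moreover have "reducible fscale Vd d w" unfolding c by (rule D.reducible_scale[OF f(4)])
      ultimately have "?I \<subseteq> {q \<in> polys fscale ?S. q w = 0}" by (rule IV)
      from subsetD[OF this q] show ?thesis by simp
    qed
    then show "L \<in> zero_locus fscale ?S ?I" unfolding ZI using f(1-3) by (intro conjI bexI[of _ f] ballI) auto
  qed
qed

end

theorem theorem3p8:
  fixes scale :: "complex \<Rightarrow> 'v::ab_group_add \<Rightarrow> 'v" and n d :: nat
  defines "Vd \<equiv> dual scale (UNIV :: 'v set)"
  assumes "vector_space scale" and "vector_space.dim scale (UNIV :: 'v set) = n + 1" and "n \<ge> 2"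
  shows "(\<forall>f \<in> forms fscale Vd d.
            (reducible fscale Vd d f \<longleftrightarrow>
               generic_Gr scale 3 (\<lambda>E. reducible fscale E d (restr E f))) \<and>
            (reducible fscale Vd d f \<longleftrightarrow>
               (\<forall>E \<in> Gr fscale 3 Vd. reducible fscale E d (restr E f)))) \<and>
         (d \<ge> 3 \<longrightarrow>
            (\<exists>Es. set Es \<subseteq> Gr fscale 3 Vd \<and>
               (\<forall>es bs cs.
                  (\<forall>j<length Es. ruppert_bases fscale (Es ! j) d (d - 2) (es j) (bs j) (cs j)) \<longrightarrow>
                  zero_locus fscale (forms fscale Vd d)
                    (ideal_sum (coord_ring fscale (forms fscale Vd d))
                       (map (\<lambda>j. ruppert_minor_ideal fscale Vd d (d\<^sup>2 - 1) (Es ! j) (es j) (bs j) (cs j))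
                          [0..<length Es]))
                  = reducible_variety fscale Vd d)))"
proof -
  interpret V: vector_space scale by fact
  obtain B where B: "V.independent B" "UNIV \<subseteq> V.span B" "card B = n + 1"
    using V.basis_exists[of UNIV] assms(3) by metis
  have "finite B" using B(3) by (metis Suc_eq_plus1 card.infinite nat.distinct(1))
  then obtain vb where vb: "set vb = B" "distinct vb" using finite_distinct_list by blast
  have "length vb = n + 1" using vb B(3) by (metis distinct_card)
  then interpret finite_dual scale vb
    using assms(2,4) vb B by unfold_locales (auto simp: ordered_basis_def)
  have "\<exists>Es. set Es \<subseteq> Gr fscale 3 Vd \<and>
               (\<forall>es bs cs.
                  (\<forall>j<length Es. ruppert_bases fscale (Es ! j) d (d - 2) (es j) (bs j) (cs j)) \<longrightarrow>
                  zero_locus fscale (forms fscale Vd d)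
                    (ideal_sum (coord_ring fscale (forms fscale Vd d))
                       (map (\<lambda>j. ruppert_minor_ideal fscale Vd d (d\<^sup>2 - 1) (Es ! j) (es j) (bs j) (cs j))
                          [0..<length Es]))
                  = reducible_variety fscale Vd d)" if d: "3 \<le> d"
  proof -
    obtain Es where Es: "set Es \<subseteq> G3" "\<And>f. f \<in> forms fscale (dual scale UNIV) d \<Longrightarrow>
        (\<forall>E\<in>set Es. reducible fscale E d (restr E f)) \<Longrightarrow> reducible fscale (dual scale UNIV) d f"
      using finitely_many_sections[OF d] by blast
    show ?thesis
      unfolding Vd_def using Es(1) zero_locus_minors[OF d Es] by (intro exI[of _ Es]) blast
  qed
  then show ?thesis using reducible_iff_sections unfolding Vd_def by blast
qed

end
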